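(* There is a constant $c_0>0$ independent of $h$ such that for every constant $c\ge c_0$ independent of $h$ there exists a positive constant $C$ independent of $h$ with the following property. Let $\Omega'\subset\subset\Omega''\subset\subset\Omega$ be such that $d:=\mathrm{dist}(\partial\Omega',\partial\Omega'')>c\,h$. If $\boldsymbol\xi_h\in\boldsymbol\Sigma_h$ satisfies $$(\mathbf{curl}\,\boldsymbol\xi_h,\mathbf{curl}\,\boldsymbol\psi_h)=0\quad\forall\,\boldsymbol\psi_h\in\boldsymbol\Sigma_{h,0},$$ then $$\|\mathbf{curl}\,\boldsymbol\xi_h\|_{\mathbf L^2(\Omega')}\le C\,d^{-1}\,\|\boldsymbol\xi_h\|_{\mathbf L^2(\Omega'')}.$$
   Context: $\Omega\subset\mathbb R^3$ is a bounded Lipschitz polygonal (i.e. polyhedral) domain with exactly one connected component. $(\cdot,\cdot)$ is the $\mathbf L^2(\Omega)$ inner product. $\mathbf H(\mathbf{curl})$ is the usual space on $\Omega$ and $\mathbf H_0(\mathbf{curl})$ its subspace with vanishing tangential trace on $\partial\Omega$. $\Omega',\Omega''$ are subdomains, $A\subset\subset B$ means that $A$ is compactly contained in $B$. $\{\mathcal T_h\}$ is a shape-regular and quasi-uniform family of simplicial triangulations of $\Omega$ with mesh width $h$; $k\ge 1$ is a fixed integer; $\boldsymbol{\mathcal P}_{k-1}$ denotes vector fields whose three components are polynomials of total degree $\le k-1$, and $\mathbf x$ is the position vector. The Nédélec spaces are $\boldsymbol\Sigma_h=\{\mathbf v\in\mathbf H(\mathbf{curl}):\mathbf v|_T\in\boldsymbol{\mathcal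 P}_{k-1}+\mathbf x\times\boldsymbol{\mathcal P}_{k-1}\ \forall T\in\mathcal T_h\}$ and $\boldsymbol\Sigma_{h,0}=\boldsymbol\Sigma_h\cap\mathbf H_0(\mathbf{curl})$. Convention on constants: $C$ may depend on $\Omega$, the mesh regularity and $k$, but not on the mesh size. *)

theory Defs
  imports "HOL-Analysis.Analysis"
begin

section \<open>Geometry of the domain\<close>

text \<open>
  Near each boundary point the domain is, after an orthogonal change of coordinates, the open
  region above the graph of a Lipschitz function of two variables.
\<close>

definition lipschitz_boundary :: "(real^3) set \<Rightarrow> bool" where
  "lipschitz_boundary \<Omega> \<longleftrightarrow>
     (\<forall>p\<in>frontier \<Omega>. \<exists>r>0. \<exists>(F :: real^3 \<Rightarrow> real^3) (g :: real^2 \<Rightarrow> real) L.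
        orthogonal_transformation F \<and> L-lipschitz_on UNIV g \<and>
        \<Omega> \<inter> ball p r = {x \<in> ball p r. g (vector [F x $ 1, F x $ 2]) < F x $ 3})"

text \<open>
  The library's \<^const>\<open>polyhedron\<close> and \<^const>\<open>polytope\<close> are convex; a polyhedral domain
  in the sense of finite elements is one whose closure is a finite union of polytopes.
\<close>

definition lipschitz_polyhedral_domain :: "(real^3) set \<Rightarrow> bool" where
  "lipschitz_polyhedral_domain \<Omega> \<longleftrightarrow>
     open \<Omega> \<and> \<Omega> \<noteq> {} \<and> bounded \<Omega> \<and> connected \<Omega> \<and> lipschitz_boundary \<Omega> \<and>
     (\<exists>\<P>. finite \<P> \<and> (\<forall>P\<in>\<P>. polytope P) \<and> closure \<Omega> = \<Union>\<P>)"

definition compactly_contained :: "'a::topological_space set \<Rightarrow> 'a set \<Rightarrow> bool" where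
  "compactly_contained A B \<longleftrightarrow> compact (closure A) \<and> closure A \<subseteq> B"

section \<open>Square-integrable vector fields\<close>

definition square_integrable :: "(real^3) set \<Rightarrow> (real^3 \<Rightarrow> real^3) \<Rightarrow> bool" where
  "square_integrable \<Omega> v \<longleftrightarrow>
     v \<in> borel_measurable (lebesgue_on \<Omega>) \<and> integrable (lebesgue_on \<Omega>) (\<lambda>x. (norm (v x))\<^sup>2)"

definition L2_inner :: "(real^3) set \<Rightarrow> (real^3 \<Rightarrow> real^3) \<Rightarrow> (real^3 \<Rightarrow> real^3) \<Rightarrow> real" where
  "L2_inner \<Omega> v w = integral\<^sup>L (lebesgue_on \<Omega>) (\<lambda>x. v x \<bullet> w x)"

definition L2_norm :: "(real^3) set \<Rightarrow> (real^3 \<Rightarrow> real^3) \<Rightarrow> real" where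
  "L2_norm \<Omega> v = sqrt (integral\<^sup>L (lebesgue_on \<Omega>) (\<lambda>x. (norm (v x))\<^sup>2))"

section \<open>Smooth fields and the classical curl\<close>

definition partial_deriv :: "3 \<Rightarrow> (real^3 \<Rightarrow> real^3) \<Rightarrow> real^3 \<Rightarrow> real^3" where
  "partial_deriv i f x = frechet_derivative f (at x) (axis i 1)"

primrec Ck_field :: "nat \<Rightarrow> (real^3 \<Rightarrow> real^3) \<Rightarrow> bool" where
  "Ck_field 0 f \<longleftrightarrow> continuous_on UNIV f"
| "Ck_field (Suc n) f \<longleftrightarrow>
     (\<forall>x. f differentiable (at x)) \<and> (\<forall>i. Ck_field n (partial_deriv i f))"

definition smooth_field :: "(real^3 \<Rightarrow> real^3) \<Rightarrow> bool" where
  "smooth_field f \<longleftrightarrow> (\<forall>n. Ck_field n f)"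

definition test_field :: "(real^3) set \<Rightarrow> (real^3 \<Rightarrow> real^3) \<Rightarrow> bool" where
  "test_field \<Omega> \<phi> \<longleftrightarrow>
     smooth_field \<phi> \<and> compact (closure {x. \<phi> x \<noteq> 0}) \<and> closure {x. \<phi> x \<noteq> 0} \<subseteq> \<Omega>"

definition classical_curl :: "(real^3 \<Rightarrow> real^3) \<Rightarrow> real^3 \<Rightarrow> real^3" where
  "classical_curl f x = vector
     [partial_deriv 2 f x $ 3 - partial_deriv 3 f x $ 2,
      partial_deriv 3 f x $ 1 - partial_deriv 1 f x $ 3,
      partial_deriv 1 f x $ 2 - partial_deriv 2 f x $ 1]"

section \<open>The spaces $H(curl)$ and $H_0(curl)$\<close>

definition has_weak_curl ::
    "(real^3) set \<Rightarrow> (real^3 \<Rightarrow> real^3) \<Rightarrow> (real^3 \<Rightarrow> real^3) \<Rightarrow> bool" where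
  "has_weak_curl \<Omega> v w \<longleftrightarrow>
     square_integrable \<Omega> v \<and> square_integrable \<Omega> w \<and>
     (\<forall>\<phi>. test_field \<Omega> \<phi> \<longrightarrow> L2_inner \<Omega> w \<phi> = L2_inner \<Omega> v (classical_curl \<phi>))"

definition Hcurl :: "(real^3) set \<Rightarrow> (real^3 \<Rightarrow> real^3) set" where
  "Hcurl \<Omega> = {v. \<exists>w. has_weak_curl \<Omega> v w}"

text \<open>
  Elements of the function spaces are representatives, not classes modulo null sets. The weak curl
  on an open set is unique up to a null set, so the choice below affects no integral over a
  measurable subset of \<open>\<Omega>\<close>.
\<close>

definition weak_curl :: "(real^3) set \<Rightarrow> (real^3 \<Rightarrow> real^3) \<Rightarrow> real^3 \<Rightarrow> real^3" where
  "weak_curl \<Omega> v = (SOME w. has_weak_curl \<Omega> v w)"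

text \<open>
  For a Lipschitz domain with outward unit normal \<open>n\<close>, the tangential trace \<open>n \<times> v\<close> of a field
  in $H(curl)$ is the functional on the boundary which Green's formula assigns to it: for \<open>v\<close> and
  \<open>\<phi>\<close> smooth up to the boundary, the boundary integral of \<open>(n \<times> v) \<bullet> \<phi>\<close> is the difference
  below. Fields smooth up to the boundary are represented by smooth fields on the whole space.
\<close>

definition tangential_trace ::
    "(real^3) set \<Rightarrow> (real^3 \<Rightarrow> real^3) \<Rightarrow> (real^3 \<Rightarrow> real^3) \<Rightarrow> real" where
  "tangential_trace \<Omega> v \<phi> = L2_inner \<Omega> (weak_curl \<Omega> v) \<phi> - L2_inner \<Omega> v (classical_curl \<phi>)"

definition Hcurl0 :: "(real^3) set \<Rightarrow> (real^3 \<Rightarrow> real^3) set" where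
  "Hcurl0 \<Omega> = {v \<in> Hcurl \<Omega>. \<forall>\<phi>. smooth_field \<phi> \<longrightarrow> tangential_trace \<Omega> v \<phi> = 0}"

section \<open>Simplicial meshes\<close>

text \<open>Meshes consist of closed tetrahedra; \<^const>\<open>triangulation\<close> supplies conformity.\<close>

definition tetrahedral_mesh :: "(real^3) set \<Rightarrow> (real^3) set set \<Rightarrow> bool" where
  "tetrahedral_mesh \<Omega> \<T> \<longleftrightarrow>
     triangulation \<T> \<and> (\<forall>T\<in>\<T>. 3 simplex T) \<and> \<Union>\<T> = closure \<Omega>"

definition mesh_width :: "(real^3) set set \<Rightarrow> real" where
  "mesh_width \<T> = Max (diameter ` \<T>)"

definition inball_diameter :: "(real^3) set \<Rightarrow> real" where
  "inball_diameter T = Sup {2 * r | r. 0 \<le> r \<and> (\<exists>x. cball x r \<subseteq> T)}"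

definition shape_regular :: "real \<Rightarrow> (real^3) set set set \<Rightarrow> bool" where
  "shape_regular \<sigma> \<M> \<longleftrightarrow> (\<forall>\<T>\<in>\<M>. \<forall>T\<in>\<T>. diameter T \<le> \<sigma> * inball_diameter T)"

definition quasi_uniform :: "real \<Rightarrow> (real^3) set set set \<Rightarrow> bool" where
  "quasi_uniform \<tau> \<M> \<longleftrightarrow> (\<forall>\<T>\<in>\<M>. \<forall>T\<in>\<T>. mesh_width \<T> \<le> \<tau> * diameter T)"

section \<open>Nedelec spaces\<close>

definition polys :: "nat \<Rightarrow> (real^3 \<Rightarrow> real) set" where
  "polys m = {p. \<exists>c :: nat \<Rightarrow> nat \<Rightarrow> nat \<Rightarrow> real. \<forall>x.
     p x = (\<Sum>(a, b, e) \<in> {(a, b, e). a + b + e \<le> m}. c a b e * x $ 1 ^ a * x $ 2 ^ b * x $ 3 ^ e)}"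

definition poly_fields :: "nat \<Rightarrow> (real^3 \<Rightarrow> real^3) set" where
  "poly_fields m = {p. \<forall>i. (\<lambda>x. p x $ i) \<in> polys m}"

text \<open>
  The condition on each element is imposed almost everywhere: a field in $H(curl)$ is only determined
  up to null sets, and neighbouring elements may prescribe different normal components on a common
  face.
\<close>

definition nedelec :: "(real^3) set \<Rightarrow> nat \<Rightarrow> (real^3) set set \<Rightarrow> (real^3 \<Rightarrow> real^3) set" where
  "nedelec \<Omega> k \<T> = {v \<in> Hcurl \<Omega>. \<forall>T\<in>\<T>.
     \<exists>p\<in>poly_fields (k - 1). \<exists>q\<in>poly_fields (k - 1).
       AE x in lebesgue_on T. v x = p x + cross3 x (q x)}"

definition nedelec0 :: "(real^3) set \<Rightarrow> nat \<Rightarrow> (real^3) set set \<Rightarrow> (real^3 \<Rightarrow> real^3) set" where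
  "nedelec0 \<Omega> k \<T> = nedelec \<Omega> k \<T> \<inter> Hcurl0 \<Omega>"

end

theory Submission
  imports Defs
begin

text \<open>
  The proof is a discrete Caccioppoli argument over layers of elements. A first-kind Nedelec field is,
  on each tetrahedron, the restriction of a homogeneous one-form in the barycentric coordinates, so
  it can be pulled back under the coordinate projection that forgets the vertices outside a given
  vertex set \<open>A\<close>. This cut of \<open>\<xi>\<close> is again a Nedelec field, equals \<open>\<xi>\<close> on elements with all
  vertices in \<open>A\<close>, vanishes on elements without vertices in \<open>A\<close>, preserves tangential continuity
  (its trace on a face depends only on the trace of the field there), and costs a factor \<open>1 / h\<close> in the
  curl. Testing with the cut along the \<open>j\<close>-th layer gives
  \<open>E\<^sub>j\<^sup>2 \<le> \<kappa> (E\<^sub>j\<^sub>+\<^sub>1 - E\<^sub>j) (m\<^sub>j\<^sub>+\<^sub>1 - m\<^sub>j)\<close> with \<open>\<kappa> \<sim> h\<^sup>-\<^sup>2\<close> for the energies \<open>E\<^sub>j\<close> of the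
  curl and the masses \<open>m\<^sub>j\<close> of the field up to layer \<open>j\<close>; over the \<open>N \<sim> d / h\<close> layers this
  discrete Riccati inequality yields \<open>E\<^sub>0 \<lesssim> \<kappa> m\<^sub>N / N\<^sup>2 \<sim> m\<^sub>N / d\<^sup>2\<close>.
\<close>

text \<open>Multiplying \<open>\<xi>\<close> by a smooth cutoff leaves the discrete space, and
  repairing that by interpolation would need degrees of freedom and superapproximation estimates.
  The pullback stays in the space because the projection is linear in barycentric coordinates, so
  the degree does not grow. Its price is that it acts within one element: a single cut yields only
  \<open>1 / h\<close>. The gain comes from the fact that the cut agrees with \<open>\<xi>\<close>
  on the core, so orthogonality expresses the whole core energy by the next ring alone, and ring
  quantities are increments of \<open>E\<close> and \<open>m\<close>. The recursion is the discrete
  form of \<open>E^2 \<le> \<kappa> E' m'\<close>, that is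
  \<open>(- 1 / E)' \<ge> 1 / (\<kappa> m')\<close>, and by convexity the right side integrates to
  at least \<open>N^2 / (\<kappa> m)\<close>. Membership in \<open>H(curl)\<close> is a weak
  condition. Passing from a weak curl to zero jumps and back both go through a Green formula on
  tetrahedra with barycentric gradients as face normals; a field that vanishes on all elements not
  inside the domain obtains zero tangential trace in the same way.\<close>

lemma sq_le_two_pow: "(n::nat)^2 \<le> 2 * 2^n"
proof (induction n)
  case (Suc n)
  show ?case
  proof (cases "n \<ge> 3")
    case True
    have "3 * n \<le> n^2" using True by (simp add: power2_eq_square)
    then have "(Suc n)^2 \<le> 2 * n^2" using True unfolding power2_eq_square mult_Suc mult_Suc_right by linarith
    then show ?thesis using Suc by simp
  next
    case False
    then have "n = 0 \<or> n = 1 \<or> n = 2" by auto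
    then show ?thesis by (auto simp: power2_eq_square)
  qed
qed simp

text \<open>A step either lets \<open>E\<close> at most double or more than doubles it. In the first
  case \<open>1 / E\<close> drops by at least \<open>1 / (2 * \<kappa> * \<mu>)\<close>, where
  \<open>\<mu>\<close> is the increment of \<open>m\<close>; in the second case \<open>E\<close>
  grows geometrically towards \<open>E N\<close>, which \<open>last\<close> bounds. Whichever kind
  makes up half of the indices gives the estimate, both times with the constant 8.\<close>

lemma discrete_riccati:
  fixes E m :: "nat \<Rightarrow> real"
  assumes mono: "\<And>j. j < N \<Longrightarrow> E j \<le> E (Suc j)" and mm: "\<And>j. j < N \<Longrightarrow> m j \<le> m (Suc j)"
    and E0: "E 0 \<ge> 0" and m0: "m 0 \<ge> 0" and kap: "\<kappa> \<ge> 0"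
    and step: "\<And>j. j < N \<Longrightarrow> (E j)^2 \<le> \<kappa> * (E (Suc j) - E j) * (m (Suc j) - m j)"
    and last: "E N \<le> \<kappa> * m N"
  shows "E 0 * (real N)^2 \<le> 8 * \<kappa> * m N"
proof (cases "E 0 = 0 \<or> N = 0")
  case True
  have "m 0 \<le> m n" if "n \<le> N" for n using that
  proof (induction n)
    case (Suc n) then show ?case using mm[of n] by simp
  qed simp
  then have "m N \<ge> 0" using m0 by force
  then show ?thesis using True kap by auto
next
  case False
  then have E0: "E 0 > 0" and N: "N > 0" using E0 by auto
  have Epos: "E 0 \<le> E n" if "n \<le> N" for n using that
  proof (induction n)
    case (Suc n) then show ?case using mono[of n] by simp
  qed simp
  have Ep: "E n > 0" if "n \<le> N" for n using Epos[OF that] E0 by linarith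
  have mpos: "m 0 \<le> m n" if "n \<le> N" for n using that
  proof (induction n)
    case (Suc n) then show ?case using mm[of n] by simp
  qed simp
  have kp: "\<kappa> > 0" using last Ep[of N] kap by (cases "\<kappa> = 0") auto
  have mN: "m N > 0" using last Ep[of N] kp by (smt (verit) order_refl zero_less_mult_pos)
  define G where "G = {j. j < N \<and> E (Suc j) \<le> 2 * E j}"
  define B where "B = {j. j < N \<and> \<not> E (Suc j) \<le> 2 * E j}"
  have fin: "finite G" "finite B" unfolding G_def B_def by auto
  have "G \<union> B = {..<N}" "G \<inter> B = {}" unfolding G_def B_def by auto
  then have cN: "card G + card B = N" using card_Un_disjoint[OF fin] by simp
  show ?thesis
  proof (cases "2 * card G \<ge> N")
    case True
    \<comment> \<open>\<open>2 * t - t^2 * \<mu>\<close> is the tangent to \<open>1 / \<mu>\<close>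
      at \<open>\<mu> = 1 / t\<close>. It replaces the reciprocal by an expression linear in
      \<open>\<mu>\<close>, so that the increments of \<open>m\<close> telescope in the sum.\<close>
    have inv: "(\<Sum>j<n. if j \<in> G then (2 * t - t^2 * (m (Suc j) - m j)) / (2 * \<kappa>) else 0) \<le> 1 / E 0 - 1 / E n"
      if "n \<le> N" for n and t :: real using that
    proof (induction n)
      case (Suc n)
      have n: "n < N" using Suc by simp
      have "(if n \<in> G then (2 * t - t^2 * (m (Suc n) - m n)) / (2 * \<kappa>) else 0) \<le> 1 / E n - 1 / E (Suc n)"
      proof (cases "n \<in> G")
        case False
        then show ?thesis using mono[OF n] Ep[of n] Ep[of "Suc n"] n by (simp add: frac_le)
      next
        case g: True
        define \<mu> where "\<mu> = m (Suc n) - m n"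
        define \<delta> where "\<delta> = E (Suc n) - E n"
        have e: "E n > 0" "E (Suc n) > 0" "E (Suc n) \<le> 2 * E n" using Ep n g by (auto simp: G_def)
        have st: "(E n)^2 \<le> \<kappa> * \<delta> * \<mu>" using step[OF n] by (simp add: \<mu>_def \<delta>_def)
        have "\<mu> \<ge> 0" using mm[OF n] by (simp add: \<mu>_def)
        moreover have "\<mu> \<noteq> 0" using st e(1) by auto
        ultimately have mu: "\<mu> > 0" by simp
        have "0 \<le> (t * \<mu> - 1)^2" by simp
        then have "2 * t * \<mu> - t^2 * \<mu>^2 \<le> 1" by (simp add: power2_eq_square algebra_simps)
        then have "(2 * t - t^2 * \<mu>) * \<mu> \<le> 1" by (simp add: power2_eq_square algebra_simps)
        then have a: "2 * t - t^2 * \<mu> \<le> 1 / \<mu>" using mu by (simp add: pos_le_divide_eq)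
        have b: "E n * E (Suc n) \<le> 2 * (E n)^2" using e by (simp add: power2_eq_square)
        have c: "1 / (2 * \<kappa> * \<mu>) \<le> \<delta> / (E n * E (Suc n))"
        proof -
          have "E n * E (Suc n) \<le> \<delta> * (2 * \<kappa> * \<mu>)" using b st by (simp add: algebra_simps)
          then show ?thesis using e mu kp by (simp add: divide_simps mult.commute)
        qed
        have "1 / E n - 1 / E (Suc n) = \<delta> / (E n * E (Suc n))"
          using e by (simp add: \<delta>_def field_simps)
        moreover have "(2 * t - t^2 * \<mu>) / (2 * \<kappa>) \<le> (1 / \<mu>) / (2 * \<kappa>)"
          using a kp by (intro divide_right_mono) auto
        ultimately show ?thesis using g c by (simp add: \<mu>_def mult.commute)
      qed
      then show ?case using Suc by simp
    qed simp
    \<comment> \<open>This \<open>t\<close> maximises \<open>real N * t - t^2 * m N\<close>, the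
      lower bound that is left once \<open>card G\<close> is replaced by
      \<open>N / 2\<close>.\<close>
    define t where "t = real N / (2 * m N)"
    have "(\<Sum>j<N. if j \<in> G then (2 * t - t^2 * (m (Suc j) - m j)) / (2 * \<kappa>) else 0) \<ge>
          (\<Sum>j<N. (if j \<in> G then (2 * t) / (2 * \<kappa>) else 0) - t^2 * (m (Suc j) - m j) / (2 * \<kappa>))"
      using mm kp by (intro sum_mono) (auto simp: diff_divide_distrib)
    also have "(\<Sum>j<N. (if j \<in> G then (2 * t) / (2 * \<kappa>) else 0) - t^2 * (m (Suc j) - m j) / (2 * \<kappa>))
      = card G * (2 * t) / (2 * \<kappa>) - t^2 * (m N - m 0) / (2 * \<kappa>)"
    proof -
      have "(\<Sum>j<N. (if j \<in> G then (2 * t) / (2 * \<kappa>) else 0)) = (\<Sum>j\<in>G. (2 * t) / (2 * \<kappa>))"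
        by (subst sum.inter_filter[symmetric]) (auto intro!: sum.cong simp: G_def)
      moreover have "(\<Sum>j<N. t^2 * (m (Suc j) - m j) / (2 * \<kappa>)) = t^2 * (m N - m 0) / (2 * \<kappa>)"
        by (simp add: sum_divide_distrib[symmetric] sum_distrib_left[symmetric] sum_lessThan_telescope)
      ultimately show ?thesis by (simp add: sum_subtractf)
    qed
    finally have "card G * (2 * t) / (2 * \<kappa>) - t^2 * (m N - m 0) / (2 * \<kappa>) \<le> 1 / E 0 - 1 / E N"
      using inv[of N t] by simp
    also have "\<dots> \<le> 1 / E 0" using Ep[of N] by simp
    finally have "card G * (2 * t) - t^2 * (m N - m 0) \<le> 2 * \<kappa> / E 0"
      using kp by (simp add: field_simps)
    moreover have "t^2 * (m N - m 0) \<le> t^2 * m N" using m0 by (intro mult_left_mono) auto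
    moreover have "t^2 * m N = real N^2 / (4 * m N)"
      using mN by (simp add: t_def power2_eq_square field_simps)
    moreover have "card G * (2 * t) \<ge> real N / 2 * (2 * t)"
      using True mN by (intro mult_right_mono) (auto simp: t_def)
    moreover have "real N / 2 * (2 * t) = real N^2 / (2 * m N)"
      using mN by (simp add: t_def power2_eq_square field_simps)
    ultimately have "real N^2 / (2 * m N) - real N^2 / (4 * m N) \<le> 2 * \<kappa> / E 0" by linarith
    then show ?thesis using mN E0 by (simp add: field_simps)
  next
    case False
    then have b: "N \<le> 2 * card B" using cN by simp
    \<comment> \<open>Every index in \<open>B\<close> doubles \<open>E\<close>. Of the resulting
      exponential growth only a quadratic part is kept, by \<open>sq_le_two_pow\<close>.\<close>
    have "2 ^ card (B \<inter> {..<n}) * E 0 \<le> E n" if "n \<le> N" for n using that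
    proof (induction n)
      case (Suc n)
      show ?case
      proof (cases "n \<in> B")
        case True
        then have "B \<inter> {..<Suc n} = insert n (B \<inter> {..<n})" by (auto simp: less_Suc_eq)
        then show ?thesis using Suc True by (simp add: B_def)
      next
        case False
        then have "B \<inter> {..<Suc n} = B \<inter> {..<n}" by (auto simp: less_Suc_eq)
        then show ?thesis using Suc mono[of n] by simp
      qed
    qed simp
    from this[of N] have "2 ^ card (B \<inter> {..<N}) * E 0 \<le> E N" by simp
    moreover have "B \<inter> {..<N} = B" by (auto simp: B_def)
    ultimately have e: "2 ^ card B * E 0 \<le> \<kappa> * m N" using last by simp
    have "N^2 \<le> (2 * card B)^2" using b by (intro power_mono) auto
    also have "\<dots> \<le> 8 * 2 ^ card B" using sq_le_two_pow[of "card B"] by (simp add: power2_eq_square)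
    finally have "real (N^2) \<le> real (8 * 2 ^ card B)" by (rule of_nat_mono)
    then have "(real N)^2 \<le> 8 * 2 ^ card B" by simp
    then have "E 0 * (real N)^2 \<le> E 0 * (8 * 2 ^ card B)" using E0 by (intro mult_left_mono) auto
    moreover have "E 0 * (8 * 2 ^ card B) = 8 * (2 ^ card B * E 0)" by simp
    ultimately show ?thesis using e by linarith
  qed
qed

section \<open>Polynomials of bounded degree\<close>

definition tri :: "nat \<Rightarrow> (nat \<times> nat \<times> nat) set" where
  "tri m = {(a, b, e). a + b + e \<le> m}"

lemma finite_tri [simp]: "finite (tri m)"
proof -
  have "tri m \<subseteq> {..m} \<times> {..m} \<times> {..m}" by (auto simp: tri_def)
  then show ?thesis by (rule finite_subset) auto
qed

lemma tri_mem: "i \<in> tri m \<longleftrightarrow> fst i + fst (snd i) + snd (snd i) \<le> m"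
  by (auto simp: tri_def)

lemma polys_iff: "p \<in> polys m \<longleftrightarrow>
    (\<exists>c :: nat \<times> nat \<times> nat \<Rightarrow> real. \<forall>x. p x = (\<Sum>(a, b, e) \<in> tri m. c (a, b, e) * (x $ 1 ^ a * x $ 2 ^ b * x $ 3 ^ e)))"
proof
  assume "p \<in> polys m"
  then obtain c where c: "\<And>x. p x = (\<Sum>(a, b, e) \<in> tri m. c a b e * x $ 1 ^ a * x $ 2 ^ b * x $ 3 ^ e)"
    by (auto simp: polys_def tri_def)
  show "\<exists>c. \<forall>x. p x = (\<Sum>(a, b, e) \<in> tri m. c (a, b, e) * (x $ 1 ^ a * x $ 2 ^ b * x $ 3 ^ e))"
    by (rule exI[of _ "\<lambda>(a,b,e). c a b e"]) (simp add: c mult.assoc)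
next
  assume "\<exists>c. \<forall>x. p x = (\<Sum>(a, b, e) \<in> tri m. c (a, b, e) * (x $ 1 ^ a * x $ 2 ^ b * x $ 3 ^ e))"
  then obtain c where c: "\<And>x. p x = (\<Sum>(a, b, e) \<in> tri m. c (a, b, e) * (x $ 1 ^ a * x $ 2 ^ b * x $ 3 ^ e))"
    by auto
  show "p \<in> polys m"
    unfolding polys_def by (auto intro!: exI[of _ "\<lambda>a b e. c (a,b,e)"] simp: c tri_def mult.assoc)
qed

lemma polys_0: "(\<lambda>x. 0) \<in> polys m"
  unfolding polys_iff by (rule exI[of _ "\<lambda>_. 0"]) auto

lemma polys_add: "p \<in> polys m \<Longrightarrow> q \<in> polys m \<Longrightarrow> (\<lambda>x. p x + q x) \<in> polys m"
proof -
  assume "p \<in> polys m" "q \<in> polys m"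
  then obtain c d where
    "\<forall>x. p x = (\<Sum>(a, b, e) \<in> tri m. c (a, b, e) * (x $ 1 ^ a * x $ 2 ^ b * x $ 3 ^ e))"
    "\<forall>x. q x = (\<Sum>(a, b, e) \<in> tri m. d (a, b, e) * (x $ 1 ^ a * x $ 2 ^ b * x $ 3 ^ e))"
    unfolding polys_iff by blast
  then show ?thesis
    unfolding polys_iff
    by (intro exI[of _ "\<lambda>i. c i + d i"]) (simp add: sum.distrib case_prod_beta distrib_right)
qed

lemma polys_cmult: "p \<in> polys m \<Longrightarrow> (\<lambda>x. r * p x) \<in> polys m"
proof -
  assume "p \<in> polys m"
  then obtain c where
    "\<forall>x. p x = (\<Sum>(a, b, e) \<in> tri m. c (a, b, e) * (x $ 1 ^ a * x $ 2 ^ b * x $ 3 ^ e))"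
    unfolding polys_iff by blast
  then show ?thesis
    unfolding polys_iff
    by (intro exI[of _ "\<lambda>i. r * c i"]) (simp add: sum_distrib_left case_prod_beta mult.assoc)
qed

lemma polys_sum: "finite I \<Longrightarrow> (\<And>i. i \<in> I \<Longrightarrow> p i \<in> polys m) \<Longrightarrow> (\<lambda>x. \<Sum>i\<in>I. p i x) \<in> polys m"
  by (induction I rule: finite_induct) (auto intro: polys_add polys_0)

lemma polys_diff: "p \<in> polys m \<Longrightarrow> q \<in> polys m \<Longrightarrow> (\<lambda>x. p x - q x) \<in> polys m"
  using polys_add[OF _ polys_cmult[of q m "-1"], of p] by simp

lemma polys_monomial:
  assumes "a + b + e \<le> m"
  shows "(\<lambda>x. x $ 1 ^ a * x $ 2 ^ b * x $ 3 ^ e) \<in> polys m"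
  unfolding polys_iff
proof (rule exI[of _ "\<lambda>i. if i = (a,b,e) then 1 else 0"], rule allI)
  fix x :: "real^3"
  have "(\<Sum>i\<in>tri m. case i of (a', b', e') \<Rightarrow> (if (a',b',e') = (a,b,e) then 1 else 0) * (x $ 1 ^ a' * x $ 2 ^ b' * x $ 3 ^ e'))
     = (\<Sum>i\<in>tri m. if i = (a,b,e) then x $ 1 ^ a * x $ 2 ^ b * x $ 3 ^ e else 0)"
    by (intro sum.cong refl) (simp split: prod.splits)
  also have "\<dots> = x $ 1 ^ a * x $ 2 ^ b * x $ 3 ^ e"
    using assms by (subst sum.delta) (auto simp: tri_mem)
  finally show "x $ 1 ^ a * x $ 2 ^ b * x $ 3 ^ e = (\<Sum>(a', b', e') \<in> tri m. (if (a',b',e') = (a,b,e) then 1 else 0) * (x $ 1 ^ a' * x $ 2 ^ b' * x $ 3 ^ e'))"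
    by (rule sym)
qed

lemma polys_expand:
  assumes "p \<in> polys m"
  obtains c where "p = (\<lambda>x. \<Sum>i\<in>tri m. c i * (x $ 1 ^ fst i * x $ 2 ^ fst (snd i) * x $ 3 ^ snd (snd i)))"
  using assms unfolding polys_iff by (auto simp: fun_eq_iff case_prod_beta)

lemma polys_mono: "m \<le> n \<Longrightarrow> p \<in> polys m \<Longrightarrow> p \<in> polys n"
  by (erule polys_expand) (auto intro!: polys_sum polys_cmult polys_monomial simp: tri_mem)

lemma polys_mult:
  assumes "p \<in> polys m" "q \<in> polys n"
  shows "(\<lambda>x. p x * q x) \<in> polys (m + n)"
proof -
  obtain c where p: "p = (\<lambda>x. \<Sum>i\<in>tri m. c i * (x $ 1 ^ fst i * x $ 2 ^ fst (snd i) * x $ 3 ^ snd (snd i)))"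
    using assms(1) polys_expand by blast
  obtain d where q: "q = (\<lambda>x. \<Sum>i\<in>tri n. d i * (x $ 1 ^ fst i * x $ 2 ^ fst (snd i) * x $ 3 ^ snd (snd i)))"
    using assms(2) polys_expand by blast
  have *: "(\<lambda>x. p x * q x) = (\<lambda>x. \<Sum>i\<in>tri m. \<Sum>j\<in>tri n. (c i * d j) *
      (x $ 1 ^ (fst i + fst j) * x $ 2 ^ (fst (snd i) + fst (snd j)) * x $ 3 ^ (snd (snd i) + snd (snd j))))"
    unfolding p q sum_product by (intro ext sum.cong) (auto simp: power_add)
  show ?thesis
    unfolding *
    by (intro polys_sum polys_cmult polys_monomial) (auto simp: tri_mem)
qed

lemma polys_const: "(\<lambda>x. r) \<in> polys m"
  using polys_cmult[OF polys_monomial[of 0 0 0 m], of r] by simp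

lemma polys_coord: "(\<lambda>x. x $ i) \<in> polys (Suc m)"
proof -
  have "i = 1 \<or> i = 2 \<or> i = 3" using exhaust_3 by auto
  then show ?thesis
    using polys_monomial[of 1 0 0 "Suc m"] polys_monomial[of 0 1 0 "Suc m"] polys_monomial[of 0 0 1 "Suc m"]
    by auto
qed

lemma polys_affine: "(\<lambda>x. g \<bullet> x + \<beta>) \<in> polys (Suc m)"
  unfolding inner_vec_def inner_real_def sum_3
  by (intro polys_add polys_cmult polys_coord polys_const)

lemma polys_power: "p \<in> polys m \<Longrightarrow> (\<lambda>x. p x ^ n) \<in> polys (m * n)"
proof (induction n)
  case 0 then show ?case using polys_const[of 1 0] by simp
next
  case (Suc n)
  then show ?case using polys_mult[of p m "\<lambda>x. p x ^ n" "m * n"] by simp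
qed

text \<open>Four factors, because a homogenized monomial involves the three coordinates of
  \<open>y\<close> and the additional variable \<open>s\<close>; composition with an affine map
  takes the fourth factor to be 1.\<close>

lemma polys_four_powers:
  assumes "p \<in> polys 1" "q \<in> polys 1" "r \<in> polys 1" "s \<in> polys 1" "a + b + e + f \<le> m"
  shows "(\<lambda>x. p x ^ a * q x ^ b * r x ^ e * s x ^ f) \<in> polys m"
  using polys_mult[OF polys_mult[OF polys_mult[OF polys_power[OF assms(1), of a] polys_power[OF assms(2), of b]]
    polys_power[OF assms(3), of e]] polys_power[OF assms(4), of f]]
  by (rule polys_mono[rotated]) (use assms(5) in simp)

lemma polys_compose_affine:
  assumes "p \<in> polys m" and "\<And>i. (\<lambda>x. X x $ i) \<in> polys 1"
  shows "(\<lambda>x. p (X x)) \<in> polys m"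
proof -
  obtain c where p: "p = (\<lambda>x. \<Sum>i\<in>tri m. c i * (x $ 1 ^ fst i * x $ 2 ^ fst (snd i) * x $ 3 ^ snd (snd i)))"
    using assms(1) polys_expand by blast
  have "(\<lambda>x. X x $ 1 ^ fst i * X x $ 2 ^ fst (snd i) * X x $ 3 ^ snd (snd i)) \<in> polys m" if "i \<in> tri m" for i
    using polys_four_powers[OF assms(2)[of 1] assms(2)[of 2] assms(2)[of 3] polys_const[of 1 1], of "fst i" "fst (snd i)" "snd (snd i)" 0 m] that
    by (auto simp: tri_mem)
  then show ?thesis unfolding p by (intro polys_sum polys_cmult) auto
qed

lemma polys_has_derivative:
  assumes "p \<in> polys m"
  obtains D :: "3 \<Rightarrow> real^3 \<Rightarrow> real" where "\<And>i. D i \<in> polys m" "\<And>x. (p has_derivative (\<lambda>h. D 1 x * h $ 1 + D 2 x * h $ 2 + D 3 x * h $ 3)) (at x)"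
proof -
  let ?P = "\<lambda>p D. (\<forall>i::3. D i \<in> polys m) \<and> (\<forall>x. (p has_derivative (\<lambda>h. D 1 x * h $ 1 + D 2 x * h $ 2 + D 3 x * h $ 3)) (at x))"
  have mon: "\<exists>D. ?P (\<lambda>x. x $ 1 ^ a * x $ 2 ^ b * x $ 3 ^ e) D" if "a + b + e \<le> m" for a b e
  proof -
    \<comment> \<open>For exponent 0 the truncated \<open>a - 1\<close> is harmless, since the
      factor \<open>real a\<close> vanishes.\<close>
    define D :: "3 \<Rightarrow> real^3 \<Rightarrow> real" where "D i = (if i = 1 then (\<lambda>x. real a * (x $ 1 ^ (a - 1) * x $ 2 ^ b * x $ 3 ^ e))
      else if i = 2 then (\<lambda>x. real b * (x $ 1 ^ a * x $ 2 ^ (b - 1) * x $ 3 ^ e))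
      else (\<lambda>x. real e * (x $ 1 ^ a * x $ 2 ^ b * x $ 3 ^ (e - 1))))" for i
    have "\<forall>i. D i \<in> polys m"
      unfolding D_def using that by (auto intro!: polys_cmult polys_monomial)
    moreover have "((\<lambda>x::real^3. x $ 1 ^ a * x $ 2 ^ b * x $ 3 ^ e) has_derivative (\<lambda>h. D 1 x * h $ 1 + D 2 x * h $ 2 + D 3 x * h $ 3)) (at x)" for x
      unfolding D_def
      by (auto intro!: derivative_eq_intros bounded_linear.has_derivative[OF bounded_linear_vec_nth] has_derivative_ident simp: fun_eq_iff algebra_simps)
    ultimately show ?thesis by blast
  qed
  obtain c where p: "p = (\<lambda>x. \<Sum>i\<in>tri m. c i * (x $ 1 ^ fst i * x $ 2 ^ fst (snd i) * x $ 3 ^ snd (snd i)))"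
    using assms(1) polys_expand by blast
  have "\<forall>i. \<exists>D. i \<in> tri m \<longrightarrow> ?P (\<lambda>x. x $ 1 ^ fst i * x $ 2 ^ fst (snd i) * x $ 3 ^ snd (snd i)) D"
    using mon by (auto simp: tri_mem)
  from choice[OF this] obtain DD where DD0: "\<forall>i. i \<in> tri m \<longrightarrow> ?P (\<lambda>x. x $ 1 ^ fst i * x $ 2 ^ fst (snd i) * x $ 3 ^ snd (snd i)) (DD i)" ..
  have DD: "?P (\<lambda>x. x $ 1 ^ fst i * x $ 2 ^ fst (snd i) * x $ 3 ^ snd (snd i)) (DD i)" if "i \<in> tri m" for i
    by (rule mp[OF spec[OF DD0] that])
  define D where "D j x = (\<Sum>i\<in>tri m. c i * DD i j x)" for j x
  have "D j \<in> polys m" for j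
    unfolding D_def using DD by (intro polys_sum polys_cmult) auto
  moreover have "(p has_derivative (\<lambda>h. D 1 x * h $ 1 + D 2 x * h $ 2 + D 3 x * h $ 3)) (at x)" for x
  proof -
    have "(p has_derivative (\<lambda>h. \<Sum>i\<in>tri m. c i * (DD i 1 x * h $ 1 + DD i 2 x * h $ 2 + DD i 3 x * h $ 3))) (at x)"
      unfolding p using DD by (intro has_derivative_sum has_derivative_mult_right) auto
    then show ?thesis
      by (simp add: D_def sum_distrib_left sum_distrib_right sum.distrib algebra_simps)
  qed
  ultimately show ?thesis by (rule that[of D])
qed

lemma polys_continuous: "p \<in> polys m \<Longrightarrow> continuous_on S p"
  by (erule polys_has_derivative) (meson has_derivative_continuous continuous_at_imp_continuous_on)

section \<open>Barycentric coordinates on a tetrahedron\<close>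

definition tet :: "(real^3) set \<Rightarrow> bool" where
  "tet C \<longleftrightarrow> \<not> affine_dependent C \<and> card C = 4"

text \<open>The coefficients are chosen for every point of space and not only for the hull, so for
  \<open>a\<close> in \<open>C\<close> this is an affine function on all of \<open>real^3\<close>.
  On \<open>C\<close> the choice is unique by affine independence; outside \<open>C\<close> its
  value is arbitrary.\<close>

definition bary :: "(real^3) set \<Rightarrow> real^3 \<Rightarrow> real^3 \<Rightarrow> real" where
  "bary C a x = (SOME u. sum u C = 1 \<and> (\<Sum>b\<in>C. u b *\<^sub>R b) = x) a"

text \<open>Increments along the axes give the exact gradient of an affine function, so no
  derivative has to be taken.\<close>

definition grad :: "(real^3) set \<Rightarrow> real^3 \<Rightarrow> real^3" where
  "grad C a = (\<chi> i. bary C a (axis i 1) - bary C a 0)"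

lemma affine_independent_unique:
  fixes C :: "'a::euclidean_space set"
  assumes "\<not> affine_dependent C" "finite C" "sum u C = sum w C" "(\<Sum>b\<in>C. u b *\<^sub>R b) = (\<Sum>b\<in>C. w b *\<^sub>R b)" "a \<in> C"
  shows "u a = w a"
proof (rule ccontr)
  assume "u a \<noteq> w a"
  then have "\<exists>U. sum U C = 0 \<and> (\<exists>v\<in>C. U v \<noteq> 0) \<and> (\<Sum>v\<in>C. U v *\<^sub>R v) = 0"
    using assms by (intro exI[of _ "\<lambda>b. u b - w b"]) (auto simp: sum_subtractf scaleR_diff_left)
  then show False using assms affine_dependent_explicit_finite by blast
qed

context
  fixes C :: "(real^3) set"
  assumes C: "tet C"
begin

lemma tet_finite: "finite C"
  using C by (intro card_ge_0_finite) (simp add: tet_def)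

lemma tet_affine_hull: "affine hull C = UNIV"
  using C affine_independent_span_eq[of C] by (simp add: tet_def)

lemma bary_both: "(\<Sum>a\<in>C. bary C a x) = 1 \<and> (\<Sum>a\<in>C. bary C a x *\<^sub>R a) = x"
proof -
  have "x \<in> affine hull C" using tet_affine_hull by simp
  then have "\<exists>u. sum u C = 1 \<and> (\<Sum>b\<in>C. u b *\<^sub>R b) = x"
    unfolding affine_hull_finite[OF tet_finite] by auto
  from someI_ex[OF this] show ?thesis unfolding bary_def by simp
qed

lemma bary_sum: "(\<Sum>a\<in>C. bary C a x) = 1" and bary_comb: "(\<Sum>a\<in>C. bary C a x *\<^sub>R a) = x"
  using bary_both by auto

lemma bary_unique:
  assumes "sum u C = 1" "(\<Sum>b\<in>C. u b *\<^sub>R b) = x" "a \<in> C"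
  shows "bary C a x = u a"
  using affine_independent_unique[of C "\<lambda>a. bary C a x" u a] assms C tet_finite bary_sum bary_comb
  by (simp add: tet_def)

text \<open>The affine expression satisfies the two equations that determine barycentric
  coordinates, because they hold at the origin and at the three unit vectors.\<close>

lemma bary_affine:
  assumes "a \<in> C"
  shows "bary C a x = grad C a \<bullet> x + bary C a 0"
proof (rule bary_unique)
  show "(\<Sum>a\<in>C. grad C a \<bullet> x + bary C a 0) = 1"
  proof -
    have "(\<Sum>a\<in>C. grad C a \<bullet> x) = (\<Sum>a\<in>C. bary C a (axis 1 1) - bary C a 0) * x $ 1 +
      (\<Sum>a\<in>C. bary C a (axis 2 1) - bary C a 0) * x $ 2 + (\<Sum>a\<in>C. bary C a (axis 3 1) - bary C a 0) * x $ 3"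
      by (simp add: sum_distrib_right sum.distrib inner_vec_def grad_def sum_3)
    then show ?thesis by (simp add: sum.distrib sum_subtractf bary_sum)
  qed
  have "(\<Sum>a\<in>C. (grad C a \<bullet> x) *\<^sub>R a) =
     x $ 1 *\<^sub>R (\<Sum>a\<in>C. bary C a (axis 1 1) *\<^sub>R a - bary C a 0 *\<^sub>R a) +
     x $ 2 *\<^sub>R (\<Sum>a\<in>C. bary C a (axis 2 1) *\<^sub>R a - bary C a 0 *\<^sub>R a) +
     x $ 3 *\<^sub>R (\<Sum>a\<in>C. bary C a (axis 3 1) *\<^sub>R a - bary C a 0 *\<^sub>R a)"
    unfolding scaleR_sum_right sum.distrib[symmetric]
    by (intro sum.cong) (auto simp: inner_vec_def grad_def sum_3 algebra_simps)
  also have "\<dots> = x"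
    by (simp add: sum_subtractf bary_comb vec_eq_iff axis_def forall_3)
  finally show "(\<Sum>a\<in>C. (grad C a \<bullet> x + bary C a 0) *\<^sub>R a) = x"
    by (simp add: scaleR_add_left sum.distrib bary_comb)
qed fact

lemma bary_vertex: "a \<in> C \<Longrightarrow> b \<in> C \<Longrightarrow> bary C a b = (if a = b then 1 else 0)"
proof -
  assume "a \<in> C" "b \<in> C"
  have "(\<Sum>a\<in>C. if a = b then 1 else 0) = (1::real)"
    using tet_finite \<open>b \<in> C\<close> by simp
  moreover have "(\<Sum>a\<in>C. (if a = b then 1 else 0) *\<^sub>R a) = (\<Sum>a\<in>C. if a = b then a else 0)"
    by (intro sum.cong) auto
  then have "(\<Sum>a\<in>C. (if a = b then 1 else 0) *\<^sub>R a) = b"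
    using tet_finite \<open>b \<in> C\<close> by simp
  ultimately show ?thesis
    using bary_unique[of "\<lambda>a. if a = b then 1 else 0" b a] \<open>a \<in> C\<close> by simp
qed

lemma bary_diff: "a \<in> C \<Longrightarrow> bary C a x - bary C a y = grad C a \<bullet> (x - y)"
  by (subst (1 2) bary_affine) (auto simp: inner_diff_right)

lemma grad_edge: "a \<in> C \<Longrightarrow> b \<in> C \<Longrightarrow> c \<in> C \<Longrightarrow>
    grad C a \<bullet> (b - c) = (if a = b then 1 else 0) - (if a = c then 1 else 0)"
  using bary_diff[of a b c] by (simp add: bary_vertex)

lemma grad_sum: "(\<Sum>a\<in>C. grad C a \<bullet> x) = 0"
proof -
  have "(\<Sum>a\<in>C. grad C a \<bullet> x) = (\<Sum>a\<in>C. bary C a x - bary C a 0)"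
    by (intro sum.cong) (auto simp: bary_diff)
  then show ?thesis by (simp add: sum_subtractf bary_sum)
qed

lemma grad_comb: "(\<Sum>a\<in>C. (grad C a \<bullet> x) *\<^sub>R a) = x"
proof -
  have "(\<Sum>a\<in>C. (grad C a \<bullet> x) *\<^sub>R a) = (\<Sum>a\<in>C. bary C a x *\<^sub>R a - bary C a 0 *\<^sub>R a)"
    by (intro sum.cong) (auto simp: bary_diff scaleR_diff_left[symmetric])
  then show ?thesis by (simp add: sum_subtractf bary_comb)
qed

lemma tet_hull: "convex hull C = {x. \<forall>a\<in>C. bary C a x \<ge> 0}"
proof (intro set_eqI iffI)
  fix x assume "x \<in> convex hull C"
  then obtain u where "\<forall>a\<in>C. 0 \<le> u a" "sum u C = 1" "(\<Sum>a\<in>C. u a *\<^sub>R a) = x"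
    unfolding convex_hull_finite[OF tet_finite] by auto
  then show "x \<in> {x. \<forall>a\<in>C. bary C a x \<ge> 0}" using bary_unique by auto
next
  fix x assume "x \<in> {x. \<forall>a\<in>C. bary C a x \<ge> 0}"
  then show "x \<in> convex hull C"
    unfolding convex_hull_finite[OF tet_finite] using bary_sum bary_comb by auto
qed

lemma bary_polys: "a \<in> C \<Longrightarrow> (\<lambda>x. bary C a x) \<in> polys (Suc 0)"
  by (subst bary_affine) (auto intro: polys_affine)

lemma bary_subset:
  assumes "B \<subseteq> C" "sum u B = 1" "(\<Sum>b\<in>B. u b *\<^sub>R b) = x" "a \<in> C"
  shows "bary C a x = (if a \<in> B then u a else 0)"
proof (rule bary_unique)
  show "(\<Sum>a\<in>C. if a \<in> B then u a else 0) = 1"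
    using assms tet_finite by (simp add: sum.inter_restrict[symmetric] Int_absorb1)
  have "(\<Sum>a\<in>C. (if a \<in> B then u a else 0) *\<^sub>R a) = (\<Sum>a\<in>C. if a \<in> B then u a *\<^sub>R a else 0)"
    by (intro sum.cong) auto
  then show "(\<Sum>a\<in>C. (if a \<in> B then u a else 0) *\<^sub>R a) = x"
    using assms tet_finite by (simp add: sum.inter_restrict[symmetric] Int_absorb1)
qed fact

end

section \<open>The local Nedelec space and its cut operator\<close>

definition local_nedelec :: "nat \<Rightarrow> (real^3 \<Rightarrow> real^3) set" where
  "local_nedelec m = {v. \<exists>p\<in>poly_fields m. \<exists>q\<in>poly_fields m. v = (\<lambda>x. p x + cross3 x (q x))}"

lemma polys_cmultr: "p \<in> polys m \<Longrightarrow> (\<lambda>x. p x * r) \<in> polys m"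
  using polys_cmult[of p m r] by (simp add: mult.commute)

text \<open>\<open>H y s\<close> stands for \<open>s ^ m * p (y / s)\<close>. The first clause
  leaves out \<open>s = 0\<close>, where the quotient has no meaning; the second records what has to
  survive there, namely that affine arguments produce polynomials of degree at most
  \<open>m\<close>.\<close>

definition homogenizes :: "nat \<Rightarrow> (real^3 \<Rightarrow> real^3) \<Rightarrow> (real^3 \<Rightarrow> real \<Rightarrow> real^3) \<Rightarrow> bool" where
  "homogenizes m p H \<longleftrightarrow>
     (\<forall>y s. s \<noteq> 0 \<longrightarrow> H y s = s ^ m *\<^sub>R p (inverse s *\<^sub>R y)) \<and>
     (\<forall>y s i. (\<forall>j. (\<lambda>x. y x $ j) \<in> polys 1) \<longrightarrow> s \<in> polys 1 \<longrightarrow> (\<lambda>x. H (y x) (s x) $ i) \<in> polys m)"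

lemma poly_field_homogenization:
  assumes "p \<in> poly_fields m"
  shows "\<exists>H. homogenizes m p H"
proof -
  have "\<forall>i. \<exists>c. (\<lambda>x. p x $ i) = (\<lambda>x. \<Sum>j\<in>tri m. c j * (x $ 1 ^ fst j * x $ 2 ^ fst (snd j) * x $ 3 ^ snd (snd j)))"
    using assms polys_expand unfolding poly_fields_def by blast
  from choice[OF this] obtain c where c0: "\<forall>i. (\<lambda>x. p x $ i) = (\<lambda>x. \<Sum>j\<in>tri m. c i j * (x $ 1 ^ fst j * x $ 2 ^ fst (snd j) * x $ 3 ^ snd (snd j)))" ..
  note c = spec[OF c0]
  define H :: "real^3 \<Rightarrow> real \<Rightarrow> real^3" where "H y s = (\<chi> i. \<Sum>j\<in>tri m. c i j *
     (y $ 1 ^ fst j * y $ 2 ^ fst (snd j) * y $ 3 ^ snd (snd j) * s ^ (m - (fst j + fst (snd j) + snd (snd j)))))" for y s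
  have "H y s = s ^ m *\<^sub>R p (inverse s *\<^sub>R y)" if "s \<noteq> 0" for y s
  proof (rule vec_eq_iff[THEN iffD2, rule_format])
    fix i
    have "H y s $ i = (\<Sum>j\<in>tri m. s ^ m * (c i j * ((inverse s *\<^sub>R y) $ 1 ^ fst j * (inverse s *\<^sub>R y) $ 2 ^ fst (snd j) * (inverse s *\<^sub>R y) $ 3 ^ snd (snd j))))"
      unfolding H_def vec_lambda_beta
    proof (intro sum.cong refl)
      fix j assume "j \<in> tri m"
      \<comment> \<open>\<open>d\<close> is the degree missing to \<open>m\<close>, filled up by the
        power of \<open>s\<close>; writing \<open>m\<close> with it removes the truncated
        subtraction.\<close>
      then obtain d where d: "m = fst j + fst (snd j) + snd (snd j) + d"
        by (auto simp: tri_mem le_iff_add)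
      show "c i j * (y $ 1 ^ fst j * y $ 2 ^ fst (snd j) * y $ 3 ^ snd (snd j) * s ^ (m - (fst j + fst (snd j) + snd (snd j)))) =
        s ^ m * (c i j * ((inverse s *\<^sub>R y) $ 1 ^ fst j * (inverse s *\<^sub>R y) $ 2 ^ fst (snd j) * (inverse s *\<^sub>R y) $ 3 ^ snd (snd j)))"
        using that unfolding d by (simp add: power_add power_mult_distrib power_inverse divide_simps)
    qed
    also have "\<dots> = s ^ m * p (inverse s *\<^sub>R y) $ i"
      by (simp only: sum_distrib_left[symmetric] fun_cong[OF c[of i]])
    finally show "H y s $ i = (s ^ m *\<^sub>R p (inverse s *\<^sub>R y)) $ i" by simp
  qed
  moreover have "(\<lambda>x. H (y x) (s x) $ i) \<in> polys m" if "\<And>j. (\<lambda>x. y x $ j) \<in> polys 1" "s \<in> polys 1" for y s i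
    unfolding H_def vec_lambda_beta using that
    by (intro polys_sum polys_cmult polys_four_powers) (auto simp: tri_mem)
  ultimately have "homogenizes m p H" unfolding homogenizes_def by blast
  then show ?thesis by (intro exI[of _ H])
qed

text \<open>This is what puts Whitney forms \<open>\<lambda>\<^sub>d grad \<lambda>\<^sub>c -
  \<lambda>\<^sub>c grad \<lambda>\<^sub>d\<close> into the Nedelec space: their linear part is the
  cross product of \<open>x\<close> with a constant vector.\<close>

lemma cross_antisym_affine:
  fixes g h :: "real^3"
  shows "(g \<bullet> x) *\<^sub>R h - (h \<bullet> x) *\<^sub>R g = cross3 x (cross3 h g)"
  by (simp add: cross3_simps vec_eq_iff forall_3 sum_3)

definition cut_mass :: "(real^3) set \<Rightarrow> (real^3) set \<Rightarrow> real^3 \<Rightarrow> real" where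
  "cut_mass C A x = (\<Sum>c\<in>C \<inter> A. bary C c x)"

definition cut_moment :: "(real^3) set \<Rightarrow> (real^3) set \<Rightarrow> real^3 \<Rightarrow> real^3" where
  "cut_moment C A x = (\<Sum>c\<in>C \<inter> A. bary C c x *\<^sub>R c)"

text \<open>
  A first-kind Nedelec field is the restriction of a homogeneous one-form of degree \<open>m + 2\<close> in the
  four barycentric coordinates that is annihilated by the Euler field. The field below is its
  pullback under the coordinate projection which kills the barycentric coordinates of the vertices
  outside \<open>A\<close>; away from the kernel, this is the pullback of \<open>v\<close> under the central projection
  \<open>x \<mapsto> y / s\<close> onto the face spanned by \<open>A\<close>, scaled by \<open>s ^ (m + 2)\<close>.
\<close>

definition is_cut :: "nat \<Rightarrow> (real^3) set \<Rightarrow> (real^3) set \<Rightarrow> (real^3 \<Rightarrow> real^3) \<Rightarrow> (real^3 \<Rightarrow> real^3) \<Rightarrow> bool" where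
  "is_cut m C A v u \<longleftrightarrow> u \<in> local_nedelec m \<and>
     (\<forall>x t. cut_mass C A x \<noteq> 0 \<longrightarrow>
       u x \<bullet> t = cut_mass C A x ^ Suc m * (v (inverse (cut_mass C A x) *\<^sub>R cut_moment C A x) \<bullet>
         (\<Sum>c\<in>C \<inter> A. (grad C c \<bullet> t) *\<^sub>R (c - inverse (cut_mass C A x) *\<^sub>R cut_moment C A x)))) \<and>
     (\<forall>x t. (\<forall>c\<in>C \<inter> A. grad C c \<bullet> t = 0) \<longrightarrow> u x \<bullet> t = 0)"

text \<open>Homogenizing \<open>p\<close> and \<open>q\<close> at \<open>(y, s)\<close> makes the
  pullback polynomial also where \<open>s\<close> vanishes. Written with antisymmetric coefficients
  of degree \<open>m\<close> it is a combination of Whitney forms, and each of these is a constant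
  plus \<open>x\<close> times a constant in the cross product, which is the required shape.\<close>

lemma cut_exists:
  assumes C: "tet C" and v: "v \<in> local_nedelec m"
  shows "\<exists>u. is_cut m C A v u"
proof -
  obtain p q where pq: "p \<in> poly_fields m" "q \<in> poly_fields m" "v = (\<lambda>x. p x + cross3 x (q x))"
    using v by (auto simp: local_nedelec_def)
  obtain P where P0: "homogenizes m p P" using poly_field_homogenization[OF pq(1)] ..
  obtain Q where Q0: "homogenizes m q Q" using poly_field_homogenization[OF pq(2)] ..
  define s where "s = cut_mass C A"
  define y where "y = cut_moment C A"
  define F where "F = C \<inter> A"
  have fF: "finite F" "F \<subseteq> C" using tet_finite[OF C] by (auto simp: F_def)
  have s: "s x = (\<Sum>c\<in>F. bary C c x)" and y: "y x = (\<Sum>c\<in>F. bary C c x *\<^sub>R c)" for x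
    by (simp_all add: s_def y_def cut_mass_def cut_moment_def F_def)
  define P' where "P' x = P (y x) (s x)" for x
  define Q' where "Q' x = Q (y x) (s x)" for x
  \<comment> \<open>The coefficient of \<open>grad C c\<close> is \<open>s ^ (m + 1)\<close> times
    \<open>v z \<bullet> (c - z)\<close> at the projected point \<open>z = y / s\<close>, with all
    denominators cleared.\<close>
  define u where "u x = (\<Sum>c\<in>F. ((s x *\<^sub>R P' x + cross3 (y x) (Q' x)) \<bullet> c - P' x \<bullet> y x) *\<^sub>R grad C c)" for x
  have sp: "s \<in> polys 1"
  proof -
    have "(\<lambda>x. \<Sum>c\<in>F. bary C c x) \<in> polys 1"
      using fF bary_polys[OF C] by (intro polys_sum) auto
    then show ?thesis using s by (metis (no_types, lifting) ext)
  qed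
  have yp: "(\<lambda>x. y x $ j) \<in> polys 1" for j
  proof -
    have "(\<lambda>x. \<Sum>c\<in>F. c $ j * bary C c x) \<in> polys 1"
      using fF bary_polys[OF C] by (intro polys_sum polys_cmult) auto
    then show ?thesis by (simp add: y sum_component mult.commute)
  qed
  have P'p: "(\<lambda>x. P' x $ i) \<in> polys m" and Q'p: "(\<lambda>x. Q' x $ i) \<in> polys m" for i
    using P0 Q0 sp yp unfolding P'_def Q'_def homogenizes_def by blast+
  \<comment> \<open>Expanding \<open>s\<close> and \<open>y\<close> over the vertices gives one
    coefficient for each product of \<open>bary C d\<close> with \<open>grad C c\<close>. It is
    antisymmetric because \<open>c - d\<close> and the cross product are.\<close>
  define \<Theta> where "\<Theta> c d x = P' x \<bullet> (c - d) + Q' x \<bullet> cross3 c d" for c d x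
  have Tp: "(\<lambda>x. \<Theta> c d x) \<in> polys m" for c d
    unfolding \<Theta>_def inner_vec_def inner_real_def sum_3 
    by (simp add: mult.commute[of "P' _ $ _"] mult.commute[of "Q' _ $ _"])
      (intro polys_add polys_cmult P'p Q'p)
  have Tas: "\<Theta> d c x = - \<Theta> c d x" for c d x
    by (simp add: \<Theta>_def inner_diff_right cross_skew[of d c])
  have u1: "u x = (\<Sum>c\<in>F. \<Sum>d\<in>F. (\<Theta> c d x * bary C d x) *\<^sub>R grad C c)" for x
  proof -
    have "(s x *\<^sub>R P' x + cross3 (y x) (Q' x)) \<bullet> c - P' x \<bullet> y x = (\<Sum>d\<in>F. \<Theta> c d x * bary C d x)" for c
    proof -
      have "cross3 d (Q' x) \<bullet> c = Q' x \<bullet> cross3 c d" for d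
        by (simp add: cross3_simps)
      moreover have lin: "linear (\<lambda>z. cross3 z (Q' x) \<bullet> c)"
        by (rule linearI) (simp_all add: cross_add_left inner_add_left cross_mult_left)
      ultimately have "cross3 (y x) (Q' x) \<bullet> c = (\<Sum>d\<in>F. bary C d x * (Q' x \<bullet> cross3 c d))"
        unfolding y linear_sum[OF lin] by (simp add: cross_mult_left)
      then show ?thesis
        by (simp add: \<Theta>_def inner_add_left s y inner_diff_right sum_distrib_right inner_sum_right
            sum.distrib sum_subtractf algebra_simps sum_distrib_left)
    qed
    then show ?thesis by (simp add: u_def scaleR_sum_left)
  qed
  \<comment> \<open>Averaging the double sum with its swapped form turns the products into Whitney
    forms, by antisymmetry of \<open>\<Theta>\<close>.\<close>
  have u2: "u x = (\<Sum>c\<in>F. \<Sum>d\<in>F. ((1/2) * \<Theta> c d x) *\<^sub>R (bary C d x *\<^sub>R grad C c - bary C c x *\<^sub>R grad C d))" for x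
  proof -
    have "u x = (\<Sum>c\<in>F. \<Sum>d\<in>F. (\<Theta> d c x * bary C c x) *\<^sub>R grad C d)"
      unfolding u1 by (rule sum.swap)
    then have "2 *\<^sub>R u x = (\<Sum>c\<in>F. \<Sum>d\<in>F. (\<Theta> c d x * bary C d x) *\<^sub>R grad C c + (\<Theta> d c x * bary C c x) *\<^sub>R grad C d)"
      by (simp add: scaleR_2 sum.distrib u1)
    also have "\<dots> = (\<Sum>c\<in>F. \<Sum>d\<in>F. \<Theta> c d x *\<^sub>R (bary C d x *\<^sub>R grad C c - bary C c x *\<^sub>R grad C d))"
    proof (intro sum.cong refl)
      fix c d
      show "(\<Theta> c d x * bary C d x) *\<^sub>R grad C c + (\<Theta> d c x * bary C c x) *\<^sub>R grad C d =
          \<Theta> c d x *\<^sub>R (bary C d x *\<^sub>R grad C c - bary C c x *\<^sub>R grad C d)"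
        by (simp add: Tas[of d c x] scaleR_diff_right)
    qed
    finally have "(1/2) *\<^sub>R (2 *\<^sub>R u x) = (1/2) *\<^sub>R (\<Sum>c\<in>F. \<Sum>d\<in>F. \<Theta> c d x *\<^sub>R (bary C d x *\<^sub>R grad C c - bary C c x *\<^sub>R grad C d))"
      by simp
    then show ?thesis by (simp add: scaleR_sum_right)
  qed
  have "u \<in> local_nedelec m"
  proof -
    define u0 where "u0 x = (\<Sum>c\<in>F. \<Sum>d\<in>F. ((1/2) * \<Theta> c d x) *\<^sub>R (bary C d 0 *\<^sub>R grad C c - bary C c 0 *\<^sub>R grad C d))" for x
    define w0 where "w0 x = (\<Sum>c\<in>F. \<Sum>d\<in>F. ((1/2) * \<Theta> c d x) *\<^sub>R cross3 (grad C c) (grad C d))" for x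
    have "u x = u0 x + cross3 x (w0 x)" for x
    proof -
      have "bounded_linear (cross3 x)"
        using bilinear_cross bilinear_conv_bounded_bilinear bounded_bilinear.bounded_linear_right by blast
      then have cl: "linear (cross3 x)" by (rule bounded_linear.linear)
      have "u x = (\<Sum>c\<in>F. \<Sum>d\<in>F. ((1/2) * \<Theta> c d x) *\<^sub>R (bary C d 0 *\<^sub>R grad C c - bary C c 0 *\<^sub>R grad C d) +
          ((1/2) * \<Theta> c d x) *\<^sub>R cross3 x (cross3 (grad C c) (grad C d)))"
        unfolding u2
      proof (intro sum.cong refl)
        fix c d assume "c \<in> F" "d \<in> F"
        then have "bary C c x = grad C c \<bullet> x + bary C c 0" "bary C d x = grad C d \<bullet> x + bary C d 0"
          using bary_affine[OF C] fF by auto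
        then have "bary C d x *\<^sub>R grad C c - bary C c x *\<^sub>R grad C d =
           (bary C d 0 *\<^sub>R grad C c - bary C c 0 *\<^sub>R grad C d) + ((grad C d \<bullet> x) *\<^sub>R grad C c - (grad C c \<bullet> x) *\<^sub>R grad C d)"
          by (simp add: algebra_simps)
        then show "((1/2) * \<Theta> c d x) *\<^sub>R (bary C d x *\<^sub>R grad C c - bary C c x *\<^sub>R grad C d) =
          ((1/2) * \<Theta> c d x) *\<^sub>R (bary C d 0 *\<^sub>R grad C c - bary C c 0 *\<^sub>R grad C d) +
          ((1/2) * \<Theta> c d x) *\<^sub>R cross3 x (cross3 (grad C c) (grad C d))"
          by (simp only: cross_antisym_affine scaleR_add_right)
      qed
      also have "\<dots> = u0 x + cross3 x (w0 x)"
        by (simp add: u0_def w0_def sum.distrib linear_sum[OF cl] linear_scale[OF cl])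
      finally show ?thesis .
    qed
    moreover have "u0 \<in> poly_fields m" "w0 \<in> poly_fields m"
      unfolding poly_fields_def u0_def w0_def mem_Collect_eq sum_component vector_scaleR_component real_scaleR_def
      by (intro allI polys_sum fF(1) polys_cmultr polys_cmult Tp)+
    ultimately show ?thesis
      unfolding local_nedelec_def by (intro CollectI bexI[of _ u0] bexI[of _ w0] ext)
  qed
  moreover have "u x \<bullet> t = s x ^ Suc m * (v (inverse (s x) *\<^sub>R y x) \<bullet> (\<Sum>c\<in>F. (grad C c \<bullet> t) *\<^sub>R (c - inverse (s x) *\<^sub>R y x)))"
    if nz: "s x \<noteq> 0" for x t
  proof -
    define z where "z = inverse (s x) *\<^sub>R y x"
    have yz: "y x = s x *\<^sub>R z" using nz by (simp add: z_def)
    have P'x: "P' x = s x ^ m *\<^sub>R p z" and Q'x: "Q' x = s x ^ m *\<^sub>R q z"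
      using nz P0 Q0 by (simp_all add: P'_def Q'_def homogenizes_def z_def)
    have "s x *\<^sub>R P' x + cross3 (y x) (Q' x) = s x ^ Suc m *\<^sub>R v z"
      by (simp add: pq P'x Q'x yz cross_mult_left cross_mult_right scaleR_add_right mult.commute)
    \<comment> \<open>\<open>cross3 z (q z)\<close> is orthogonal to \<open>z\<close>, so
      \<open>p z\<close> may be replaced by \<open>v z\<close> here; this is the annihilation by the
      Euler field.\<close>
    moreover have "P' x \<bullet> y x = s x ^ Suc m * (v z \<bullet> z)"
      by (simp add: pq P'x yz inner_add_left cross3_simps)
    ultimately have "u x = (\<Sum>c\<in>F. (s x ^ Suc m * (v z \<bullet> (c - z))) *\<^sub>R grad C c)"
      unfolding u_def by (simp add: inner_diff_right right_diff_distrib)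
    then show ?thesis
      by (simp add: z_def[symmetric] inner_sum_left inner_sum_right sum_distrib_left mult_ac del: power_Suc)
  qed
  \<comment> \<open>Read off from the polynomial formula, this also covers \<open>s = 0\<close>,
    where the formula with the quotient is silent. It decides the cut on elements and faces without
    a vertex in \<open>A\<close>.\<close>
  moreover have "u x \<bullet> t = 0" if "\<And>c. c \<in> F \<Longrightarrow> grad C c \<bullet> t = 0" for x t
    unfolding u_def using that by (simp add: inner_sum_left)
  ultimately have "is_cut m C A v u"
    unfolding is_cut_def s_def y_def F_def by blast
  then show ?thesis by (intro exI[of _ u])
qed

section \<open>Faces of a tetrahedral mesh\<close>

text \<open>Elements are represented by their vertex sets, since coordinates, faces and cuts are all
  expressed by vertices; \<open>tet_hull_inj\<close> makes the representation faithful.\<close>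

definition mesh_tets :: "(real^3) set set \<Rightarrow> (real^3) set set" where
  "mesh_tets \<T> = {C. tet C \<and> convex hull C \<in> \<T>}"

lemma tet_hull_inj:
  assumes "tet C" "tet D" "convex hull C = convex hull D"
  shows "C = D"
  using assms extreme_point_of_convex_hull_affine_independent[of C]
    extreme_point_of_convex_hull_affine_independent[of D] by (auto simp: tet_def)

lemma simplex_3_tet: "3 simplex T \<Longrightarrow> \<exists>C. tet C \<and> T = convex hull C"
  by (auto simp: simplex_def tet_def)

lemma finite_mesh_tets:
  assumes "triangulation \<T>"
  shows "finite (mesh_tets \<T>)"
proof (rule finite_imageD)
  show "finite ((\<lambda>C. convex hull C) ` mesh_tets \<T>)"
    by (rule finite_subset[of _ \<T>]) (use assms in \<open>auto simp: triangulation_def mesh_tets_def\<close>)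
  show "inj_on (\<lambda>C. convex hull C) (mesh_tets \<T>)"
    by (rule inj_onI, rule tet_hull_inj) (auto simp: mesh_tets_def)
qed

lemma mesh_tets_tet: "C \<in> mesh_tets \<T> \<Longrightarrow> tet C"
  by (simp add: mesh_tets_def)

text \<open>Conformity makes the intersection a face of both hulls. A face of a simplex is spanned
  by some of its vertices, and these are its extreme points, so the two descriptions use the same
  vertices.\<close>

lemma mesh_hull_inter:
  assumes tri: "triangulation \<T>" and C: "C \<in> mesh_tets \<T>" and D: "D \<in> mesh_tets \<T>"
  shows "convex hull C \<inter> convex hull D = convex hull (C \<inter> D)"
proof -
  have i: "\<not> affine_dependent C" "\<not> affine_dependent D"
    using C D by (auto simp: mesh_tets_def tet_def)
  have f: "(convex hull C \<inter> convex hull D) face_of convex hull C"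
    "(convex hull D \<inter> convex hull C) face_of convex hull D"
    using assms by (auto simp: triangulation_def mesh_tets_def)
  obtain c where c: "c \<subseteq> C" "convex hull C \<inter> convex hull D = convex hull c"
    using f(1) face_of_convex_hull_affine_independent[OF i(1)] by auto
  obtain d where d: "d \<subseteq> D" "convex hull D \<inter> convex hull C = convex hull d"
    using f(2) face_of_convex_hull_affine_independent[OF i(2)] by auto
  have "\<not> affine_dependent c" "\<not> affine_dependent d"
    using affine_independent_subset i c d by blast+
  moreover have "convex hull c = convex hull d" using c d by auto
  ultimately have "c = d"
    using extreme_point_of_convex_hull_affine_independent[of c] extreme_point_of_convex_hull_affine_independent[of d] by auto
  then have "convex hull c \<subseteq> convex hull (C \<inter> D)"
    using c d by (intro hull_mono) auto
  moreover have "convex hull (C \<inter> D) \<subseteq> convex hull C \<inter> convex hull D"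
    by (intro Int_greatest hull_mono) auto
  ultimately show ?thesis using c by auto
qed

text \<open>The coordinates of \<open>x\<close> in \<open>D\<close> can be computed from
  \<open>B\<close> and from \<open>B'\<close>, and positive weights must show up in both. The lemma
  isolates a face from all others near a point of its relative interior.\<close>

lemma mesh_positive_face_subset:
  assumes tri: "triangulation \<T>" and C: "C \<in> mesh_tets \<T>" and D: "D \<in> mesh_tets \<T>"
    and B: "B \<subseteq> C" and B': "B' \<subseteq> D"
    and u: "sum u B = 1" "(\<Sum>b\<in>B. u b *\<^sub>R b) = x" "\<And>b. b \<in> B \<Longrightarrow> u b > 0"
    and x: "x \<in> convex hull B'"
  shows "B \<subseteq> B'"
proof -
  note tC = mesh_tets_tet[OF C] and tD = mesh_tets_tet[OF D]
  have fin: "finite C" "finite D" using tC tD by (auto intro: tet_finite)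
  have fB: "finite B" using B fin finite_subset by blast
  have "x \<in> convex hull B"
    unfolding convex_hull_finite[OF fB] using u by (auto intro!: exI[of _ u] less_imp_le)
  then have "x \<in> convex hull C \<inter> convex hull D"
    using x hull_mono[OF B] hull_mono[OF B'] by auto
  then have "x \<in> convex hull (C \<inter> D)" using mesh_hull_inter[OF tri C D] by auto
  then obtain w where w: "sum w (C \<inter> D) = 1" "(\<Sum>b\<in>C \<inter> D. w b *\<^sub>R b) = x"
    using convex_hull_finite[of "C \<inter> D"] fin by auto
  have BD: "B \<subseteq> D"
  proof
    fix b assume b: "b \<in> B"
    then have "bary C b x = u b" using bary_subset[OF tC B u(1,2), of b] B by auto
    moreover have "bary C b x = (if b \<in> C \<inter> D then w b else 0)"
      using bary_subset[OF tC _ w, of b] B b by auto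
    ultimately show "b \<in> D" using u(3)[OF b] by (auto split: if_splits)
  qed
  obtain w' where w': "sum w' B' = 1" "(\<Sum>b\<in>B'. w' b *\<^sub>R b) = x"
    using x convex_hull_finite[of B'] fin finite_subset[OF B'] by auto
  show ?thesis
  proof
    fix b assume b: "b \<in> B"
    then have "bary D b x = u b" using bary_subset[OF tD BD u(1,2), of b] BD by auto
    moreover have "bary D b x = (if b \<in> B' then w' b else 0)"
      using bary_subset[OF tD B' w', of b] BD b by auto
    ultimately show "b \<in> B'" using u(3)[OF b] by (auto split: if_splits)
  qed
qed

section \<open>Integration over simplices\<close>

text \<open>Fubini's theorem works on product types and the geometry on \<open>real^3\<close>; this
  map carries Lebesgue measure from one to the other.\<close>

definition triple3 :: "real \<times> real \<times> real \<Rightarrow> real^3" where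
  "triple3 p = vector [fst p, fst (snd p), snd (snd p)]"

lemma triple3_nth [simp]: "triple3 (a, b, c) $ 1 = a" "triple3 (a, b, c) $ 2 = b" "triple3 (a, b, c) $ 3 = c"
  by (simp_all add: triple3_def)

lemma triple3_continuous: "continuous_on UNIV triple3"
proof -
  have "continuous_on UNIV (\<lambda>p::real \<times> real \<times> real. \<chi> i::3. if i = 1 then fst p else if i = 2 then fst (snd p) else snd (snd p))"
  proof (intro continuous_on_vec_lambda)
    fix i :: 3
    show "continuous_on UNIV (\<lambda>p::real \<times> real \<times> real. if i = 1 then fst p else if i = 2 then fst (snd p) else snd (snd p))"
      by (cases "i = 1"; cases "i = 2") (simp_all add: continuous_intros)
  qed
  moreover have "(\<lambda>p. \<chi> i::3. if i = 1 then fst p else if i = 2 then fst (snd p) else snd (snd p)) = triple3"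
    by (auto simp: triple3_def vec_eq_iff forall_3 fun_eq_iff)
  ultimately show ?thesis by (rule back_subst[of "continuous_on UNIV"])
qed

lemma triple3_measurable [measurable]: "triple3 \<in> borel_measurable borel"
  using triple3_continuous by (rule borel_measurable_continuous_onI)

lemma prod_UNIV_3: "prod h (UNIV::3 set) = h 1 * h 2 * h 3" for h :: "3 \<Rightarrow> real"
  unfolding UNIV_3 by (simp add: ac_simps)

lemma prod_Basis_3:
  fixes f :: "real^3 \<Rightarrow> real"
  shows "(\<Prod>b\<in>(Basis::(real^3) set). f b) = f (axis 1 1) * f (axis 2 1) * f (axis 3 1)"
proof -
  have eq: "(Basis :: (real^3) set) = (\<lambda>i. axis i 1) ` UNIV"
    by (auto simp: Basis_vec_def)
  have inj: "inj (\<lambda>i::3. axis i (1::real))" by (auto simp: inj_on_def axis_eq_axis)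
  have "(\<Prod>b\<in>(Basis::(real^3) set). f b) = (\<Prod>i\<in>(UNIV::3 set). f (axis i 1))"
    unfolding eq prod.reindex[OF inj] by simp
  also have "\<dots> = f (axis 1 1) * f (axis 2 1) * f (axis 3 1)"
    by (rule prod_UNIV_3)
  finally show ?thesis .
qed

lemma box_triple3:
  "box (a, b, c) (a', b', c') = box a a' \<times> (box b b' \<times> box c (c'::real))" for a b a' b' :: real
  by (auto simp: box_def Basis_prod_def)

lemma emeasure_lborel_Times:
  fixes A :: "'a::euclidean_space set" and B :: "'b::euclidean_space set"
  assumes "A \<in> sets borel" "B \<in> sets borel"
  shows "emeasure lborel (A \<times> B) = emeasure lborel A * emeasure lborel B"
  unfolding lborel_prod[symmetric] using assms by (intro lborel.emeasure_pair_measure_Times) auto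

lemma lborel_triple3: "distr lborel borel triple3 = (lborel :: (real^3) measure)"
proof (rule lborel_eqI[symmetric])
  fix l u :: "real^3" assume le: "\<And>b. b \<in> Basis \<Longrightarrow> l \<bullet> b \<le> u \<bullet> b"
  have le': "l $ i \<le> u $ i" for i
    using le[of "axis i 1"] by (simp add: inner_axis axis_in_Basis_iff)
  have "triple3 -` box l u = box (l $ 1, l $ 2, l $ 3) (u $ 1, u $ 2, u $ 3)"
    by (auto simp: mem_box_cart forall_3 box_triple3)
  moreover have "emeasure lborel (box (l $ 1, l $ 2, l $ 3) (u $ 1, u $ 2, u $ 3)) =
     ennreal (u $ 1 - l $ 1) * (ennreal (u $ 2 - l $ 2) * ennreal (u $ 3 - l $ 3))"
    unfolding box_triple3 using le' by (simp add: emeasure_lborel_Times borel_Times)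
  ultimately show "emeasure (distr lborel borel triple3) (box l u) = (\<Prod>b\<in>Basis. (u - l) \<bullet> b)"
    using le' by (simp add: emeasure_distr prod_Basis_3 inner_axis ennreal_mult mult.assoc)
qed simp

text \<open>\<open>J\<close> is the absolute determinant of the inverse map. Its value stays hidden
  because it later cancels against volumes of elements.\<close>

lemma lborel_linear_image:
  fixes g :: "real^3 \<Rightarrow> real^3"
  assumes g: "linear g" "inj g"
  shows "\<exists>J>0. distr lborel borel g = density lborel (\<lambda>_. ennreal J)"
proof -
  define h where "h = inv g"
  have "surj g" using g linear_injective_imp_surjective by blast
  then have gh: "g (h x) = x" "h (g x) = x" for x
    using g by (auto simp: h_def surj_f_inv_f)
  have h: "linear h" using g inj_linear_imp_inv_linear by (simp add: h_def)
  have "inj h" using gh by (metis injI)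
  then have det: "\<bar>det (matrix h)\<bar> > 0" using h det_nz_iff_inj by auto
  have gm [measurable]: "g \<in> borel_measurable borel"
    using g by (simp add: borel_measurable_continuous_onI linear_continuous_on linear_conv_bounded_linear)
  have "lborel = density (distr lborel borel g) (\<lambda>_. ennreal (inverse \<bar>det (matrix h)\<bar>))"
  proof (rule lborel_eqI)
    fix l u :: "real^3" assume le: "\<And>b. b \<in> Basis \<Longrightarrow> l \<bullet> b \<le> u \<bullet> b"
    have im: "g -` box l u = h ` box l u"
    proof (intro set_eqI iffI)
      fix x assume "x \<in> g -` box l u"
      then have "h (g x) \<in> h ` box l u" by (intro imageI) simp
      then show "x \<in> h ` box l u" by (simp only: gh)
    qed (auto simp: gh)
    have m: "h ` box l u \<in> lmeasurable" "measure lebesgue (h ` box l u) = \<bar>det (matrix h)\<bar> * measure lebesgue (box l u)"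
      using measurable_linear_image[OF h, of "box l u"] measure_linear_image[OF h, of "box l u"] by auto
    have bs: "g -` box l u \<in> sets borel" using measurable_sets[OF gm, of "box l u"] by simp
    have "emeasure lborel (g -` box l u) = emeasure lebesgue (h ` box l u)"
      unfolding im[symmetric] using bs by simp
    also have "\<dots> = ennreal (\<bar>det (matrix h)\<bar> * measure lebesgue (box l u))"
      using m by (simp add: emeasure_eq_measure2)
    finally have e: "emeasure lborel (g -` box l u) = ennreal (\<bar>det (matrix h)\<bar> * measure lebesgue (box l u))" .
    have "emeasure (density (distr lborel borel g) (\<lambda>_. ennreal (inverse \<bar>det (matrix h)\<bar>))) (box l u)
       = ennreal (inverse \<bar>det (matrix h)\<bar>) * emeasure lborel (g -` box l u)"
      by (subst emeasure_density) (auto simp: nn_integral_cmult_indicator emeasure_distr)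
    also have "\<dots> = ennreal (measure lebesgue (box l u))"
      unfolding e using det by (simp add: ennreal_mult[symmetric])
    also have "measure lebesgue (box l u) = (\<Prod>b\<in>Basis. (u - l) \<bullet> b)"
      using le by (simp add: measure_lborel_box_eq)
    finally show "emeasure (density (distr lborel borel g) (\<lambda>_. ennreal (inverse \<bar>det (matrix h)\<bar>))) (box l u) = (\<Prod>b\<in>Basis. (u - l) \<bullet> b)" .
  qed simp
  then have "density lborel (\<lambda>_. ennreal \<bar>det (matrix h)\<bar>) =
     density (density (distr lborel borel g) (\<lambda>_. ennreal (inverse \<bar>det (matrix h)\<bar>))) (\<lambda>_. ennreal \<bar>det (matrix h)\<bar>)"
    by simp
  also have "\<dots> = density (distr lborel borel g) (\<lambda>_. ennreal (inverse \<bar>det (matrix h)\<bar>) * ennreal \<bar>det (matrix h)\<bar>)"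
    by (subst density_density_eq) auto
  also have "\<dots> = distr lborel borel g"
    using det by (simp add: ennreal_mult[symmetric] density_1)
  finally show ?thesis using det by (metis)
qed

section \<open>Parametrised triangles and tetrahedra, face integrals\<close>

definition std2 :: "(real \<times> real) set" where
  "std2 = {p. 0 \<le> fst p \<and> 0 \<le> snd p \<and> fst p + snd p \<le> 1}"

definition std3 :: "(real \<times> real \<times> real) set" where
  "std3 = {q. 0 \<le> fst q \<and> 0 \<le> fst (snd q) \<and> 0 \<le> snd (snd q) \<and> fst q + fst (snd q) + snd (snd q) \<le> 1}"

definition tri_int :: "real^3 \<Rightarrow> real^3 \<Rightarrow> real^3 \<Rightarrow> (real^3 \<Rightarrow> real) \<Rightarrow> real" where
  "tri_int a c d f = (\<integral>p. indicator std2 p * f (a + fst p *\<^sub>R (c - a) + snd p *\<^sub>R (d - a)) \<partial>lborel)"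

text \<open>The vertex \<open>b\<close> is the origin, and the first parameter runs along the edge
  towards \<open>a\<close>: this is the direction integrated out in
  \<open>tet_edge_derivative\<close>.\<close>

definition tet_param :: "real^3 \<Rightarrow> real^3 \<Rightarrow> real^3 \<Rightarrow> real^3 \<Rightarrow> real \<times> real \<times> real \<Rightarrow> real^3" where
  "tet_param a b c d q = b + (fst q *\<^sub>R (a - b) + fst (snd q) *\<^sub>R (c - b) + snd (snd q) *\<^sub>R (d - b))"

lemma compact_std2: "compact std2"
proof -
  have "std2 \<subseteq> cbox (0,0) (1,1)" by (auto simp: std2_def mem_box)
  moreover have "closed std2"
    unfolding std2_def by (intro closed_Collect_conj closed_Collect_le continuous_intros)
  ultimately show ?thesis by (meson bounded_cbox bounded_subset compact_eq_bounded_closed)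
qed

lemma compact_std3: "compact std3"
proof -
  have "std3 \<subseteq> cbox (0,0,0) (1,1,1)" by (auto simp: std3_def mem_box)
  moreover have "closed std3"
    unfolding std3_def by (intro closed_Collect_conj closed_Collect_le continuous_intros)
  ultimately show ?thesis by (meson bounded_cbox bounded_subset compact_eq_bounded_closed)
qed

lemma std2_integrable:
  assumes "continuous_on UNIV f"
  shows "integrable lborel (\<lambda>p. indicator std2 p * f (a + fst p *\<^sub>R u + snd p *\<^sub>R w :: real^3) :: real)"
proof -
  have "continuous_on std2 (\<lambda>p. f (a + fst p *\<^sub>R u + snd p *\<^sub>R w))"
    by (rule continuous_on_compose2[OF assms]) (auto intro!: continuous_intros)
  from borel_integrable_compact[OF compact_std2 this] show ?thesis by simp
qed

lemma tri_int_swap: "continuous_on UNIV f \<Longrightarrow> tri_int a c d f = tri_int a d c f"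
proof -
  assume f: "continuous_on UNIV f"
  let ?F = "\<lambda>p::real \<times> real. indicator std2 p * f (a + fst p *\<^sub>R (d - a) + snd p *\<^sub>R (c - a))"
  have "?F \<in> borel_measurable (lborel \<Otimes>\<^sub>M lborel)"
    unfolding lborel_prod using std2_integrable[OF f] by (rule borel_measurable_integrable)
  from lborel_pair.integral_product_swap[OF this]
  have "(\<integral>p. ?F (snd p, fst p) \<partial>lborel) = integral\<^sup>L lborel ?F"
    unfolding lborel_prod by (simp add: case_prod_beta')
  moreover have "indicator std2 (snd p, fst p) = (indicator std2 p :: real)" for p
    by (auto simp: std2_def indicator_def)
  ultimately show ?thesis unfolding tri_int_def
    by (simp add: add.commute add.left_commute)
qed

text \<open>On each slice of the triangle the substitution of \<open>1 - z - y\<close> for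
  \<open>y\<close> exchanges the first two vertices; together with \<open>tri_int_swap\<close> this
  generates all permutations.\<close>

lemma tri_int_rotate: "continuous_on UNIV f \<Longrightarrow> tri_int a c d f = tri_int c a d f"
proof -
  assume f: "continuous_on UNIV f"
  have Fub: "tri_int a c d f = (\<integral>z. (\<integral>y. indicator std2 (y, z) * f (a + y *\<^sub>R (c - a) + z *\<^sub>R (d - a)) \<partial>lborel) \<partial>lborel)" for a c
  proof -
    have "integrable (lborel \<Otimes>\<^sub>M lborel) (\<lambda>(y,z). indicator std2 (y, z) * f (a + y *\<^sub>R (c - a) + z *\<^sub>R (d - a)))"
      unfolding lborel_prod using std2_integrable[OF f] by (simp add: case_prod_beta')
    from lborel_pair.integral_snd[OF this] show ?thesis
      unfolding lborel_prod tri_int_def by (simp add: case_prod_beta')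
  qed
  have "(\<integral>y. indicator std2 (y, z) * f (a + y *\<^sub>R (c - a) + z *\<^sub>R (d - a)) \<partial>lborel) =
        (\<integral>y. indicator std2 (y, z) * f (c + y *\<^sub>R (a - c) + z *\<^sub>R (d - c)) \<partial>lborel)" for z
  proof -
    have "indicator std2 (1 - z - y, z) = (indicator std2 (y, z) :: real)" for y
      by (auto simp: std2_def indicator_def)
    moreover have "a + (1 - z - y) *\<^sub>R (c - a) + z *\<^sub>R (d - a) = c + y *\<^sub>R (a - c) + z *\<^sub>R (d - c)" for y
      by (simp add: algebra_simps)
    ultimately show ?thesis
      by (subst lborel_integral_real_affine[of "-1" _ "1 - z"]) (simp_all del: real_scaleR_def)
  qed
  then show ?thesis unfolding Fub by simp
qed

text \<open>
  The face integral is normalised by the standard 2-simplex and carries no area factor; it does not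
  depend on the order of the vertices.
\<close>

definition face_int :: "(real^3) set \<Rightarrow> (real^3 \<Rightarrow> real) \<Rightarrow> real" where
  "face_int B f = (SOME I. \<exists>a c d. B = {a, c, d} \<and> card B = 3 \<and> I = tri_int a c d f)"

lemma face_int_eq:
  assumes f: "continuous_on UNIV f" and B: "card {a, c, d} = 3"
  shows "face_int {a, c, d} f = tri_int a c d f"
proof -
  have "face_int {a, c, d} f = I" if I: "I = tri_int a c d f" for I
    unfolding face_int_def
  proof (rule some_equality)
    show "\<exists>a' c' d'. {a, c, d} = {a', c', d'} \<and> card {a, c, d} = 3 \<and> I = tri_int a' c' d' f"
      using I B by blast
  next
    fix J assume "\<exists>a' c' d'. {a, c, d} = {a', c', d'} \<and> card {a, c, d} = 3 \<and> J = tri_int a' c' d' f"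
    then obtain a' c' d' where J: "{a, c, d} = {a', c', d'}" "J = tri_int a' c' d' f" by blast
    have "a \<noteq> c \<and> a \<noteq> d \<and> c \<noteq> d" using B by (auto simp: card_insert_if split: if_splits)
    moreover have "a' \<noteq> c' \<and> a' \<noteq> d' \<and> c' \<noteq> d'" using B unfolding J by (auto simp: card_insert_if split: if_splits)
    ultimately have "(a' = a \<and> c' = c \<and> d' = d) \<or> (a' = a \<and> c' = d \<and> d' = c) \<or> (a' = c \<and> c' = a \<and> d' = d)
      \<or> (a' = c \<and> c' = d \<and> d' = a) \<or> (a' = d \<and> c' = a \<and> d' = c) \<or> (a' = d \<and> c' = c \<and> d' = a)"
      using J(1) by (simp add: set_eq_iff) metis
    moreover have "tri_int a d c f = tri_int a c d f" "tri_int c a d f = tri_int a c d f"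
      "tri_int c d a f = tri_int a c d f" "tri_int d a c f = tri_int a c d f" "tri_int d c a f = tri_int a c d f"
      using tri_int_swap[OF f] tri_int_rotate[OF f] by metis+
    ultimately show "J = I" using I J(2) by auto
  qed
  then show ?thesis by simp
qed

lemma tet_param_distr:
  assumes C: "tet {a, b, c, d}"
  shows "\<exists>J>0. distr lborel borel (tet_param a b c d) = density lborel (\<lambda>_. ennreal J)"
proof -
  have dist: "distinct [a, b, c, d]"
    using C by (auto simp: tet_def card_insert_if split: if_splits)
  then have ne: "a \<noteq> b" "b \<noteq> a" "a \<noteq> c" "c \<noteq> a" "a \<noteq> d" "d \<noteq> a" "b \<noteq> c" "c \<noteq> b" "b \<noteq> d" "d \<noteq> b" "c \<noteq> d" "d \<noteq> c"
    by auto
  define g where "g w = w $ 1 *\<^sub>R (a - b) + w $ 2 *\<^sub>R (c - b) + w $ 3 *\<^sub>R (d - b)" for w :: "real^3"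
  have lin: "linear g"
    unfolding g_def by (rule linearI) (simp_all add: algebra_simps)
  have "inj g"
  proof (subst linear_injective_0[OF lin], intro allI impI)
    fix w assume "g w = 0"
    \<comment> \<open>A kernel vector of \<open>g\<close> gives the weights of an affine dependence;
      the weight of \<open>b\<close> is chosen to make their sum zero.\<close>
    define u where "u = (\<lambda>x. if x = a then w $ 1 else if x = c then w $ 2 else if x = d then w $ 3 else - (w $ 1 + w $ 2 + w $ 3))"
    have "sum u {a, b, c, d} = sum (\<lambda>_. 0) {a, b, c, d}"
      using ne by (simp add: u_def)
    moreover have "(\<Sum>x\<in>{a, b, c, d}. u x *\<^sub>R x) = g w"
      using ne by (simp add: u_def g_def algebra_simps)
    then have "(\<Sum>x\<in>{a, b, c, d}. u x *\<^sub>R x) = (\<Sum>x\<in>{a, b, c, d}. 0 *\<^sub>R x)"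
      using \<open>g w = 0\<close> by simp
    ultimately have "u x = 0" if "x \<in> {a, b, c, d}" for x
      using affine_independent_unique[of "{a,b,c,d}" u "\<lambda>_. 0" x] that C by (simp add: tet_def)
    from this[of a] this[of c] this[of d] have "w $ 1 = 0 \<and> w $ 2 = 0 \<and> w $ 3 = 0"
      using ne by (simp add: u_def)
    then show "w = 0" by (simp add: vec_eq_iff forall_3)
  qed
  then obtain J where J: "J > 0" "distr lborel borel g = density lborel (\<lambda>_. ennreal J)"
    using lborel_linear_image[OF lin] by blast
  have [measurable]: "g \<in> borel_measurable borel"
    using lin by (simp add: borel_measurable_continuous_onI linear_continuous_on linear_conv_bounded_linear)
  have "tet_param a b c d = (\<lambda>x. b + x) \<circ> (g \<circ> triple3)"
    by (auto simp: fun_eq_iff tet_param_def g_def)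
  then have "distr lborel borel (tet_param a b c d) = distr (distr (distr lborel borel triple3) borel g) borel ((+) b)"
    by (simp add: distr_distr o_assoc)
  also have "\<dots> = distr (density lborel (\<lambda>_. ennreal J)) borel ((+) b)"
    by (simp add: lborel_triple3 J)
  also have "\<dots> = density (distr lborel borel ((+) b)) (\<lambda>_. ennreal J)"
    by (subst density_distr) auto
  also have "\<dots> = density lborel (\<lambda>_. ennreal J)"
    by (simp add: lborel_distr_plus)
  finally show ?thesis using J by blast
qed

text \<open>The three parameters are the barycentric coordinates of \<open>a\<close>,
  \<open>c\<close> and \<open>d\<close>, and what remains to 1 is that of \<open>b\<close>.\<close>

lemma tet_param_in_hull:
  assumes C: "tet {a, b, c, d}"
  shows "tet_param a b c d q \<in> convex hull {a, b, c, d} \<longleftrightarrow> q \<in> std3"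
proof -
  have dist: "distinct [a, b, c, d]"
    using C by (auto simp: tet_def card_insert_if split: if_splits)
  then have ne: "a \<noteq> b" "b \<noteq> a" "a \<noteq> c" "c \<noteq> a" "a \<noteq> d" "d \<noteq> a" "b \<noteq> c" "c \<noteq> b" "b \<noteq> d" "d \<noteq> b" "c \<noteq> d" "d \<noteq> c"
    by auto
  obtain s y z where q: "q = (s, y, z)" by (metis surj_pair)
  define u where "u = (\<lambda>x. if x = a then s else if x = c then y else if x = d then z else 1 - (s + y + z))"
  have u: "sum u {a, b, c, d} = 1" "(\<Sum>x\<in>{a, b, c, d}. u x *\<^sub>R x) = tet_param a b c d q"
    using ne by (simp_all add: u_def q tet_param_def algebra_simps)
  have "bary {a,b,c,d} x (tet_param a b c d q) = u x" if "x \<in> {a,b,c,d}" for x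
    by (rule bary_unique[OF C u that])
  then show ?thesis
    unfolding tet_hull[OF C] using ne by (auto simp: u_def q std3_def)
qed

text \<open>This is 1/6, but only its positivity matters.\<close>

definition std3_volume :: real where
  "std3_volume = measure lborel std3"

lemma std3_volume_pos: "std3_volume > 0"
proof -
  have "cbox (0,0,0) (1/3,1/3,1/3) \<subseteq> std3"
    by (auto simp: std3_def mem_box Basis_prod_def)
  moreover have "emeasure lborel (cbox (0,0,0) (1/3,1/3,1/3) :: (real \<times> real \<times> real) set) > 0"
    unfolding emeasure_lborel_cbox_eq by (auto simp: Basis_prod_def prod.union_disjoint intro!: prod_pos)
  moreover have "emeasure lborel std3 < \<infinity>"
    using compact_std3 emeasure_bounded_finite compact_imp_bounded by blast
  ultimately show ?thesis
    unfolding std3_volume_def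
    by (metis (no_types, lifting) borel_compact compact_std3 emeasure_mono enn2real_positive_iff less_le_trans measure_def sets_lborel infinity_ennreal_def)
qed

text \<open>The Jacobian of the parametrisation is eliminated by comparison with
  \<open>h = 1\<close>, for which the same substitution computes the volume. Hence two volumes
  appear in place of a determinant.\<close>

lemma tet_fubini:
  assumes C: "tet {a, b, c, d}" and h: "continuous_on UNIV h"
  shows "std3_volume * (\<integral>x. indicator (convex hull {a, b, c, d}) x * h x \<partial>lborel) =
    measure lborel (convex hull {a, b, c, d}) *
     (\<integral>p. indicator std2 p * (\<integral>s. h (tet_param a b c d (s, p)) * indicator {0..1 - fst p - snd p} s \<partial>lborel) \<partial>lborel)"
proof -
  let ?H = "convex hull {a, b, c, d}"
  obtain J where J: "J > 0" "distr lborel borel (tet_param a b c d) = density lborel (\<lambda>_. ennreal J)"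
    using tet_param_distr[OF C] by blast
  have cont: "continuous_on UNIV (tet_param a b c d)"
    unfolding tet_param_def by (intro continuous_intros)
  then have [measurable]: "tet_param a b c d \<in> borel_measurable borel"
    by (rule borel_measurable_continuous_onI)
  have cH: "compact ?H" by (intro compact_convex_hull finite_imp_compact) auto
  then have [measurable]: "?H \<in> sets borel" by (simp add: borel_compact)
  have tr: "(\<integral>q. indicator std3 q * h (tet_param a b c d q) \<partial>lborel) = J * (\<integral>x. indicator ?H x * h x \<partial>lborel)"
    if h: "continuous_on UNIV h" for h :: "real^3 \<Rightarrow> real"
  proof -
    have [measurable]: "h \<in> borel_measurable borel" using h by (rule borel_measurable_continuous_onI)
    have "(\<integral>q. indicator std3 q * h (tet_param a b c d q) \<partial>lborel) =
      (\<integral>q. indicator ?H (tet_param a b c d q) * h (tet_param a b c d q) \<partial>lborel)"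
      using tet_param_in_hull[OF C] by (simp add: indicator_def)
    also have "\<dots> = (\<integral>x. indicator ?H x * h x \<partial>(distr lborel borel (tet_param a b c d)))"
      by (subst integral_distr) auto
    also have "\<dots> = J * (\<integral>x. indicator ?H x * h x \<partial>lborel)"
      unfolding J using J(1) by (subst integral_density) auto
    finally show ?thesis .
  qed
  have "std3_volume = J * measure lborel ?H"
    using tr[of "\<lambda>_. 1"] borel_compact[OF compact_std3]
    by (simp add: std3_volume_def)
  moreover have "J * (\<integral>x. indicator ?H x * h x \<partial>lborel) =
     (\<integral>p. indicator std2 p * (\<integral>s. h (tet_param a b c d (s, p)) * indicator {0..1 - fst p - snd p} s \<partial>lborel) \<partial>lborel)"
  proof -
    have "continuous_on std3 (\<lambda>q. h (tet_param a b c d q))"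
      by (rule continuous_on_compose2[OF h continuous_on_subset[OF cont]]) auto
    from borel_integrable_compact[OF compact_std3 this]
    have "integrable (lborel \<Otimes>\<^sub>M lborel) (\<lambda>(s, p). indicator std3 (s, p) * h (tet_param a b c d (s, p)))"
      unfolding lborel_prod by (simp add: case_prod_beta')
    from lborel_pair.integral_snd[OF this]
    have "(\<integral>q. indicator std3 q * h (tet_param a b c d q) \<partial>lborel) =
       (\<integral>p. (\<integral>s. indicator std3 (s, p) * h (tet_param a b c d (s, p)) \<partial>lborel) \<partial>lborel)"
      unfolding lborel_prod by (simp add: case_prod_beta')
    moreover have "indicator std3 (s, p) = indicator std2 p * (indicator {0..1 - fst p - snd p} s :: real)" for s p
      by (auto simp: std3_def std2_def indicator_def)
    then have "(\<integral>s. indicator std3 (s, p) * h (tet_param a b c d (s, p)) \<partial>lborel) =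
       indicator std2 p * (\<integral>s. h (tet_param a b c d (s, p)) * indicator {0..1 - fst p - snd p} s \<partial>lborel)" for p
      by (simp add: mult.assoc mult.commute[of "indicator {0..1 - fst p - snd p} _"])
    ultimately show ?thesis using tr[OF h] by simp
  qed
  ultimately have k: "std3_volume = J * measure lborel ?H" and
    i: "J * (\<integral>x. indicator ?H x * h x \<partial>lborel) =
     (\<integral>p. indicator std2 p * (\<integral>s. h (tet_param a b c d (s, p)) * indicator {0..1 - fst p - snd p} s \<partial>lborel) \<partial>lborel)"
    by blast+
  show ?thesis unfolding i[symmetric] k by (simp only: mult_ac)
qed

text \<open>On each segment parallel to \<open>a - b\<close> the fundamental theorem of calculus
  leaves two end values, one on the face opposite \<open>b\<close> and one on the face opposite
  \<open>a\<close>.\<close>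

lemma tet_edge_derivative:
  assumes C: "tet {a, b, c, d}" and f: "\<And>x. (f has_derivative f' x) (at x)"
    and f': "continuous_on UNIV (\<lambda>x. f' x (a - b))"
  shows "std3_volume * (\<integral>x. indicator (convex hull {a, b, c, d}) x * f' x (a - b) \<partial>lborel) =
    measure lborel (convex hull {a, b, c, d}) * (tri_int a c d f - tri_int b c d f)"
proof -
  have fc: "continuous_on UNIV f"
    by (intro continuous_at_imp_continuous_on ballI has_derivative_continuous[OF f])
  have "indicator std2 p * (\<integral>s. f' (tet_param a b c d (s, p)) (a - b) * indicator {0..1 - fst p - snd p} s \<partial>lborel) =
    indicator std2 p * f (a + fst p *\<^sub>R (c - a) + snd p *\<^sub>R (d - a)) - indicator std2 p * f (b + fst p *\<^sub>R (c - b) + snd p *\<^sub>R (d - b))" for p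
  proof (cases "p \<in> std2")
    case True
    define t where "t = 1 - fst p - snd p"
    have t: "0 \<le> t" using True by (auto simp: std2_def t_def)
    have "(\<integral>s. f' (tet_param a b c d (s, p)) (a - b) * indicator {0..t} s \<partial>lborel) =
       f (tet_param a b c d (t, p)) - f (tet_param a b c d (0, p))"
    proof (rule integral_FTC_Icc_real[OF t])
      fix s :: real
      have "((\<lambda>s. tet_param a b c d (s, p)) has_derivative (\<lambda>h. h *\<^sub>R (a - b))) (at s)"
        unfolding tet_param_def by (auto intro!: derivative_eq_intros)
      from has_derivative_compose[OF this f]
      have "((\<lambda>s. f (tet_param a b c d (s, p))) has_derivative (\<lambda>h. f' (tet_param a b c d (s, p)) (h *\<^sub>R (a - b)))) (at s)" .
      moreover have "f' x (h *\<^sub>R (a - b)) = f' x (a - b) * h" for x h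
        using linear_scale[OF has_derivative_linear[OF f[of x]], of h "a - b"] by simp
      ultimately show "((\<lambda>s. f (tet_param a b c d (s, p))) has_real_derivative f' (tet_param a b c d (s, p)) (a - b)) (at s)"
        by (simp add: has_field_derivative_def)
      have "continuous_on UNIV (\<lambda>s. f' (tet_param a b c d (s, p)) (a - b))"
        by (rule continuous_on_compose2[OF f']) (auto simp: tet_param_def intro!: continuous_intros)
      then show "isCont (\<lambda>s. f' (tet_param a b c d (s, p)) (a - b)) s"
        by (simp add: continuous_on_eq_continuous_at)
    qed
    moreover have "tet_param a b c d (t, p) = a + fst p *\<^sub>R (c - a) + snd p *\<^sub>R (d - a)"
      by (simp add: tet_param_def t_def algebra_simps)
    moreover have "tet_param a b c d (0, p) = b + fst p *\<^sub>R (c - b) + snd p *\<^sub>R (d - b)"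
      by (simp add: tet_param_def algebra_simps)
    ultimately show ?thesis using True by (simp add: t_def)
  qed simp
  then have "(\<integral>p. indicator std2 p * (\<integral>s. f' (tet_param a b c d (s, p)) (a - b) * indicator {0..1 - fst p - snd p} s \<partial>lborel) \<partial>lborel)
     = tri_int a c d f - tri_int b c d f"
    unfolding tri_int_def by (simp only: Bochner_Integration.integral_diff[OF std2_integrable[OF fc] std2_integrable[OF fc]])
  then show ?thesis using tet_fubini[OF C f'] by simp
qed

text \<open>The divergence theorem for one directional derivative. The vector \<open>e\<close> is a
  combination of edges from one fixed vertex \<open>b\<close>; the common term with the face
  opposite \<open>b\<close> drops out because the gradients sum to zero. Each gradient is the inward
  normal divided by the height, which explains the sign and the volume factor.\<close>

lemma tet_gauss:
  assumes C: "tet C" and f: "\<And>x. (f has_derivative f' x) (at x)"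
    and f': "\<And>e. continuous_on UNIV (\<lambda>x. f' x e)"
  shows "std3_volume * (\<integral>x. indicator (convex hull C) x * f' x e \<partial>lborel) =
    - measure lborel (convex hull C) * (\<Sum>a\<in>C. (grad C a \<bullet> e) * face_int (C - {a}) f)"
proof -
  have fc: "continuous_on UNIV f"
    by (intro continuous_at_imp_continuous_on ballI has_derivative_continuous[OF f])
  have fin: "finite C" using tet_finite[OF C] .
  have "C \<noteq> {}" using C by (auto simp: tet_def)
  then obtain b where b: "b \<in> C" by blast
  define I where "I e = (\<integral>x. indicator (convex hull C) x * f' x e \<partial>lborel)" for e
  define V where "V = measure lborel (convex hull C)"
  have edge: "std3_volume * I (a - b) = V * (face_int (C - {b}) f - face_int (C - {a}) f)" if a: "a \<in> C" for a
  proof (cases "a = b")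
    case True
    then show ?thesis
      using linear_0[OF has_derivative_linear[OF f]] by (simp add: I_def)
  next
    case False
    have "card (C - {a, b}) = 2"
      using C a b False fin by (simp add: tet_def card_Diff_subset)
    then obtain c d where cd: "C - {a, b} = {c, d}" "c \<noteq> d" by (auto simp: card_2_iff)
    then have Ceq: "C = {a, b, c, d}" using a b by auto
    have ne: "a \<noteq> c" "a \<noteq> d" "b \<noteq> c" "b \<noteq> d" using cd by auto
    have "C - {b} = {a, c, d}" "C - {a} = {b, c, d}" using Ceq ne False by auto
    moreover have "card {a, c, d} = 3" "card {b, c, d} = 3" using ne cd by auto
    ultimately show ?thesis
      using tet_edge_derivative[of a b c d f f'] C f f' face_int_eq[OF fc, of a c d] face_int_eq[OF fc, of b c d]
      by (simp add: I_def V_def Ceq)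
  qed
  have cH: "compact (convex hull C)" using fin by (intro compact_convex_hull finite_imp_compact)
  have int: "integrable lborel (\<lambda>x. indicator (convex hull C) x * f' x e)" for e
    using borel_integrable_compact[OF cH continuous_on_subset[OF f']] by simp
  have "I e = (\<Sum>a\<in>C. (grad C a \<bullet> e) * I (a - b))"
  proof -
    have e: "e = (\<Sum>a\<in>C. (grad C a \<bullet> e) *\<^sub>R (a - b))"
      using grad_comb[OF C, of e] grad_sum[OF C, of e]
      by (simp add: scaleR_diff_right sum_subtractf scaleR_sum_left[symmetric])
    have "f' x e = (\<Sum>a\<in>C. (grad C a \<bullet> e) * f' x (a - b))" for x
    proof -
      have lin: "linear (f' x)" using has_derivative_linear[OF f] .
      have "f' x e = f' x (\<Sum>a\<in>C. (grad C a \<bullet> e) *\<^sub>R (a - b))" using e by simp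
      also have "\<dots> = (\<Sum>a\<in>C. (grad C a \<bullet> e) * f' x (a - b))"
        by (simp add: linear_sum[OF lin] linear_scale[OF lin])
      finally show ?thesis .
    qed
    then have "indicator (convex hull C) x * f' x e = (\<Sum>a\<in>C. (grad C a \<bullet> e) * (indicator (convex hull C) x * f' x (a - b)))" for x
      by (simp add: sum_distrib_left mult_ac)
    then show ?thesis
      unfolding I_def by (simp add: Bochner_Integration.integral_sum int)
  qed
  then have "std3_volume * I e = (\<Sum>a\<in>C. (grad C a \<bullet> e) * (std3_volume * I (a - b)))"
    by (simp add: sum_distrib_left mult_ac)
  also have "\<dots> = (\<Sum>a\<in>C. (grad C a \<bullet> e) * (V * (face_int (C - {b}) f - face_int (C - {a}) f)))"
    using edge by simp
  also have "\<dots> = V * face_int (C - {b}) f * (\<Sum>a\<in>C. grad C a \<bullet> e) - V * (\<Sum>a\<in>C. (grad C a \<bullet> e) * face_int (C - {a}) f)"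
    by (simp add: sum_distrib_left sum_subtractf algebra_simps)
  finally show ?thesis by (simp add: grad_sum[OF C] I_def V_def)
qed

section \<open>Linearity, locality and definiteness of face integrals\<close>

lemma tri_int_sum:
  assumes "\<And>i. i \<in> I \<Longrightarrow> continuous_on UNIV (f i)"
  shows "tri_int a c d (\<lambda>x. \<Sum>i\<in>I. r i * f i x) = (\<Sum>i\<in>I. r i * tri_int a c d (f i))"
proof -
  have "tri_int a c d (\<lambda>x. \<Sum>i\<in>I. r i * f i x) =
    (\<integral>p. (\<Sum>i\<in>I. r i * (indicator std2 p * f i (a + fst p *\<^sub>R (c - a) + snd p *\<^sub>R (d - a)))) \<partial>lborel)"
    unfolding tri_int_def by (intro Bochner_Integration.integral_cong refl) (simp add: sum_distrib_left mult_ac)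
  also have "\<dots> = (\<Sum>i\<in>I. r i * tri_int a c d (f i))"
    unfolding tri_int_def using assms
    by (subst Bochner_Integration.integral_sum) (auto intro!: std2_integrable integrable_mult_right)
  finally show ?thesis .
qed

lemma face_int_sum:
  assumes f: "\<And>i. i \<in> I \<Longrightarrow> continuous_on UNIV (f i)" and B: "card B = 3"
  shows "face_int B (\<lambda>x. \<Sum>i\<in>I. r i * f i x) = (\<Sum>i\<in>I. r i * face_int B (f i))"
proof -
  obtain a c d where Beq: "B = {a, c, d}" using B by (auto simp: card_3_iff)
  have "continuous_on UNIV (\<lambda>x. \<Sum>i\<in>I. r i * f i x)"
    using f by (intro continuous_intros) auto
  then show ?thesis
    using B f tri_int_sum[OF f, of I] unfolding Beq by (simp add: face_int_eq)
qed

lemma face_point_in_hull: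
  assumes "p \<in> std2"
  shows "a + fst p *\<^sub>R (c - a) + snd p *\<^sub>R (d - a) \<in> convex hull {a, c, d}"
proof -
  have "a + fst p *\<^sub>R (c - a) + snd p *\<^sub>R (d - a) = (1 - fst p - snd p) *\<^sub>R a + fst p *\<^sub>R c + snd p *\<^sub>R d"
    by (simp add: algebra_simps)
  moreover have "0 \<le> 1 - fst p - snd p" "0 \<le> fst p" "0 \<le> snd p" "(1 - fst p - snd p) + fst p + snd p = 1"
    using assms by (auto simp: std2_def)
  ultimately show ?thesis unfolding convex_hull_3 by blast
qed

lemma face_int_cong:
  assumes f: "continuous_on UNIV f" "continuous_on UNIV g" and B: "card B = 3"
    and eq: "\<And>x. x \<in> convex hull B \<Longrightarrow> f x = g x"
  shows "face_int B f = face_int B g"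
proof -
  obtain a c d where Beq: "B = {a, c, d}" using B by (auto simp: card_3_iff)
  have "tri_int a c d f = tri_int a c d g"
    unfolding tri_int_def
  proof (intro Bochner_Integration.integral_cong refl)
    fix p
    show "indicator std2 p * f (a + fst p *\<^sub>R (c - a) + snd p *\<^sub>R (d - a)) = indicator std2 p * g (a + fst p *\<^sub>R (c - a) + snd p *\<^sub>R (d - a))"
      using eq[of "a + fst p *\<^sub>R (c - a) + snd p *\<^sub>R (d - a)"] face_point_in_hull[of p a c d]
      unfolding Beq by (cases "p \<in> std2") auto
  qed
  then show ?thesis using f B unfolding Beq by (simp add: face_int_eq)
qed

lemma face_int_zero:
  assumes f: "continuous_on UNIV f" and B: "card B = 3"
    and eq: "\<And>x. x \<in> convex hull B \<Longrightarrow> f x = 0"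
  shows "face_int B f = 0"
proof -
  have "face_int B f = face_int B (\<lambda>x. 0)" by (rule face_int_cong[OF f _ B eq]) auto
  also have "\<dots> = 0" using face_int_sum[of "{}" "\<lambda>_ _. 0" B "\<lambda>_. 0"] B by simp
  finally show ?thesis .
qed

text \<open>Positive weights place \<open>x\<close> in the relative interior of the face, whose
  parameters form an open set; a positive value at \<open>x\<close> would persist on an open, hence
  non-negligible, set of parameters.\<close>

lemma face_int_zero_imp:
  assumes f: "continuous_on UNIV f" and B: "card B = 3"
    and nn: "\<And>x. f x \<ge> 0" and z: "face_int B f = 0"
    and u: "sum u B = 1" "(\<Sum>b\<in>B. u b *\<^sub>R b) = x" "\<And>b. b \<in> B \<Longrightarrow> u b > 0"
  shows "f x = 0"
proof (rule ccontr)
  assume "f x \<noteq> 0"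
  then have fx: "f x > 0" using nn[of x] by linarith
  obtain a c d where Beq: "B = {a, c, d}" using B by (auto simp: card_3_iff)
  have ne: "a \<noteq> c" "a \<noteq> d" "c \<noteq> d" using B unfolding Beq by (auto simp: card_insert_if split: if_splits)
  define F where "F p = f (a + fst p *\<^sub>R (c - a) + snd p *\<^sub>R (d - a))" for p
  have contF: "continuous_on UNIV F"
    unfolding F_def by (rule continuous_on_compose2[OF f]) (auto intro!: continuous_intros)
  define U where "U = {p. 0 < fst p \<and> 0 < snd p \<and> fst p + snd p < 1 \<and> 0 < F p}"
  have "open U" unfolding U_def
    by (intro open_Collect_conj open_Collect_less continuous_intros contF)
  moreover have "(u c, u d) \<in> U"
  proof -
    have s: "u a + u c + u d = 1" using u(1) ne unfolding Beq by simp
    then have ua: "u a = 1 - u c - u d" by simp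
    have "a + u c *\<^sub>R (c - a) + u d *\<^sub>R (d - a) = x"
      using u(2) ne unfolding Beq by (simp add: ua algebra_simps)
    then show ?thesis using u(3)[of a] u(3)[of c] u(3)[of d] fx s
      unfolding U_def F_def Beq by simp
  qed
  ultimately have "\<not> negligible U" using open_not_negligible by blast
  have "(\<integral>p. indicator std2 p * F p \<partial>lborel) = 0"
    using z B f unfolding Beq by (simp add: face_int_eq tri_int_def F_def)
  moreover have "integrable lborel (\<lambda>p. indicator std2 p * F p)"
    unfolding F_def by (rule std2_integrable[OF f])
  moreover have "AE p in lborel. 0 \<le> indicator std2 p * F p" using nn by (simp add: F_def)
  ultimately have "AE p in lborel. indicator std2 p * F p = 0"
    using integral_nonneg_eq_0_iff_AE by blast
  then have "AE p in lborel. p \<notin> U"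
    by eventually_elim (auto simp: U_def std2_def indicator_def split: if_splits)
  then have "AE p in lebesgue. p \<notin> U" by (rule AE_completion)
  then have "U \<in> null_sets lebesgue"
    using AE_iff_null_sets[of U lebesgue] \<open>open U\<close> by auto
  then show False using \<open>\<not> negligible U\<close> by (simp add: negligible_iff_null_sets)
qed

section \<open>Green's formula for the curl on a tetrahedron\<close>

lemma bounded_bilinear_cross3: "bounded_bilinear cross3"
  using bilinear_cross bilinear_conv_bounded_bilinear by blast

lemmas continuous_on_cross3 [continuous_intros] = bounded_bilinear.continuous_on[OF bounded_bilinear_cross3]

lemma Ck_field_1: "Ck_field 1 f \<longleftrightarrow> (\<forall>x. f differentiable (at x)) \<and> (\<forall>i. continuous_on UNIV (partial_deriv i f))"
  by (simp only: One_nat_def Ck_field.simps)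

lemma smooth_field_C1: "smooth_field f \<Longrightarrow> Ck_field 1 f"
  by (simp only: smooth_field_def)

lemma C1_has_derivative:
  assumes "Ck_field 1 f"
  shows "(f has_derivative (\<lambda>e. \<Sum>i\<in>UNIV. e $ i *\<^sub>R partial_deriv i f x)) (at x)"
proof -
  have d: "(f has_derivative frechet_derivative f (at x)) (at x)"
    using assms unfolding Ck_field_1 frechet_derivative_works by blast
  have lin: "linear (frechet_derivative f (at x))" using has_derivative_linear[OF d] .
  have "frechet_derivative f (at x) e = (\<Sum>i\<in>UNIV. e $ i *\<^sub>R partial_deriv i f x)" for e
  proof -
    have "frechet_derivative f (at x) e = frechet_derivative f (at x) (\<Sum>i\<in>UNIV. e $ i *\<^sub>R axis i 1)"
      by (simp add: basis_expansion scalar_mult_eq_scaleR[symmetric])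
    then show ?thesis by (simp add: partial_deriv_def linear_sum[OF lin] linear_scale[OF lin])
  qed
  then have "frechet_derivative f (at x) = (\<lambda>e. \<Sum>i\<in>UNIV. e $ i *\<^sub>R partial_deriv i f x)" by (rule ext)
  then show ?thesis using d by (simp only:)
qed

lemma C1_continuous: "Ck_field 1 f \<Longrightarrow> continuous_on S f"
  by (intro continuous_at_imp_continuous_on ballI has_derivative_continuous[OF C1_has_derivative])

lemma C1_partial_continuous: "Ck_field 1 f \<Longrightarrow> continuous_on UNIV (partial_deriv i f)"
  by (simp only: Ck_field_1)

lemma C1_curl_continuous: "Ck_field 1 f \<Longrightarrow> continuous_on UNIV (classical_curl f)"
proof -
  assume f: "Ck_field 1 f"
  have "continuous_on UNIV (\<lambda>x. \<chi> j::3. if j = 1 then partial_deriv 2 f x $ 3 - partial_deriv 3 f x $ 2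
    else if j = 2 then partial_deriv 3 f x $ 1 - partial_deriv 1 f x $ 3 else partial_deriv 1 f x $ 2 - partial_deriv 2 f x $ 1)"
  proof (intro continuous_on_vec_lambda)
    fix j :: 3
    show "continuous_on UNIV (\<lambda>x. if j = 1 then partial_deriv 2 f x $ 3 - partial_deriv 3 f x $ 2
    else if j = 2 then partial_deriv 3 f x $ 1 - partial_deriv 1 f x $ 3 else partial_deriv 1 f x $ 2 - partial_deriv 2 f x $ 1)"
      by (cases "j = 1"; cases "j = 2") (simp_all add: continuous_intros C1_partial_continuous[OF f])
  qed
  moreover have "(\<lambda>x. \<chi> j::3. if j = 1 then partial_deriv 2 f x $ 3 - partial_deriv 3 f x $ 2
    else if j = 2 then partial_deriv 3 f x $ 1 - partial_deriv 1 f x $ 3 else partial_deriv 1 f x $ 2 - partial_deriv 2 f x $ 1) = classical_curl f"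
    by (auto simp: classical_curl_def vec_eq_iff forall_3 fun_eq_iff)
  ultimately show ?thesis by (rule back_subst[of "continuous_on UNIV"])
qed

text \<open>\<open>tet_gauss\<close> is applied to the components of
  \<open>cross3 (v x) (\<phi> x)\<close>, whose divergence is the integrand on the left.\<close>

lemma tet_green:
  assumes C: "tet C" and v: "Ck_field 1 v" and \<phi>: "Ck_field 1 \<phi>"
  shows "std3_volume * (\<integral>x. indicator (convex hull C) x * (classical_curl v x \<bullet> \<phi> x - v x \<bullet> classical_curl \<phi> x) \<partial>lborel) =
    - measure lborel (convex hull C) * (\<Sum>a\<in>C. face_int (C - {a}) (\<lambda>x. grad C a \<bullet> cross3 (v x) (\<phi> x)))"
proof -
  define f where "f i x = cross3 (v x) (\<phi> x) $ i" for i x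
  define D where "D g x e = (\<Sum>i\<in>UNIV. e $ i *\<^sub>R partial_deriv i g x)" for g :: "real^3 \<Rightarrow> real^3" and x e
  define f' where "f' i x e = (cross3 (v x) (D \<phi> x e) + cross3 (D v x e) (\<phi> x)) $ i" for i x e
  have der: "(f i has_derivative f' i x) (at x)" for i x
    unfolding f_def f'_def D_def
    by (intro bounded_linear.has_derivative[OF bounded_linear_vec_nth]
        bounded_bilinear.FDERIV[OF bounded_bilinear_cross3] C1_has_derivative v \<phi>)
  have cont': "continuous_on UNIV (\<lambda>x. f' i x e)" for i e
    unfolding f'_def D_def
    by (intro continuous_intros C1_continuous[OF v] C1_continuous[OF \<phi>] C1_partial_continuous[OF v] C1_partial_continuous[OF \<phi>])
  have contf: "continuous_on UNIV (f i)" for i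
    unfolding f_def by (intro continuous_intros C1_continuous[OF v] C1_continuous[OF \<phi>])
  have div: "classical_curl v x \<bullet> \<phi> x - v x \<bullet> classical_curl \<phi> x = (\<Sum>i\<in>UNIV. f' i x (axis i 1))" for x
  proof -
    have "D g x (axis i 1) = partial_deriv i g x" for g i
      unfolding D_def by (simp add: axis_def if_distrib[of "\<lambda>r. r *\<^sub>R _"] cong: if_cong)
    then show ?thesis
      by (simp add: f'_def sum_3 classical_curl_def inner_vec_def cross3_def algebra_simps)
  qed
  have fin: "finite C" using tet_finite[OF C] .
  have cH: "compact (convex hull C)" using fin by (intro compact_convex_hull finite_imp_compact)
  have int: "integrable lborel (\<lambda>x. indicator (convex hull C) x * f' i x e)" for i e
    using borel_integrable_compact[OF cH continuous_on_subset[OF cont']] by simp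
  have card: "card (C - {a}) = 3" if "a \<in> C" for a
    using C that fin by (simp add: tet_def)
  have "std3_volume * (\<integral>x. indicator (convex hull C) x * (classical_curl v x \<bullet> \<phi> x - v x \<bullet> classical_curl \<phi> x) \<partial>lborel)
    = (\<Sum>i\<in>UNIV. std3_volume * (\<integral>x. indicator (convex hull C) x * f' i x (axis i 1) \<partial>lborel))"
    unfolding div sum_distrib_left by (subst Bochner_Integration.integral_sum) (auto simp: int sum_distrib_left)
  also have "\<dots> = (\<Sum>i\<in>UNIV. - measure lborel (convex hull C) * (\<Sum>a\<in>C. (grad C a \<bullet> axis i 1) * face_int (C - {a}) (f i)))"
    by (intro sum.cong refl tet_gauss[OF C der cont'])
  also have "\<dots> = - measure lborel (convex hull C) * (\<Sum>a\<in>C. \<Sum>i\<in>UNIV. grad C a $ i * face_int (C - {a}) (f i))"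
    unfolding sum_distrib_left[symmetric] by (subst sum.swap) (simp add: inner_axis)
  also have "(\<Sum>a\<in>C. \<Sum>i\<in>UNIV. grad C a $ i * face_int (C - {a}) (f i)) = (\<Sum>a\<in>C. face_int (C - {a}) (\<lambda>x. grad C a \<bullet> cross3 (v x) (\<phi> x)))"
  proof (intro sum.cong refl)
    fix a assume "a \<in> C"
    then have "face_int (C - {a}) (\<lambda>x. \<Sum>i\<in>UNIV. grad C a $ i * f i x) = (\<Sum>i\<in>UNIV. grad C a $ i * face_int (C - {a}) (f i))"
      by (intro face_int_sum contf card)
    then show "(\<Sum>i\<in>UNIV. grad C a $ i * face_int (C - {a}) (f i)) = face_int (C - {a}) (\<lambda>x. grad C a \<bullet> cross3 (v x) (\<phi> x))"
      by (simp add: f_def inner_vec_def)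
  qed
  finally show ?thesis .
qed

section \<open>Smooth bump functions and the fundamental lemma\<close>

text \<open>The family contains \<open>exp (- 1 / x)\<close>, extended by zero, and its span is
  closed under differentiation; so smoothness of bumps becomes an induction on the order with a
  single derivative computed.\<close>

definition flat_exp :: "nat \<Rightarrow> real \<Rightarrow> real" where
  "flat_exp k x = (if x > 0 then (1 / x) ^ k * exp (- (1 / x)) else 0)"

lemma flat_exp_tendsto_0: "(flat_exp k \<longlongrightarrow> 0) (at 0)"
proof -
  have "((\<lambda>x. (inverse x) ^ k / exp (inverse x)) \<longlongrightarrow> (0::real)) (at_right 0)"
    by (rule filterlim_compose[OF tendsto_power_div_exp_0 filterlim_inverse_at_top_right])
  moreover have "\<forall>\<^sub>F x in at_right 0. (inverse x) ^ k / exp (inverse x) = flat_exp k (x::real)"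
    unfolding eventually_at_right_field
    by (intro exI[of _ 1]) (auto simp: flat_exp_def exp_minus field_simps)
  ultimately have "(flat_exp k \<longlongrightarrow> 0) (at_right 0)" by (rule Lim_transform_eventually)
  moreover have "(flat_exp k \<longlongrightarrow> 0) (at_left 0)"
  proof (rule Lim_transform_eventually[OF tendsto_const])
    show "\<forall>\<^sub>F x in at_left 0. 0 = flat_exp k (x::real)"
      unfolding eventually_at_left_field by (intro exI[of _ "-1"]) (auto simp: flat_exp_def)
  qed
  ultimately show ?thesis by (simp add: filterlim_split_at)
qed

lemma flat_exp_derivative:
  "(flat_exp k has_real_derivative (flat_exp (Suc (Suc k)) x - k * flat_exp (Suc k) x)) (at x)"
proof -
  consider "x > 0" | "x < 0" | "x = 0" by linarith
  then show ?thesis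
  proof cases
    case 1
    have "((\<lambda>x. (1 / x) ^ k * exp (- (1 / x))) has_real_derivative (flat_exp (Suc (Suc k)) x - k * flat_exp (Suc k) x)) (at x)"
    proof -
      have p: "((\<lambda>x. 1 / x) has_real_derivative - (1 / x\<^sup>2)) (at x)"
        using 1 by (auto intro!: derivative_eq_intros simp: power2_eq_square)
      have "((\<lambda>x. exp (- (1 / x))) has_real_derivative exp (- (1 / x)) * (- (- (1 / x\<^sup>2)))) (at x)"
        by (rule DERIV_chain2[OF DERIV_exp DERIV_minus[OF p]])
      from DERIV_mult[OF DERIV_power[OF p, of k] this] show ?thesis
        by (rule DERIV_cong) (use 1 in \<open>cases k; simp add: flat_exp_def field_simps power2_eq_square\<close>)
    qed
    then show ?thesis
    proof (rule has_field_derivative_transform_within_open[of _ _ _ "{0<..}"])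
      show "(1 / y) ^ k * exp (- (1 / y)) = flat_exp k y" if "y \<in> {0<..}" for y
        using that by (simp add: flat_exp_def)
    qed (use 1 in auto)
  next
    case 2
    have "((\<lambda>x. 0) has_real_derivative (flat_exp (Suc (Suc k)) x - k * flat_exp (Suc k) x)) (at x)"
      using 2 by (simp add: flat_exp_def)
    then show ?thesis
      by (rule has_field_derivative_transform_within_open[of _ _ _ "{..<0}"]) (use 2 in \<open>auto simp: flat_exp_def\<close>)
  next
    case 3
    have "((\<lambda>h. flat_exp k h / h) \<longlongrightarrow> 0) (at 0)"
    proof (rule Lim_transform_eventually[OF flat_exp_tendsto_0[of "Suc k"]])
      show "\<forall>\<^sub>F x in at 0. flat_exp (Suc k) x = flat_exp k x / x"
        by (intro always_eventually) (auto simp: flat_exp_def)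
    qed
    then have "(flat_exp k has_real_derivative 0) (at 0)"
      unfolding DERIV_def by (simp add: flat_exp_def)
    then show ?thesis using 3 by (simp add: flat_exp_def)
  qed
qed

text \<open>Bumps on the interval from \<open>a\<close> to \<open>b\<close> together with all their
  derivatives. Here \<open>k\<close> is a steepness and not a degree: for positive \<open>k\<close>
  the support stays fixed, and the bump with both indices 0 tends to 1 inside the interval as
  \<open>k\<close> grows.\<close>

inductive_set bumps :: "real \<Rightarrow> real \<Rightarrow> real \<Rightarrow> (real \<Rightarrow> real) set" for k a b where
  base: "(\<lambda>x. flat_exp i (k * (x - a)) * flat_exp j (k * (b - x))) \<in> bumps k a b"
| add: "f \<in> bumps k a b \<Longrightarrow> g \<in> bumps k a b \<Longrightarrow> (\<lambda>x. f x + g x) \<in> bumps k a b"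
| cmult: "f \<in> bumps k a b \<Longrightarrow> (\<lambda>x. c * f x) \<in> bumps k a b"

lemma bumps_derivative: "f \<in> bumps k a b \<Longrightarrow> \<exists>f'\<in>bumps k a b. \<forall>x. (f has_real_derivative f' x) (at x)"
proof (induction rule: bumps.induct)
  case (base i j)
  let ?G = "\<lambda>i j x. flat_exp i (k * (x - a)) * flat_exp j (k * (b - x))"
  let ?f' = "\<lambda>x. (k * ?G (Suc (Suc i)) j x + (- k * real i) * ?G (Suc i) j x) +
     ((- k) * ?G i (Suc (Suc j)) x + (k * real j) * ?G i (Suc j) x)"
  have "?f' \<in> bumps k a b" by (intro bumps.intros)
  moreover have "(?G i j has_real_derivative ?f' x) (at x)" for x
  proof -
    have "((\<lambda>x. flat_exp i (k * (x - a))) has_real_derivative (flat_exp (Suc (Suc i)) (k * (x - a)) - i * flat_exp (Suc i) (k * (x - a))) * k) (at x)"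
      by (rule DERIV_chain2[OF flat_exp_derivative]) (auto intro!: derivative_eq_intros)
    moreover have "((\<lambda>x. flat_exp j (k * (b - x))) has_real_derivative (flat_exp (Suc (Suc j)) (k * (b - x)) - j * flat_exp (Suc j) (k * (b - x))) * (- k)) (at x)"
      by (rule DERIV_chain2[OF flat_exp_derivative]) (auto intro!: derivative_eq_intros)
    ultimately show ?thesis
      by (rule DERIV_cong[OF DERIV_mult]) (simp add: algebra_simps)
  qed
  ultimately show ?case by (intro bexI[of _ ?f']) auto
next
  case (add f g)
  then obtain f' g' where "f' \<in> bumps k a b" "\<forall>x. (f has_real_derivative f' x) (at x)"
    "g' \<in> bumps k a b" "\<forall>x. (g has_real_derivative g' x) (at x)" by blast
  then show ?case by (intro bexI[of _ "\<lambda>x. f' x + g' x"]) (auto intro: bumps.intros DERIV_add)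
next
  case (cmult f c)
  then obtain f' where "f' \<in> bumps k a b" "\<forall>x. (f has_real_derivative f' x) (at x)" by blast
  then show ?case by (intro bexI[of _ "\<lambda>x. c * f' x"]) (auto intro: bumps.intros DERIV_cmult)
qed

text \<open>A class of fields that is closed under partial derivatives, so that each member is
  smooth by induction on the order.\<close>

definition tensor_fields :: "real \<Rightarrow> real^3 \<Rightarrow> real^3 \<Rightarrow> real^3 \<Rightarrow> (real^3 \<Rightarrow> real^3) set" where
  "tensor_fields k a b e = {\<phi>. \<exists>f1\<in>bumps k (a $ 1) (b $ 1). \<exists>f2\<in>bumps k (a $ 2) (b $ 2). \<exists>f3\<in>bumps k (a $ 3) (b $ 3).
     \<phi> = (\<lambda>x. (f1 (x $ 1) * f2 (x $ 2) * f3 (x $ 3)) *\<^sub>R e)}"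

lemma tensor_fields_derivative:
  assumes "\<phi> \<in> tensor_fields k a b e"
  shows "(\<forall>x. \<phi> differentiable (at x)) \<and> (\<forall>i. partial_deriv i \<phi> \<in> tensor_fields k a b e)"
proof -
  obtain f1 f2 f3 where f: "f1 \<in> bumps k (a $ 1) (b $ 1)" "f2 \<in> bumps k (a $ 2) (b $ 2)" "f3 \<in> bumps k (a $ 3) (b $ 3)"
    "\<phi> = (\<lambda>x. (f1 (x $ 1) * f2 (x $ 2) * f3 (x $ 3)) *\<^sub>R e)"
    using assms by (auto simp: tensor_fields_def)
  obtain f1' where f1': "f1' \<in> bumps k (a $ 1) (b $ 1)" "\<forall>x. (f1 has_real_derivative f1' x) (at x)"
    using bumps_derivative[OF f(1)] by blast
  obtain f2' where f2': "f2' \<in> bumps k (a $ 2) (b $ 2)" "\<forall>x. (f2 has_real_derivative f2' x) (at x)"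
    using bumps_derivative[OF f(2)] by blast
  obtain f3' where f3': "f3' \<in> bumps k (a $ 3) (b $ 3)" "\<forall>x. (f3 has_real_derivative f3' x) (at x)"
    using bumps_derivative[OF f(3)] by blast
  have c: "((\<lambda>x. g (x $ i)) has_derivative (\<lambda>h. g' (x $ i) * h $ i)) (at x)"
    if "\<forall>x. (g has_real_derivative g' x) (at x)" for g g' :: "real \<Rightarrow> real" and i :: 3 and x :: "real^3"
  proof -
    have "((\<lambda>x::real^3. x $ i) has_derivative (\<lambda>h. h $ i)) (at x)"
      by (intro bounded_linear.has_derivative[OF bounded_linear_vec_nth] has_derivative_ident)
    from has_derivative_compose[OF this, of g "\<lambda>h. g' (x $ i) * h"] that
    show ?thesis by (simp add: has_field_derivative_def)
  qed
  have d: "(\<phi> has_derivative (\<lambda>h. ((f1' (x $ 1) * h $ 1) * f2 (x $ 2) * f3 (x $ 3) +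
      f1 (x $ 1) * (f2' (x $ 2) * h $ 2) * f3 (x $ 3) + f1 (x $ 1) * f2 (x $ 2) * (f3' (x $ 3) * h $ 3)) *\<^sub>R e)) (at x)" for x
  proof -
    have "(\<phi> has_derivative (\<lambda>h. (f1 (x $ 1) * f2 (x $ 2) * (f3' (x $ 3) * h $ 3) +
        (f1 (x $ 1) * (f2' (x $ 2) * h $ 2) + (f1' (x $ 1) * h $ 1) * f2 (x $ 2)) * f3 (x $ 3)) *\<^sub>R e)) (at x)"
      unfolding f(4)
      by (rule has_derivative_scaleR_left[OF has_derivative_mult[OF has_derivative_mult[OF c[OF f1'(2)] c[OF f2'(2)]] c[OF f3'(2)]]])
    then show ?thesis by (rule has_derivative_eq_rhs) (simp add: fun_eq_iff algebra_simps)
  qed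
  have "partial_deriv i \<phi> \<in> tensor_fields k a b e" for i
  proof -
    have p: "partial_deriv i \<phi> x = ((f1' (x $ 1) * axis i 1 $ 1) * f2 (x $ 2) * f3 (x $ 3) +
      f1 (x $ 1) * (f2' (x $ 2) * axis i 1 $ 2) * f3 (x $ 3) + f1 (x $ 1) * f2 (x $ 2) * (f3' (x $ 3) * axis i 1 $ 3)) *\<^sub>R e" for x
      unfolding partial_deriv_def frechet_derivative_at[OF d, symmetric] by simp
    consider "i = 1" | "i = 2" | "i = 3" using exhaust_3 by blast
    then show ?thesis
    proof cases
      case 1
      then have "partial_deriv i \<phi> = (\<lambda>x. (f1' (x $ 1) * f2 (x $ 2) * f3 (x $ 3)) *\<^sub>R e)"
        using p by (auto simp: axis_def)
      then show ?thesis using f f1' unfolding tensor_fields_def by blast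
    next
      case 2
      then have "partial_deriv i \<phi> = (\<lambda>x. (f1 (x $ 1) * f2' (x $ 2) * f3 (x $ 3)) *\<^sub>R e)"
        using p by (auto simp: axis_def)
      then show ?thesis using f f2' unfolding tensor_fields_def by blast
    next
      case 3
      then have "partial_deriv i \<phi> = (\<lambda>x. (f1 (x $ 1) * f2 (x $ 2) * f3' (x $ 3)) *\<^sub>R e)"
        using p by (auto simp: axis_def)
      then show ?thesis using f f3' unfolding tensor_fields_def by blast
    qed
  qed
  then show ?thesis using d by (auto simp: differentiable_def)
qed

lemma tensor_fields_smooth: "\<phi> \<in> tensor_fields k a b e \<Longrightarrow> smooth_field \<phi>"
proof -
  have "\<forall>\<phi>\<in>tensor_fields k a b e. Ck_field n \<phi>" for n
  proof (induction n)
    case 0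
    then show ?case
      using tensor_fields_derivative by (auto intro!: continuous_at_imp_continuous_on differentiable_imp_continuous_within)
  next
    case (Suc n)
    then show ?case using tensor_fields_derivative by auto
  qed
  then show "\<phi> \<in> tensor_fields k a b e \<Longrightarrow> smooth_field \<phi>" by (simp add: smooth_field_def)
qed

definition box_bump :: "real \<Rightarrow> real^3 \<Rightarrow> real^3 \<Rightarrow> real^3 \<Rightarrow> real" where
  "box_bump k a b x = (flat_exp 0 (k * (x $ 1 - a $ 1)) * flat_exp 0 (k * (b $ 1 - x $ 1))) *
     (flat_exp 0 (k * (x $ 2 - a $ 2)) * flat_exp 0 (k * (b $ 2 - x $ 2))) *
     (flat_exp 0 (k * (x $ 3 - a $ 3)) * flat_exp 0 (k * (b $ 3 - x $ 3)))"

lemma flat_exp_0: "0 \<le> flat_exp 0 x" "flat_exp 0 x \<le> 1" "flat_exp 0 x = 0 \<longleftrightarrow> x \<le> 0"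
  by (auto simp: flat_exp_def)

lemma box_bump_nonneg: "0 \<le> box_bump k a b x"
  unfolding box_bump_def by (intro mult_nonneg_nonneg flat_exp_0)

lemma box_bump_le_1: "box_bump k a b x \<le> 1"
  unfolding box_bump_def by (intro mult_le_one mult_nonneg_nonneg flat_exp_0)

lemma box_bump_eq_0: "k > 0 \<Longrightarrow> box_bump k a b x = 0 \<longleftrightarrow> x \<notin> box a b"
  by (auto simp: box_bump_def flat_exp_0 mem_box_cart forall_3 mult_le_0_iff)

lemma box_bump_smooth: "smooth_field (\<lambda>x. box_bump k a b x *\<^sub>R e)"
proof (rule tensor_fields_smooth)
  show "(\<lambda>x. box_bump k a b x *\<^sub>R e) \<in> tensor_fields k a b e"
    unfolding tensor_fields_def box_bump_def
    by (intro CollectI bexI[of _ "\<lambda>t. flat_exp 0 (k * (t - a $ 1)) * flat_exp 0 (k * (b $ 1 - t))"]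
        bexI[of _ "\<lambda>t. flat_exp 0 (k * (t - a $ 2)) * flat_exp 0 (k * (b $ 2 - t))"]
        bexI[of _ "\<lambda>t. flat_exp 0 (k * (t - a $ 3)) * flat_exp 0 (k * (b $ 3 - t))"] bumps.base refl)
qed

lemma box_bump_continuous: "continuous_on S (box_bump k a b)"
proof -
  have "continuous_on S (\<lambda>x. (box_bump k a b x *\<^sub>R (axis 1 1 :: real^3)) $ 1)"
    by (intro continuous_intros C1_continuous[OF smooth_field_C1[OF box_bump_smooth]])
  then show ?thesis by (simp add: axis_def)
qed

lemma box_bump_test_field:
  assumes "cbox a b \<subseteq> \<Omega>" "k > 0"
  shows "test_field \<Omega> (\<lambda>x. box_bump k a b x *\<^sub>R e)"
proof -
  have "{x. box_bump k a b x *\<^sub>R e \<noteq> 0} \<subseteq> cbox a b"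
    using box_bump_eq_0[OF assms(2), of a b] box_subset_cbox[of a b] by auto
  then have "closure {x. box_bump k a b x *\<^sub>R e \<noteq> 0} \<subseteq> cbox a b"
    by (intro closure_minimal closed_cbox)
  then show ?thesis
    unfolding test_field_def using assms box_bump_smooth
    by (meson bounded_cbox bounded_subset closed_closure compact_eq_bounded_closed order_trans)
qed

lemma box_bump_tendsto: "(\<lambda>n. box_bump (Suc n) a b x) \<longlonglongrightarrow> indicator (box a b) x"
proof (cases "x \<in> box a b")
  case True
  have f: "(\<lambda>n. flat_exp 0 (real (Suc n) * t)) \<longlonglongrightarrow> 1" if "t > 0" for t
  proof -
    have "(\<lambda>n. inverse (real (Suc n))) \<longlonglongrightarrow> 0" by (rule LIMSEQ_inverse_real_of_nat)
    then have "(\<lambda>n. exp (- (inverse (real (Suc n)) * inverse t))) \<longlonglongrightarrow> exp (- (0 * inverse t))"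
      by (intro tendsto_intros)
    moreover have "flat_exp 0 (real (Suc n) * t) = exp (- (inverse (real (Suc n)) * inverse t))" for n
      using that by (simp add: flat_exp_def inverse_eq_divide)
    ultimately show ?thesis by simp
  qed
  have "(\<lambda>n. box_bump (Suc n) a b x) \<longlonglongrightarrow> (1 * 1) * (1 * 1) * (1 * 1)"
    unfolding box_bump_def using True
    by (intro tendsto_mult f) (auto simp: mem_box_cart forall_3)
  then show ?thesis using True by simp
next
  case False
  then show ?thesis using box_bump_eq_0[of "real (Suc _)" a b x] by simp
qed

text \<open>Increasing the steepness turns the hypothesis into vanishing integrals over boxes inside
  \<open>U\<close>, by dominated convergence; differentiating these integrals over shrinking cubes
  recovers \<open>f\<close> almost everywhere.\<close>

lemma fundamental_lemma:
  fixes f :: "real^3 \<Rightarrow> real"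
  assumes f: "integrable lebesgue f" and U: "open U"
    and zero: "\<And>a b k. cbox a b \<subseteq> U \<Longrightarrow> k > 0 \<Longrightarrow> (\<integral>x. f x * box_bump k a b x \<partial>lebesgue) = 0"
  shows "AE x in lebesgue. x \<in> U \<longrightarrow> f x = 0"
proof -
  have fm: "f \<in> borel_measurable lebesgue" using f by (rule borel_measurable_integrable)
  have box0: "(\<integral>x. f x * indicator (box a b) x \<partial>lebesgue) = 0" if "cbox a b \<subseteq> U" for a b
  proof -
    have "(\<lambda>n. \<integral>x. f x * box_bump (Suc n) a b x \<partial>lebesgue) \<longlonglongrightarrow> (\<integral>x. f x * indicator (box a b) x \<partial>lebesgue)"
    proof (rule integral_dominated_convergence[where w = "\<lambda>x. \<bar>f x\<bar>"])
      show "(\<lambda>x. f x * indicator (box a b) x) \<in> borel_measurable lebesgue"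
        using fm by (intro borel_measurable_times borel_measurable_indicator) auto
      show "(\<lambda>x. f x * box_bump (Suc n) a b x) \<in> borel_measurable lebesgue" for n
      proof (rule borel_measurable_times[OF fm])
        have "box_bump (Suc n) a b \<in> borel_measurable lborel"
          using borel_measurable_continuous_onI[OF box_bump_continuous] by simp
        then show "box_bump (Suc n) a b \<in> borel_measurable lebesgue" by (rule measurable_completion)
      qed
      show "integrable lebesgue (\<lambda>x. \<bar>f x\<bar>)" using f by simp
      show "AE x in lebesgue. (\<lambda>n. f x * box_bump (Suc n) a b x) \<longlonglongrightarrow> f x * indicator (box a b) x"
        by (intro AE_I2 tendsto_intros box_bump_tendsto)
      show "AE x in lebesgue. norm (f x * box_bump (Suc n) a b x) \<le> \<bar>f x\<bar>" for n
        using box_bump_nonneg box_bump_le_1 by (intro AE_I2) (auto simp: abs_mult mult_left_le)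
    qed
    moreover have "(\<integral>x. f x * box_bump (Suc n) a b x \<partial>lebesgue) = 0" for n
      by (rule zero[OF that]) simp
    ultimately show ?thesis by (simp add: LIMSEQ_const_iff)
  qed
  have ai: "f absolutely_integrable_on S" if "S \<in> sets lebesgue" for S
    using integrable_mult_indicator[OF that f] by (simp add: set_integrable_def)
  have fint: "f integrable_on cbox a b" for a b
    using ai[of "cbox a b"] set_lebesgue_integral_eq_integral(1) by auto
  have cbox0: "integral (cbox a b) f = 0" if "cbox a b \<subseteq> U" for a b
  proof -
    have "integral (cbox a b) f = integral (box a b) f"
      by (simp add: integral_open_interval)
    also have "\<dots> = (LINT x:box a b|lebesgue. f x)"
      using set_lebesgue_integral_eq_integral(2)[OF ai[of "box a b"]] by simp
    also have "\<dots> = 0"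
      using box0[OF that] by (simp add: set_lebesgue_integral_def mult.commute)
    finally show ?thesis .
  qed
  obtain N where N: "negligible N" "\<And>x e. x \<notin> N \<Longrightarrow> 0 < e \<Longrightarrow> \<exists>d>0. \<forall>h. 0 < h \<and> h < d \<longrightarrow>
      norm (integral (cbox x (x + h *\<^sub>R One)) f /\<^sub>R h ^ DIM(real^3) - f x) < e"
    using integrable_ccontinuous_explicit[OF fint] by metis
  have "f x = 0" if xU: "x \<in> U" and xN: "x \<notin> N" for x
  proof (rule ccontr)
    assume "f x \<noteq> 0"
    then obtain d where d: "d > 0" "\<And>h. 0 < h \<Longrightarrow> h < d \<Longrightarrow>
      norm (integral (cbox x (x + h *\<^sub>R One)) f /\<^sub>R h ^ DIM(real^3) - f x) < \<bar>f x\<bar>"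
      using N(2)[OF xN, of "\<bar>f x\<bar>"] by auto
    obtain r where r: "r > 0" "ball x r \<subseteq> U" using U xU open_contains_ball by blast
    \<comment> \<open>Small enough for the differentiation theorem and for the cube to stay in the
      ball; the \<open>+ 1\<close> makes the denominator positive without evaluating the norm of
      \<open>One\<close>.\<close>
    define h where "h = min (d / 2) (r / (2 * (norm (One :: real^3) + 1)))"
    have h: "0 < h" "h < d" using d r by (auto simp: h_def add_nonneg_pos intro!: divide_pos_pos)
    have "cbox x (x + h *\<^sub>R One) \<subseteq> ball x r"
    proof
      fix y assume y: "y \<in> cbox x (x + h *\<^sub>R One)"
      have "norm (y - x) \<le> norm (h *\<^sub>R (One :: real^3))"
      proof (rule norm_le_componentwise)
        fix b :: "real^3" assume "b \<in> Basis"
        then show "\<bar>(y - x) \<bullet> b\<bar> \<le> \<bar>(h *\<^sub>R One) \<bullet> b\<bar>"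
          using y h by (auto simp: mem_box inner_diff_left inner_add_left)
      qed
      also have "\<dots> = h * norm (One :: real^3)" using h by simp
      also have "\<dots> < r"
      proof -
        have "h * norm (One :: real^3) \<le> r / (2 * (norm (One :: real^3) + 1)) * (norm (One :: real^3) + 1)"
          using h r by (intro mult_mono) (auto simp: h_def add_nonneg_pos intro!: divide_nonneg_pos)
        also have "\<dots> = r / 2"
        proof -
          have "r / (2 * m) * m = r / 2" if "m > 0" for m :: real using that by simp
          moreover have "norm (One :: real^3) + 1 > 0" by (intro add_nonneg_pos) auto
          ultimately show ?thesis by blast
        qed
        finally show ?thesis using r by simp
      qed
      finally show "y \<in> ball x r" by (simp add: dist_norm norm_minus_commute)
    qed
    then show False using d(2)[OF h] cbox0[of x "x + h *\<^sub>R One"] r by auto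
  qed
  then have "AE x in lebesgue. x \<notin> N \<longrightarrow> (x \<in> U \<longrightarrow> f x = 0)" by simp
  moreover have "AE x in lebesgue. x \<notin> N"
    using N(1) negligible_iff_null_sets AE_not_in by blast
  ultimately show ?thesis by auto
qed

section \<open>Piecewise smooth fields and their weak curl\<close>

definition cell_int :: "(real^3) set \<Rightarrow> (real^3 \<Rightarrow> real) \<Rightarrow> real" where
  "cell_int C f = (\<integral>x. indicator (convex hull C) x * f x \<partial>lborel)"

lemma tet_hull_compact: "tet C \<Longrightarrow> compact (convex hull C)"
  by (intro compact_convex_hull finite_imp_compact tet_finite)

lemma tet_hull_lebesgue: "tet C \<Longrightarrow> convex hull C \<in> sets lebesgue"
  using borel_compact[OF tet_hull_compact] by (simp add: sets_completionI_sets)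

lemma cell_integrable_lborel:
  assumes "tet C" "continuous_on UNIV f"
  shows "integrable lborel (\<lambda>x. indicator (convex hull C) x * f x :: real)"
  using borel_integrable_compact[OF tet_hull_compact[OF assms(1)] continuous_on_subset[OF assms(2)]] by simp

lemma cell_integrable:
  assumes "tet C" "continuous_on UNIV f"
  shows "integrable lebesgue (\<lambda>x. indicator (convex hull C) x * f x :: real)"
  using cell_integrable_lborel[OF assms] integrable_completion[OF borel_measurable_integrable[OF cell_integrable_lborel[OF assms]]]
  by blast

lemma cell_int_lebesgue:
  assumes "tet C" "continuous_on UNIV f"
  shows "cell_int C f = (\<integral>x. indicator (convex hull C) x * f x \<partial>lebesgue)"
  unfolding cell_int_def
  using integral_completion[OF borel_measurable_integrable[OF cell_integrable_lborel[OF assms]]] by simp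

lemma grad_nonzero:
  assumes C: "tet C" and a: "a \<in> C"
  shows "grad C a \<noteq> 0"
proof
  assume 0: "grad C a = 0"
  have "card (C - {a}) = 3" using C a tet_finite[OF C] by (simp add: tet_def)
  then have "C - {a} \<noteq> {}" by (metis card.empty zero_neq_numeral)
  then obtain b where "b \<in> C" "b \<noteq> a" by auto
  then show False using grad_edge[OF C a a, of b] 0 by simp
qed

lemma face_bary_0:
  assumes C: "tet C" and B: "B \<subseteq> C" and a: "a \<in> C" "a \<notin> B" and x: "x \<in> convex hull B"
  shows "bary C a x = 0"
proof -
  have "finite B" using B tet_finite[OF C] finite_subset by blast
  then obtain u where "sum u B = 1" "(\<Sum>b\<in>B. u b *\<^sub>R b) = x"
    using x convex_hull_finite[of B] by auto
  then show ?thesis using bary_subset[OF C B _ _ a(1)] a(2) by simp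
qed

lemma face_negligible:
  assumes C: "tet C" and B: "B \<subset> C"
  shows "negligible (convex hull B)"
proof -
  obtain a where a: "a \<in> C" "a \<notin> B" using B by blast
  have "convex hull B \<subseteq> {x. grad C a \<bullet> x = - bary C a 0}"
  proof
    fix x assume "x \<in> convex hull B"
    then have "bary C a x = 0" using face_bary_0[OF C _ a] B by auto
    then show "x \<in> {x. grad C a \<bullet> x = - bary C a 0}" using bary_affine[OF C a(1), of x] by simp
  qed
  moreover have "negligible {x. grad C a \<bullet> x = - bary C a 0}"
    using grad_nonzero[OF C a(1)] by (intro negligible_hyperplane) auto
  ultimately show ?thesis by (rule negligible_subset[rotated])
qed

lemma interior_not_face:
  assumes C: "tet C" and a: "a \<in> C" and x: "x \<in> interior (convex hull C)"
  shows "bary C a x > 0"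
proof -
  obtain e where e: "e > 0" "ball x e \<subseteq> convex hull C"
    using x by (meson mem_interior)
  let ?g = "grad C a"
  have g: "norm ?g > 0" using grad_nonzero[OF C a] by simp
  define t where "t = e / (2 * norm ?g)"
  have t: "t > 0" using e g by (simp add: t_def)
  have "norm (t *\<^sub>R ?g) < e" using t g e by (simp add: t_def)
  then have "x - t *\<^sub>R ?g \<in> convex hull C" using e by (auto simp: subset_iff dist_norm)
  then have "bary C a (x - t *\<^sub>R ?g) \<ge> 0" using tet_hull[OF C] a by blast
  moreover have "bary C a x - bary C a (x - t *\<^sub>R ?g) = t * (?g \<bullet> ?g)"
    using bary_diff[OF C a, of x "x - t *\<^sub>R ?g"] by simp
  moreover have "t * (?g \<bullet> ?g) > 0" using t g by simp
  ultimately show ?thesis by linarith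
qed

lemma AE_interior_hull:
  assumes "tet C"
  shows "AE x in lebesgue. x \<in> convex hull C \<longrightarrow> x \<in> interior (convex hull C)"
proof -
  have "negligible (frontier (convex hull C))"
    by (rule negligible_convex_frontier) (rule convex_convex_hull)
  then have "AE x in lebesgue. x \<notin> frontier (convex hull C)"
    using negligible_iff_null_sets AE_not_in by blast
  then show ?thesis
    by eventually_elim (use closure_subset in \<open>auto simp: frontier_def\<close>)
qed

text \<open>Two different elements meet in a proper face of each, which lies in a plane.\<close>

lemma mesh_AE_disjoint:
  assumes tri: "triangulation \<T>"
  shows "AE x in lebesgue. \<forall>C\<in>mesh_tets \<T>. \<forall>D\<in>mesh_tets \<T>. x \<in> convex hull C \<longrightarrow> x \<in> convex hull D \<longrightarrow> C = D"
proof -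
  note fin = finite_mesh_tets[OF tri]
  have "AE x in lebesgue. x \<in> convex hull C \<longrightarrow> x \<in> convex hull D \<longrightarrow> C = D"
    if CD: "C \<in> mesh_tets \<T>" "D \<in> mesh_tets \<T>" for C D
  proof (cases "C = D")
    case False
    note tC = mesh_tets_tet[OF CD(1)] and tD = mesh_tets_tet[OF CD(2)]
    have "C \<inter> D \<noteq> C"
    proof
      assume "C \<inter> D = C"
      then have "C \<subseteq> D" by auto
      then have "C = D"
        using tC tD by (intro card_subset_eq tet_finite) (auto simp: tet_def)
      then show False using False by simp
    qed
    then have "negligible (convex hull (C \<inter> D))" by (intro face_negligible[OF tC]) auto
    then have "AE x in lebesgue. x \<notin> convex hull (C \<inter> D)"
      using negligible_iff_null_sets AE_not_in by blast
    then show ?thesis using mesh_hull_inter[OF tri CD] by (auto elim!: eventually_mono)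
  qed auto
  then show ?thesis using fin by (intro AE_finite_allI) auto
qed

text \<open>On the null set where elements overlap, the values add up.\<close>

definition glue :: "(real^3) set set \<Rightarrow> ((real^3) set \<Rightarrow> real^3 \<Rightarrow> 'b::real_vector) \<Rightarrow> real^3 \<Rightarrow> 'b" where
  "glue \<C> u x = (\<Sum>C\<in>\<C>. indicator (convex hull C) x *\<^sub>R u C x)"

lemma glue_AE:
  assumes tri: "triangulation \<T>"
  shows "AE x in lebesgue. \<forall>C\<in>mesh_tets \<T>. x \<in> convex hull C \<longrightarrow> glue (mesh_tets \<T>) u x = u C x"
  using mesh_AE_disjoint[OF tri]
proof eventually_elim
  case (elim x)
  show ?case
  proof (intro ballI impI)
    fix C assume C: "C \<in> mesh_tets \<T>" "x \<in> convex hull C"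
    have "glue (mesh_tets \<T>) u x = (\<Sum>D\<in>mesh_tets \<T>. if D = C then u C x else 0)"
      unfolding glue_def using elim C by (intro sum.cong refl) (auto simp: indicator_def)
    then show "glue (mesh_tets \<T>) u x = u C x"
      using C finite_mesh_tets[OF tri] by simp
  qed
qed

text \<open>
  The volume times \<open>grad C a\<close> is one third of the inward area normal of the face opposite to \<open>a\<close>, so
  this is, up to a factor, the sum of the tangential traces from all elements containing \<open>B\<close>.
\<close>

definition jump :: "(real^3) set set \<Rightarrow> ((real^3) set \<Rightarrow> real^3 \<Rightarrow> real^3) \<Rightarrow> (real^3) set \<Rightarrow> real^3 \<Rightarrow> real^3" where
  "jump \<C> u B x = (\<Sum>(C, a) \<in> {(C, a). C \<in> \<C> \<and> a \<in> C \<and> C - {a} = B}.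
     measure lborel (convex hull C) *\<^sub>R cross3 (grad C a) (u C x))"

definition mesh_faces :: "(real^3) set set \<Rightarrow> (real^3) set set" where
  "mesh_faces \<C> = {C - {a} | C a. C \<in> \<C> \<and> a \<in> C}"

lemma finite_mesh_faces:
  assumes "finite \<C>" "\<And>C. C \<in> \<C> \<Longrightarrow> tet C"
  shows "finite (mesh_faces \<C>)"
proof -
  have "mesh_faces \<C> = (\<lambda>(C, a). C - {a}) ` Sigma \<C> (\<lambda>C. C)" by (auto simp: mesh_faces_def)
  moreover have "finite (Sigma \<C> (\<lambda>C. C))" using assms tet_finite by blast
  ultimately show ?thesis by simp
qed

lemma mesh_face_card: "\<lbrakk>B \<in> mesh_faces \<C>; \<And>C. C \<in> \<C> \<Longrightarrow> tet C\<rbrakk> \<Longrightarrow> card B = 3"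
  unfolding mesh_faces_def using tet_finite by (auto simp: tet_def)

lemma jump_continuous:
  assumes "finite \<C>" "\<And>C. C \<in> \<C> \<Longrightarrow> tet C" "\<And>C. C \<in> \<C> \<Longrightarrow> continuous_on UNIV (u C)"
  shows "continuous_on UNIV (jump \<C> u B)"
  unfolding jump_def
  by (intro continuous_intros) (use assms in \<open>auto intro!: continuous_intros\<close>)

text \<open>The face terms of the elementwise formula are regrouped by faces as vertex sets, so that
  all contributions to one face are collected in \<open>jump\<close>.\<close>

lemma mesh_green:
  assumes fin: "finite \<C>" and tet: "\<And>C. C \<in> \<C> \<Longrightarrow> tet C" and u: "\<And>C. C \<in> \<C> \<Longrightarrow> Ck_field 1 (u C)" and \<phi>: "Ck_field 1 \<phi>"
  shows "std3_volume * (\<Sum>C\<in>\<C>. cell_int C (\<lambda>x. classical_curl (u C) x \<bullet> \<phi> x - u C x \<bullet> classical_curl \<phi> x)) =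
    - (\<Sum>B\<in>mesh_faces \<C>. face_int B (\<lambda>x. jump \<C> u B x \<bullet> \<phi> x))"
proof -
  define P where "P = Sigma \<C> (\<lambda>C. C)"
  have fP: "finite P" unfolding P_def using fin tet tet_finite by blast
  define h where "h p = measure lborel (convex hull (fst p)) * face_int (fst p - {snd p}) (\<lambda>x. grad (fst p) (snd p) \<bullet> cross3 (u (fst p) x) (\<phi> x))" for p
  have "std3_volume * (\<Sum>C\<in>\<C>. cell_int C (\<lambda>x. classical_curl (u C) x \<bullet> \<phi> x - u C x \<bullet> classical_curl \<phi> x))
     = (\<Sum>C\<in>\<C>. - measure lborel (convex hull C) * (\<Sum>a\<in>C. face_int (C - {a}) (\<lambda>x. grad C a \<bullet> cross3 (u C x) (\<phi> x))))"
    unfolding sum_distrib_left[where r = std3_volume] cell_int_def by (intro sum.cong refl tet_green tet u \<phi>)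
  also have "\<dots> = - (\<Sum>C\<in>\<C>. \<Sum>a\<in>C. h (C, a))"
    unfolding h_def by (simp add: sum_negf sum_distrib_left)
  also have "(\<Sum>C\<in>\<C>. \<Sum>a\<in>C. h (C, a)) = sum h P"
    unfolding P_def using fin tet tet_finite by (subst sum.Sigma) auto
  also have "sum h P = (\<Sum>B\<in>mesh_faces \<C>. sum h {p \<in> P. fst p - {snd p} = B})"
  proof (rule sum.group[symmetric, OF fP finite_mesh_faces[OF fin tet]])
    show "(\<lambda>p. fst p - {snd p}) ` P \<subseteq> mesh_faces \<C>"
    proof
      fix B assume "B \<in> (\<lambda>p. fst p - {snd p}) ` P"
      then obtain C a where "C \<in> \<C>" "a \<in> C" "B = C - {a}" by (auto simp: P_def)
      then show "B \<in> mesh_faces \<C>" unfolding mesh_faces_def by blast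
    qed
  qed simp
  also have "\<dots> = (\<Sum>B\<in>mesh_faces \<C>. face_int B (\<lambda>x. jump \<C> u B x \<bullet> \<phi> x))"
  proof (intro sum.cong refl)
    fix B assume B: "B \<in> mesh_faces \<C>"
    have cB: "card B = 3" using mesh_face_card[OF B tet] .
    define Q where "Q = {p \<in> P. fst p - {snd p} = B}"
    have Q: "Q = {(C, a). C \<in> \<C> \<and> a \<in> C \<and> C - {a} = B}" by (auto simp: Q_def P_def)
    have "sum h Q = (\<Sum>p\<in>Q. measure lborel (convex hull (fst p)) * face_int B (\<lambda>x. grad (fst p) (snd p) \<bullet> cross3 (u (fst p) x) (\<phi> x)))"
      by (intro sum.cong refl) (auto simp: h_def Q_def)
    also have "\<dots> = face_int B (\<lambda>x. \<Sum>p\<in>Q. measure lborel (convex hull (fst p)) * (grad (fst p) (snd p) \<bullet> cross3 (u (fst p) x) (\<phi> x)))"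
      using C1_continuous[OF u] C1_continuous[OF \<phi>]
      by (intro face_int_sum[symmetric] cB) (auto simp: Q_def P_def intro!: continuous_intros)
    also have "(\<lambda>x. \<Sum>p\<in>Q. measure lborel (convex hull (fst p)) * (grad (fst p) (snd p) \<bullet> cross3 (u (fst p) x) (\<phi> x))) = (\<lambda>x. jump \<C> u B x \<bullet> \<phi> x)"
    proof
      fix x
      have "g \<bullet> cross3 v w = cross3 g v \<bullet> w" for g v w :: "real^3"
        by (simp add: cross3_simps)
      then show "(\<Sum>p\<in>Q. measure lborel (convex hull (fst p)) * (grad (fst p) (snd p) \<bullet> cross3 (u (fst p) x) (\<phi> x))) = jump \<C> u B x \<bullet> \<phi> x"
        unfolding jump_def Q[symmetric] by (simp add: inner_sum_left case_prod_beta)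
    qed
    finally show "sum h {p \<in> P. fst p - {snd p} = B} = face_int B (\<lambda>x. jump \<C> u B x \<bullet> \<phi> x)"
      by (simp add: Q_def)
  qed
  finally show ?thesis .
qed

lemma field_zero_outside:
  assumes K: "closed K" and z: "\<And>x. x \<notin> K \<Longrightarrow> \<phi> x = 0" and x: "x \<notin> K"
  shows "classical_curl \<phi> x = 0"
proof -
  have "((\<lambda>y. 0) has_derivative (\<lambda>h. 0)) (at x)" by simp
  then have "(\<phi> has_derivative (\<lambda>h. 0)) (at x)"
    by (rule has_derivative_transform_within_open[of _ _ _ _ "- K"]) (use K z x in auto)
  then have "frechet_derivative \<phi> (at x) = (\<lambda>h. 0)" by (rule frechet_derivative_at[symmetric])
  then show ?thesis by (simp add: classical_curl_def partial_deriv_def vec_eq_iff forall_3)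
qed

lemma test_field_zero_outside:
  assumes \<phi>: "test_field \<Omega> \<phi>" and x: "x \<notin> \<Omega>"
  shows "\<phi> x = 0" "classical_curl \<phi> x = 0"
proof -
  let ?K = "closure {x. \<phi> x \<noteq> 0}"
  have z: "\<phi> y = 0" if "y \<notin> ?K" for y
    using that closure_subset[of "{x. \<phi> x \<noteq> 0}"] by blast
  have "x \<notin> ?K" using \<phi> x by (auto simp: test_field_def)
  then show "\<phi> x = 0" by (rule z)
  show "classical_curl \<phi> x = 0" by (rule field_zero_outside[OF closed_closure z \<open>x \<notin> ?K\<close>])
qed

lemma L2_inner_lebesgue:
  assumes "\<Omega> \<in> sets lebesgue"
  shows "L2_inner \<Omega> v w = (\<integral>x. indicator \<Omega> x * (v x \<bullet> w x) \<partial>lebesgue)"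
  unfolding L2_inner_def using assms by (subst integral_restrict_space) auto

lemma square_integrable_lebesgue:
  assumes "square_integrable \<Omega> v" "\<Omega> \<in> sets lebesgue"
  shows "(\<lambda>x. indicator \<Omega> x *\<^sub>R v x) \<in> borel_measurable lebesgue"
    "integrable lebesgue (\<lambda>x. indicator \<Omega> x * (norm (v x))\<^sup>2)"
  using assms by (auto simp: square_integrable_def borel_measurable_restrict_space_iff integrable_restrict_space)

lemma continuous_lebesgue_measurable:
  assumes "continuous_on UNIV f"
  shows "f \<in> borel_measurable lebesgue"
proof (rule measurable_completion)
  show "f \<in> borel_measurable lborel" using borel_measurable_continuous_onI[OF assms] by simp
qed

text \<open>Bumps supported inside one element leave no boundary terms in \<open>tet_green\<close>,
  and the fundamental lemma then compares the curls componentwise. The result applies to every weak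
  curl, hence also to the one picked arbitrarily by \<open>weak_curl\<close>.\<close>

lemma weak_curl_on_cell:
  assumes w: "has_weak_curl \<Omega> \<xi> w" and O: "open \<Omega>" and C: "tet C" and v: "Ck_field 1 v"
    and eq: "AE x in lebesgue. x \<in> convex hull C \<longrightarrow> x \<in> \<Omega> \<longrightarrow> \<xi> x = v x"
  shows "AE x in lebesgue. x \<in> convex hull C \<longrightarrow> x \<in> \<Omega> \<longrightarrow> w x = classical_curl v x"
proof -
  define U where "U = interior (convex hull C) \<inter> \<Omega>"
  have U: "open U" "U \<subseteq> \<Omega>" "U \<subseteq> convex hull C"
    using O interior_subset by (auto simp: U_def)
  have Om: "\<Omega> \<in> sets lebesgue" "U \<in> sets lebesgue" using O U(1) by (auto simp: sets_completionI_sets)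
  have si: "square_integrable \<Omega> \<xi>" "square_integrable \<Omega> w" using w by (auto simp: has_weak_curl_def)
  note \<xi>m = square_integrable_lebesgue[OF si(1) Om(1)] and wm = square_integrable_lebesgue[OF si(2) Om(1)]
  have cv: "continuous_on UNIV (classical_curl v)" by (rule C1_curl_continuous[OF v])
  have "AE x in lebesgue. x \<in> U \<longrightarrow> indicator U x * (w x $ i - classical_curl v x $ i) = 0" for i
  proof (rule fundamental_lemma[OF _ U(1)])
    \<comment> \<open>Square integrability on a set of finite volume gives integrability, by the
      bound of a number by 1 plus its square.\<close>
    have i1: "integrable lebesgue (\<lambda>x. indicator U x * w x $ i)"
    proof (rule Bochner_Integration.integrable_bound)
      show "integrable lebesgue (\<lambda>x. indicator (convex hull C) x * 1 + indicator \<Omega> x * (norm (w x))\<^sup>2)"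
        by (intro Bochner_Integration.integrable_add cell_integrable C wm(2)) auto
      have "(\<lambda>x. indicator U x * (indicator \<Omega> x *\<^sub>R w x) $ i) \<in> borel_measurable lebesgue"
        using Om(2) by (intro borel_measurable_times borel_measurable_indicator measurable_compose[OF wm(1)]) auto
      moreover have "(\<lambda>x. indicator U x * (indicator \<Omega> x *\<^sub>R w x) $ i) = (\<lambda>x. indicator U x * w x $ i)"
        using U by (auto simp: indicator_def fun_eq_iff)
      ultimately show "(\<lambda>x. indicator U x * w x $ i) \<in> borel_measurable lebesgue" by simp
      have "norm (indicator U x * w x $ i) \<le> norm (indicator (convex hull C) x * 1 + indicator \<Omega> x * (norm (w x))\<^sup>2)" for x
      proof (cases "x \<in> U")
        case True
        have "\<bar>w x $ i\<bar> \<le> norm (w x)" by (rule component_le_norm_cart)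
        also have "norm (w x) \<le> 1 + (norm (w x))\<^sup>2"
        proof -
          have "2 * norm (w x) \<le> 1 + (norm (w x))\<^sup>2"
            using zero_le_power2[of "norm (w x) - 1"] unfolding power2_diff by simp
          then show ?thesis using norm_ge_zero[of "w x"] by linarith
        qed
        finally show ?thesis using True U by (auto simp: indicator_def)
      qed simp
      then show "AE x in lebesgue. norm (indicator U x * w x $ i) \<le> norm (indicator (convex hull C) x * 1 + indicator \<Omega> x * (norm (w x))\<^sup>2)"
        by simp
    qed
    have i2: "integrable lebesgue (\<lambda>x. indicator U x * classical_curl v x $ i)"
    proof (rule Bochner_Integration.integrable_bound)
      show "integrable lebesgue (\<lambda>x. indicator (convex hull C) x * \<bar>classical_curl v x $ i\<bar>)"
        by (intro cell_integrable C continuous_intros cv)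
      show "(\<lambda>x. indicator U x * classical_curl v x $ i) \<in> borel_measurable lebesgue"
        using Om(2) by (intro borel_measurable_times borel_measurable_indicator continuous_lebesgue_measurable continuous_intros cv)
      show "AE x in lebesgue. norm (indicator U x * classical_curl v x $ i) \<le> norm (indicator (convex hull C) x * \<bar>classical_curl v x $ i\<bar>)"
        using U by (intro AE_I2) (auto simp: indicator_def abs_mult)
    qed
    show "integrable lebesgue (\<lambda>x. indicator U x * (w x $ i - classical_curl v x $ i))"
      using Bochner_Integration.integrable_diff[OF i1 i2] by (simp add: right_diff_distrib)
    fix a b :: "real^3" and k :: real assume cb: "cbox a b \<subseteq> U" and k: "k > 0"
    define \<phi> where "\<phi> = (\<lambda>x. box_bump k a b x *\<^sub>R (axis i 1 :: real^3))"
    have tf: "test_field \<Omega> \<phi>" unfolding \<phi>_def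
      by (rule box_bump_test_field) (use cb U k in auto)
    have \<phi>1: "Ck_field 1 \<phi>" using tf smooth_field_C1 by (auto simp: test_field_def)
    have z: "\<phi> x = 0" if "x \<notin> cbox a b" for x
      using that box_bump_eq_0[OF k, of a b x] box_subset_cbox[of a b] by (auto simp: \<phi>_def)
    have zc: "classical_curl \<phi> x = 0" if "x \<notin> cbox a b" for x
      by (rule field_zero_outside[OF closed_cbox z that])
    have bump_int: "integrable lebesgue (\<lambda>x. (indicator U x * g x) * box_bump k a b x)"
      if "integrable lebesgue (\<lambda>x. indicator U x * g x)" for g :: "real^3 \<Rightarrow> real"
    proof (rule Bochner_Integration.integrable_bound[OF that])
      show "(\<lambda>x. (indicator U x * g x) * box_bump k a b x) \<in> borel_measurable lebesgue"
        by (rule borel_measurable_times[OF borel_measurable_integrable[OF that] continuous_lebesgue_measurable[OF box_bump_continuous]])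
      show "AE x in lebesgue. norm ((indicator U x * g x) * box_bump k a b x) \<le> norm (indicator U x * g x)"
        using box_bump_nonneg[of k a b] box_bump_le_1[of k a b] by (intro AE_I2) (auto simp: abs_mult mult_left_le)
    qed
    have e1: "(\<integral>x. (indicator U x * w x $ i) * box_bump k a b x \<partial>lebesgue) = L2_inner \<Omega> w \<phi>"
      unfolding L2_inner_lebesgue[OF Om(1)]
    proof (intro Bochner_Integration.integral_cong refl)
      fix x
      show "(indicator U x * w x $ i) * box_bump k a b x = indicator \<Omega> x * (w x \<bullet> \<phi> x)"
      proof (cases "x \<in> cbox a b")
        case True
        then have "x \<in> U" "x \<in> \<Omega>" "x \<in> convex hull C" using cb U by auto
        then show ?thesis by (simp add: \<phi>_def inner_axis)
      next
        case False
        then show ?thesis using z[OF False] by (simp add: \<phi>_def axis_eq_0_iff)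
      qed
    qed
    have e2: "(\<integral>x. (indicator U x * classical_curl v x $ i) * box_bump k a b x \<partial>lebesgue) = cell_int C (\<lambda>x. classical_curl v x \<bullet> \<phi> x)"
    proof -
      have "(indicator U x * classical_curl v x $ i) * box_bump k a b x = indicator (convex hull C) x * (classical_curl v x \<bullet> \<phi> x)" for x
      proof (cases "x \<in> cbox a b")
        case True
        then have "x \<in> U" "x \<in> \<Omega>" "x \<in> convex hull C" using cb U by auto
        then show ?thesis by (simp add: \<phi>_def inner_axis)
      next
        case False
        then show ?thesis using z[OF False] by (simp add: \<phi>_def axis_eq_0_iff)
      qed
      then show ?thesis
        by (subst cell_int_lebesgue[OF C]) (auto intro!: continuous_intros cv C1_continuous \<phi>1)
    qed
    have e3: "L2_inner \<Omega> \<xi> (classical_curl \<phi>) = cell_int C (\<lambda>x. v x \<bullet> classical_curl \<phi> x)"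
    proof -
      have cc: "continuous_on UNIV (\<lambda>x. v x \<bullet> classical_curl \<phi> x)"
        by (intro continuous_intros C1_continuous v C1_curl_continuous \<phi>1)
      have "(\<integral>x. indicator \<Omega> x * (\<xi> x \<bullet> classical_curl \<phi> x) \<partial>lebesgue) = (\<integral>x. indicator (convex hull C) x * (v x \<bullet> classical_curl \<phi> x) \<partial>lebesgue)"
      proof (rule integral_cong_AE)
        have "(\<lambda>x. (indicator \<Omega> x *\<^sub>R \<xi> x) \<bullet> classical_curl \<phi> x) \<in> borel_measurable lebesgue"
          by (intro borel_measurable_inner \<xi>m continuous_lebesgue_measurable C1_curl_continuous \<phi>1)
        then show "(\<lambda>x. indicator \<Omega> x * (\<xi> x \<bullet> classical_curl \<phi> x)) \<in> borel_measurable lebesgue" by simp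
        show "(\<lambda>x. indicator (convex hull C) x * (v x \<bullet> classical_curl \<phi> x)) \<in> borel_measurable lebesgue"
          using cell_integrable[OF C cc] by (rule borel_measurable_integrable)
        show "AE x in lebesgue. indicator \<Omega> x * (\<xi> x \<bullet> classical_curl \<phi> x) = indicator (convex hull C) x * (v x \<bullet> classical_curl \<phi> x)"
          using eq
        proof eventually_elim
          case (elim x)
          show ?case
          proof (cases "x \<in> cbox a b")
            case True
            then have "x \<in> convex hull C" "x \<in> \<Omega>" using cb U by auto
            then show ?thesis using elim by simp
          qed (simp add: zc)
        qed
      qed
      then show ?thesis by (simp add: L2_inner_lebesgue[OF Om(1)] cell_int_lebesgue[OF C cc])
    qed
    have e4: "cell_int C (\<lambda>x. classical_curl v x \<bullet> \<phi> x) = cell_int C (\<lambda>x. v x \<bullet> classical_curl \<phi> x)"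
    proof -
      \<comment> \<open>A coordinate vanishes on each face, so faces avoid the interior of the hull
        and with it the support of \<open>\<phi>\<close>.\<close>
      have "face_int (C - {c}) (\<lambda>x. grad C c \<bullet> cross3 (v x) (\<phi> x)) = 0" if c: "c \<in> C" for c
      proof (rule face_int_zero)
        show "continuous_on UNIV (\<lambda>x. grad C c \<bullet> cross3 (v x) (\<phi> x))"
          by (intro continuous_intros C1_continuous v \<phi>1)
        show "card (C - {c}) = 3" using C c tet_finite[OF C] by (simp add: tet_def)
        fix x assume "x \<in> convex hull (C - {c})"
        then have "bary C c x = 0" using face_bary_0[OF C _ c, of "C - {c}" x] by auto
        then have "x \<notin> interior (convex hull C)" using interior_not_face[OF C c, of x] by auto
        then have "x \<notin> cbox a b" using cb by (auto simp: U_def)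
        then show "grad C c \<bullet> cross3 (v x) (\<phi> x) = 0" using z by (simp add: cross3_simps)
      qed
      then have "std3_volume * cell_int C (\<lambda>x. classical_curl v x \<bullet> \<phi> x - v x \<bullet> classical_curl \<phi> x) = 0"
        unfolding cell_int_def tet_green[OF C v \<phi>1] by simp
      then have "cell_int C (\<lambda>x. classical_curl v x \<bullet> \<phi> x - v x \<bullet> classical_curl \<phi> x) = 0"
        using std3_volume_pos by simp
      moreover have "integrable lborel (\<lambda>x. indicator (convex hull C) x * (classical_curl v x \<bullet> \<phi> x))"
        "integrable lborel (\<lambda>x. indicator (convex hull C) x * (v x \<bullet> classical_curl \<phi> x))"
        by (intro cell_integrable_lborel[OF C] continuous_intros cv C1_continuous v \<phi>1 C1_curl_continuous)+
      ultimately show ?thesis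
        by (simp add: cell_int_def right_diff_distrib)
    qed
    have "L2_inner \<Omega> w \<phi> = L2_inner \<Omega> \<xi> (classical_curl \<phi>)"
      using w tf by (auto simp: has_weak_curl_def)
    then have "(\<integral>x. (indicator U x * w x $ i) * box_bump k a b x \<partial>lebesgue) - (\<integral>x. (indicator U x * classical_curl v x $ i) * box_bump k a b x \<partial>lebesgue) = 0"
      unfolding e1 e2 e3 e4 by simp
    then show "(\<integral>x. indicator U x * (w x $ i - classical_curl v x $ i) * box_bump k a b x \<partial>lebesgue) = 0"
      using bump_int[OF i1] bump_int[OF i2] by (simp add: right_diff_distrib left_diff_distrib)
  qed
  from this[of 1] this[of 2] this[of 3] AE_interior_hull[OF C] show ?thesis
  proof eventually_elim
    case (elim x)
    then show ?case by (auto simp: U_def vec_eq_iff forall_3)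
  qed
qed

section \<open>Meshes of an open set: integrals over elements, jumps, gluing\<close>

locale tet_mesh =
  fixes \<Omega> :: "(real^3) set" and \<T> :: "(real^3) set set"
  assumes open_domain: "open \<Omega>" and mesh: "tetrahedral_mesh \<Omega> \<T>"
begin

abbreviation "cells \<equiv> mesh_tets \<T>"

lemma tri: "triangulation \<T>"
  using mesh by (simp add: tetrahedral_mesh_def)

lemma finite_cells: "finite cells"
  by (rule finite_mesh_tets[OF tri])

lemma cell_tet: "C \<in> cells \<Longrightarrow> tet C"
  by (rule mesh_tets_tet)

lemma domain_measurable: "\<Omega> \<in> sets lebesgue"
  using open_domain by (simp add: sets_completionI_sets)

lemma cells_hull: "T \<in> \<T> \<longleftrightarrow> (\<exists>C\<in>cells. T = convex hull C)"
  using mesh simplex_3_tet by (fastforce simp: tetrahedral_mesh_def mesh_tets_def)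

lemma cells_cover: "x \<in> \<Omega> \<Longrightarrow> \<exists>C\<in>cells. x \<in> convex hull C"
proof -
  assume "x \<in> \<Omega>"
  then have "x \<in> \<Union>\<T>" using mesh closure_subset by (auto simp: tetrahedral_mesh_def)
  then show ?thesis using cells_hull by auto
qed

text \<open>The elements fill the closure of \<open>\<Omega>\<close>, so they may reach out of the
  open set. The condition \<open>out\<close> lets an integral over \<open>\<Omega>\<close> be
  written with whole elements all the same.\<close>

lemma cell_sum_AE:
  fixes G :: "(real^3) set \<Rightarrow> real^3 \<Rightarrow> real"
  assumes g: "AE x in lebesgue. \<forall>C\<in>cells. x \<in> convex hull C \<longrightarrow> x \<in> \<Omega> \<longrightarrow> g x = G C x"
    and out: "\<And>C x. C \<in> cells \<Longrightarrow> x \<in> convex hull C \<Longrightarrow> x \<notin> \<Omega> \<Longrightarrow> G C x = 0"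
  shows "AE x in lebesgue. indicator \<Omega> x * g x = (\<Sum>C\<in>cells. indicator (convex hull C) x * G C x)"
  using glue_AE[OF tri, of G] g
proof eventually_elim
  case (elim x)
  show ?case
  proof (cases "x \<in> \<Omega>")
    case True
    then obtain C where C: "C \<in> cells" "x \<in> convex hull C" using cells_cover by blast
    then have "glue cells G x = g x" using elim True by simp
    then show ?thesis using True by (simp add: glue_def)
  next
    case False
    have "(\<Sum>C\<in>cells. indicator (convex hull C) x * G C x) = 0"
      using out[OF _ _ False] by (intro sum.neutral) (auto simp: indicator_def)
    then show ?thesis using False by simp
  qed
qed

lemma integral_cells:
  fixes G :: "(real^3) set \<Rightarrow> real^3 \<Rightarrow> real"
  assumes gm: "(\<lambda>x. indicator \<Omega> x * g x) \<in> borel_measurable lebesgue"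
    and g: "AE x in lebesgue. \<forall>C\<in>cells. x \<in> convex hull C \<longrightarrow> x \<in> \<Omega> \<longrightarrow> g x = G C x"
    and out: "\<And>C x. C \<in> cells \<Longrightarrow> x \<in> convex hull C \<Longrightarrow> x \<notin> \<Omega> \<Longrightarrow> G C x = 0"
    and cont: "\<And>C. C \<in> cells \<Longrightarrow> continuous_on UNIV (G C)"
  shows "(\<integral>x. indicator \<Omega> x * g x \<partial>lebesgue) = (\<Sum>C\<in>cells. cell_int C (G C))"
proof -
  have int: "integrable lebesgue (\<lambda>x. indicator (convex hull C) x * G C x)" if "C \<in> cells" for C
    by (rule cell_integrable[OF cell_tet[OF that] cont[OF that]])
  have "(\<integral>x. indicator \<Omega> x * g x \<partial>lebesgue) = (\<integral>x. (\<Sum>C\<in>cells. indicator (convex hull C) x * G C x) \<partial>lebesgue)"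
    by (rule integral_cong_AE[OF gm _ cell_sum_AE[OF g out]]) (auto intro!: borel_measurable_sum borel_measurable_integrable int)
  also have "\<dots> = (\<Sum>C\<in>cells. \<integral>x. indicator (convex hull C) x * G C x \<partial>lebesgue)"
    by (rule Bochner_Integration.integral_sum) (rule int)
  also have "\<dots> = (\<Sum>C\<in>cells. cell_int C (G C))"
    by (intro sum.cong refl cell_int_lebesgue[symmetric] cell_tet cont)
  finally show ?thesis .
qed

lemma face_in_cell:
  assumes "B \<in> mesh_faces cells"
  obtains C where "C \<in> cells" "B \<subseteq> C"
  using assms by (auto simp: mesh_faces_def)

text \<open>Let the jump at \<open>x\<close> be some nonzero \<open>e\<close>. A bump times
  \<open>e\<close>, supported near \<open>x\<close> and away from the faces that miss
  \<open>x\<close>, leaves a single face term in Green's formula; its integrand is nonnegative and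
  positive at \<open>x\<close>, while the weak curl forces the integral to be zero. Positive weights
  guarantee that \<open>B\<close> is the only face through \<open>x\<close>.\<close>

lemma jump_zero_inside:
  assumes w: "has_weak_curl \<Omega> \<xi> w" and v: "\<And>C. C \<in> cells \<Longrightarrow> Ck_field 1 (v C)"
    and eq: "\<And>C. C \<in> cells \<Longrightarrow> AE x in lebesgue. x \<in> convex hull C \<longrightarrow> x \<in> \<Omega> \<longrightarrow> \<xi> x = v C x"
    and B: "B \<in> mesh_faces cells" and x: "x \<in> \<Omega>"
    and u: "sum u B = 1" "(\<Sum>b\<in>B. u b *\<^sub>R b) = x" "\<And>b. b \<in> B \<Longrightarrow> u b > 0"
  shows "jump cells v B x = 0"
proof (rule ccontr)
  define e where "e = jump cells v B x"
  assume "jump cells v B x \<noteq> 0"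
  then have e: "e \<bullet> e > 0" by (simp add: e_def)
  have Jc: "continuous_on UNIV (jump cells v B')" for B'
    by (intro jump_continuous finite_cells cell_tet C1_continuous v)
  define W where "W = \<Omega> \<inter> {y. jump cells v B y \<bullet> e > 0} \<inter> (\<Inter>B'\<in>{B' \<in> mesh_faces cells. x \<notin> convex hull B'}. - (convex hull B'))"
  have fin: "finite (mesh_faces cells)" by (rule finite_mesh_faces[OF finite_cells cell_tet])
  have "open W"
  proof -
    have cl: "closed (convex hull B')" if "B' \<in> mesh_faces cells" for B'
    proof -
      have "finite B'" using mesh_face_card[OF that cell_tet] card_ge_0_finite by force
      then show ?thesis by (intro compact_imp_closed compact_convex_hull finite_imp_compact)
    qed
    have "open {y. 0 < jump cells v B y \<bullet> e}"
      by (intro open_Collect_less continuous_intros Jc)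
    then show ?thesis unfolding W_def using fin
      by (intro open_Int open_domain open_INT) (auto intro!: open_Compl cl)
  qed
  moreover have "x \<in> W" using x e by (simp add: W_def e_def)
  ultimately obtain a b where ab: "x \<in> box a b" "cbox a b \<subseteq> W"
    using open_contains_cbox by (metis box_subset_cbox) 
  define \<phi> where "\<phi> = (\<lambda>x. box_bump 1 a b x *\<^sub>R e)"
  have tf: "test_field \<Omega> \<phi>" unfolding \<phi>_def
    by (rule box_bump_test_field) (use ab in \<open>auto simp: W_def\<close>)
  have \<phi>1: "Ck_field 1 \<phi>" using tf smooth_field_C1 by (auto simp: test_field_def)
  have z: "\<phi> y = 0" if "y \<notin> W" for y
    using that ab box_subset_cbox[of a b] box_bump_eq_0[of 1 a b y] by (auto simp: \<phi>_def)
  have si: "square_integrable \<Omega> \<xi>" "square_integrable \<Omega> w" using w by (auto simp: has_weak_curl_def)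
  have A1: "L2_inner \<Omega> w \<phi> = (\<Sum>C\<in>cells. cell_int C (\<lambda>x. classical_curl (v C) x \<bullet> \<phi> x))"
    unfolding L2_inner_lebesgue[OF domain_measurable]
  proof (rule integral_cells)
    have "(\<lambda>x. (indicator \<Omega> x *\<^sub>R w x) \<bullet> \<phi> x) \<in> borel_measurable lebesgue"
      by (intro borel_measurable_inner square_integrable_lebesgue[OF si(2) domain_measurable] continuous_lebesgue_measurable C1_continuous \<phi>1)
    then show "(\<lambda>x. indicator \<Omega> x * (w x \<bullet> \<phi> x)) \<in> borel_measurable lebesgue" by simp
    have "AE x in lebesgue. x \<in> convex hull C \<longrightarrow> x \<in> \<Omega> \<longrightarrow> w x = classical_curl (v C) x" if "C \<in> cells" for C
      by (rule weak_curl_on_cell[OF w open_domain cell_tet[OF that] v[OF that] eq[OF that]])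
    then have "AE x in lebesgue. \<forall>C\<in>cells. x \<in> convex hull C \<longrightarrow> x \<in> \<Omega> \<longrightarrow> w x = classical_curl (v C) x"
      by (intro AE_finite_allI finite_cells) auto
    then show "AE x in lebesgue. \<forall>C\<in>cells. x \<in> convex hull C \<longrightarrow> x \<in> \<Omega> \<longrightarrow> w x \<bullet> \<phi> x = classical_curl (v C) x \<bullet> \<phi> x"
      by eventually_elim simp
  next
    fix C x assume "x \<notin> \<Omega>"
    then show "classical_curl (v C) x \<bullet> \<phi> x = 0" by (simp add: test_field_zero_outside[OF tf])
  next
    fix C assume "C \<in> cells"
    then show "continuous_on UNIV (\<lambda>x. classical_curl (v C) x \<bullet> \<phi> x)"
      by (intro continuous_intros C1_curl_continuous v C1_continuous \<phi>1)
  qed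
  have A2: "L2_inner \<Omega> \<xi> (classical_curl \<phi>) = (\<Sum>C\<in>cells. cell_int C (\<lambda>x. v C x \<bullet> classical_curl \<phi> x))"
    unfolding L2_inner_lebesgue[OF domain_measurable]
  proof (rule integral_cells)
    have "(\<lambda>x. (indicator \<Omega> x *\<^sub>R \<xi> x) \<bullet> classical_curl \<phi> x) \<in> borel_measurable lebesgue"
      by (intro borel_measurable_inner square_integrable_lebesgue[OF si(1) domain_measurable] continuous_lebesgue_measurable C1_curl_continuous \<phi>1)
    then show "(\<lambda>x. indicator \<Omega> x * (\<xi> x \<bullet> classical_curl \<phi> x)) \<in> borel_measurable lebesgue" by simp
    have "AE x in lebesgue. \<forall>C\<in>cells. x \<in> convex hull C \<longrightarrow> x \<in> \<Omega> \<longrightarrow> \<xi> x = v C x"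
      using eq by (intro AE_finite_allI finite_cells) auto
    then show "AE x in lebesgue. \<forall>C\<in>cells. x \<in> convex hull C \<longrightarrow> x \<in> \<Omega> \<longrightarrow> \<xi> x \<bullet> classical_curl \<phi> x = v C x \<bullet> classical_curl \<phi> x"
      by eventually_elim simp
  next
    fix C x assume "x \<notin> \<Omega>"
    then show "v C x \<bullet> classical_curl \<phi> x = 0" by (simp add: test_field_zero_outside[OF tf])
  next
    fix C assume "C \<in> cells"
    then show "continuous_on UNIV (\<lambda>x. v C x \<bullet> classical_curl \<phi> x)"
      by (intro continuous_intros C1_curl_continuous v C1_continuous \<phi>1)
  qed
  have "(\<Sum>C\<in>cells. cell_int C (\<lambda>x. classical_curl (v C) x \<bullet> \<phi> x - v C x \<bullet> classical_curl \<phi> x)) =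
     (\<Sum>C\<in>cells. cell_int C (\<lambda>x. classical_curl (v C) x \<bullet> \<phi> x) - cell_int C (\<lambda>x. v C x \<bullet> classical_curl \<phi> x))"
  proof (intro sum.cong refl)
    fix C assume C: "C \<in> cells"
    have "integrable lborel (\<lambda>x. indicator (convex hull C) x * (classical_curl (v C) x \<bullet> \<phi> x))"
      "integrable lborel (\<lambda>x. indicator (convex hull C) x * (v C x \<bullet> classical_curl \<phi> x))"
      by (intro cell_integrable_lborel cell_tet[OF C] continuous_intros C1_continuous v[OF C] \<phi>1 C1_curl_continuous)+
    then show "cell_int C (\<lambda>x. classical_curl (v C) x \<bullet> \<phi> x - v C x \<bullet> classical_curl \<phi> x) =
       cell_int C (\<lambda>x. classical_curl (v C) x \<bullet> \<phi> x) - cell_int C (\<lambda>x. v C x \<bullet> classical_curl \<phi> x)"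
      by (simp add: cell_int_def right_diff_distrib)
  qed
  also have "\<dots> = L2_inner \<Omega> w \<phi> - L2_inner \<Omega> \<xi> (classical_curl \<phi>)"
    by (simp add: A1 A2 sum_subtractf)
  also have "\<dots> = 0" using w tf by (auto simp: has_weak_curl_def)
  finally have "(\<Sum>B\<in>mesh_faces cells. face_int B (\<lambda>x. jump cells v B x \<bullet> \<phi> x)) = 0"
    using mesh_green[of cells v, OF finite_cells cell_tet v \<phi>1] by simp
  moreover have "face_int B' (\<lambda>x. jump cells v B' x \<bullet> \<phi> x) = 0" if B': "B' \<in> mesh_faces cells" "B' \<noteq> B" for B'
  proof (rule face_int_zero)
    show "continuous_on UNIV (\<lambda>x. jump cells v B' x \<bullet> \<phi> x)"
      by (intro continuous_intros Jc C1_continuous \<phi>1)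
    show c3: "card B' = 3" by (rule mesh_face_card[OF B'(1) cell_tet])
    have "x \<notin> convex hull B'"
    proof
      assume xB': "x \<in> convex hull B'"
      obtain C where C: "C \<in> cells" "B \<subseteq> C" using face_in_cell[OF B] .
      obtain D where D: "D \<in> cells" "B' \<subseteq> D" using face_in_cell[OF B'(1)] .
      have "B \<subseteq> B'" using mesh_positive_face_subset[OF tri C(1) D(1) C(2) D(2) u xB'] .
      moreover have "card B = 3" by (rule mesh_face_card[OF B cell_tet])
      ultimately have "B = B'" using c3 card_ge_0_finite[of B'] by (intro card_subset_eq) auto
      then show False using B'(2) by simp
    qed
    then have dis: "convex hull B' \<inter> W = {}" using B'(1) by (auto simp: W_def)
    fix y assume "y \<in> convex hull B'"
    then have "y \<notin> W" using dis by blast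
    then show "jump cells v B' y \<bullet> \<phi> y = 0" by (simp add: z)
  qed
  ultimately have "face_int B (\<lambda>x. jump cells v B x \<bullet> \<phi> x) = 0"
    using B fin by (simp add: sum.remove)
  moreover have "continuous_on UNIV (\<lambda>x. jump cells v B x \<bullet> \<phi> x)"
    by (intro continuous_intros Jc C1_continuous \<phi>1)
  moreover have "0 \<le> jump cells v B y \<bullet> \<phi> y" for y
  proof (cases "y \<in> W")
    case True
    then show ?thesis using box_bump_nonneg[of 1 a b y] by (simp add: \<phi>_def W_def)
  next
    case False
    then show ?thesis using z by simp
  qed
  ultimately have "jump cells v B x \<bullet> \<phi> x = 0"
    using face_int_zero_imp[OF _ mesh_face_card[OF B cell_tet] _ _ u] by blast
  then show False using e ab box_bump_eq_0[of 1 a b x] by (simp add: \<phi>_def e_def)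
qed

text \<open>The converse direction: with zero jumps the face terms in Green's formula cancel for
  every smooth field and not only for those supported in \<open>\<Omega>\<close>, and this is the
  vanishing of the tangential trace. For that reason \<open>J\<close> includes the faces on the
  boundary.\<close>

lemma glued_field:
  assumes u: "\<And>C. C \<in> cells \<Longrightarrow> Ck_field 1 (u C)"
    and out: "\<And>C. C \<in> cells \<Longrightarrow> \<not> convex hull C \<subseteq> \<Omega> \<Longrightarrow> u C = (\<lambda>x. 0)"
    and J: "\<And>B x. B \<in> mesh_faces cells \<Longrightarrow> x \<in> convex hull B \<Longrightarrow> jump cells u B x = 0"
  shows "has_weak_curl \<Omega> (glue cells u) (glue cells (\<lambda>C. classical_curl (u C)))"
    and "glue cells u \<in> Hcurl0 \<Omega>"
    and "AE x in lebesgue. \<forall>C\<in>cells. x \<in> convex hull C \<longrightarrow> x \<in> \<Omega> \<longrightarrow> weak_curl \<Omega> (glue cells u) x = classical_curl (u C) x"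
proof -
  have out0: "u C x = 0" "classical_curl (u C) x = 0" if "C \<in> cells" "x \<in> convex hull C" "x \<notin> \<Omega>" for C x
  proof -
    have "u C = (\<lambda>x. 0)" using out that by blast
    then show "u C x = 0" "classical_curl (u C) x = 0" using field_zero_outside[of "{}" "u C" x] by auto
  qed
  have sq: "square_integrable \<Omega> (glue cells F)"
    if F: "\<And>C. C \<in> cells \<Longrightarrow> continuous_on UNIV (F C)" and F0: "\<And>C x. C \<in> cells \<Longrightarrow> x \<in> convex hull C \<Longrightarrow> x \<notin> \<Omega> \<Longrightarrow> F C x = 0"
    for F :: "(real^3) set \<Rightarrow> real^3 \<Rightarrow> real^3"
  proof -
    have m: "glue cells F \<in> borel_measurable lebesgue"
      unfolding glue_def using F tet_hull_lebesgue[OF cell_tet]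
      by (intro borel_measurable_sum borel_measurable_scaleR borel_measurable_indicator continuous_lebesgue_measurable) auto
    then have "glue cells F \<in> borel_measurable (lebesgue_on \<Omega>)" by (rule measurable_restrict_space1)
    moreover have "integrable lebesgue (\<lambda>x. indicator \<Omega> x * (norm (glue cells F x))\<^sup>2)"
    proof (rule integrable_cong_AE_imp)
      show "integrable lebesgue (\<lambda>x. \<Sum>C\<in>cells. indicator (convex hull C) x * (norm (F C x))\<^sup>2)"
        by (intro Bochner_Integration.integrable_sum cell_integrable cell_tet continuous_intros F)
      show "(\<lambda>x. indicator \<Omega> x * (norm (glue cells F x))\<^sup>2) \<in> borel_measurable lebesgue"
        using domain_measurable measurable_compose[OF m, of norm borel]
        by (intro borel_measurable_times borel_measurable_indicator borel_measurable_power) auto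
      have "AE x in lebesgue. \<forall>C\<in>cells. x \<in> convex hull C \<longrightarrow> x \<in> \<Omega> \<longrightarrow> (norm (glue cells F x))\<^sup>2 = (norm (F C x))\<^sup>2"
        using glue_AE[OF tri, of F] by eventually_elim simp
      from cell_sum_AE[OF this]
      have "AE x in lebesgue. indicator \<Omega> x * (norm (glue cells F x))\<^sup>2 = (\<Sum>C\<in>cells. indicator (convex hull C) x * (norm (F C x))\<^sup>2)"
        using F0 by simp
      then show "AE x in lebesgue. (\<Sum>C\<in>cells. indicator (convex hull C) x * (norm (F C x))\<^sup>2) = indicator \<Omega> x * (norm (glue cells F x))\<^sup>2"
        by eventually_elim simp
    qed
    ultimately show ?thesis
      unfolding square_integrable_def using domain_measurable by (simp add: integrable_restrict_space)
  qed
  let ?w = "glue cells (\<lambda>C. classical_curl (u C))"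
  have s1: "square_integrable \<Omega> (glue cells u)"
    by (rule sq) (auto intro: C1_continuous u out0)
  have s2: "square_integrable \<Omega> ?w"
    by (rule sq) (auto intro: C1_curl_continuous u out0)
  have inner: "L2_inner \<Omega> f \<phi> = (\<Sum>C\<in>cells. cell_int C (\<lambda>x. F C x \<bullet> \<phi> x))"
    if f: "square_integrable \<Omega> f" and \<phi>: "continuous_on UNIV \<phi>"
      and F: "\<And>C. C \<in> cells \<Longrightarrow> continuous_on UNIV (F C)" and F0: "\<And>C x. C \<in> cells \<Longrightarrow> x \<in> convex hull C \<Longrightarrow> x \<notin> \<Omega> \<Longrightarrow> F C x = 0"
      and fF: "AE x in lebesgue. \<forall>C\<in>cells. x \<in> convex hull C \<longrightarrow> x \<in> \<Omega> \<longrightarrow> f x = F C x"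
    for F :: "(real^3) set \<Rightarrow> real^3 \<Rightarrow> real^3" and f \<phi>
    unfolding L2_inner_lebesgue[OF domain_measurable]
  proof (rule integral_cells)
    have "(\<lambda>x. (indicator \<Omega> x *\<^sub>R f x) \<bullet> \<phi> x) \<in> borel_measurable lebesgue"
      by (intro borel_measurable_inner square_integrable_lebesgue[OF f domain_measurable] continuous_lebesgue_measurable \<phi>)
    then show "(\<lambda>x. indicator \<Omega> x * (f x \<bullet> \<phi> x)) \<in> borel_measurable lebesgue" by simp
    show "AE x in lebesgue. \<forall>C\<in>cells. x \<in> convex hull C \<longrightarrow> x \<in> \<Omega> \<longrightarrow> f x \<bullet> \<phi> x = F C x \<bullet> \<phi> x"
      using fF by eventually_elim simp
  next
    fix C x assume "C \<in> cells" "x \<in> convex hull C" "x \<notin> \<Omega>"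
    then show "F C x \<bullet> \<phi> x = 0" by (simp add: F0)
  next
    fix C assume "C \<in> cells"
    then show "continuous_on UNIV (\<lambda>x. F C x \<bullet> \<phi> x)" by (intro continuous_intros \<phi> F)
  qed
  have green: "(\<Sum>C\<in>cells. cell_int C (\<lambda>x. classical_curl (u C) x \<bullet> \<phi> x)) = (\<Sum>C\<in>cells. cell_int C (\<lambda>x. u C x \<bullet> classical_curl \<phi> x))"
    if \<phi>1: "Ck_field 1 \<phi>" for \<phi>
  proof -
    have "face_int B (\<lambda>x. jump cells u B x \<bullet> \<phi> x) = 0" if B: "B \<in> mesh_faces cells" for B
    proof (rule face_int_zero)
      show "continuous_on UNIV (\<lambda>x. jump cells u B x \<bullet> \<phi> x)"
        by (intro continuous_intros jump_continuous finite_cells cell_tet C1_continuous u \<phi>1)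
      show "card B = 3" by (rule mesh_face_card[OF B cell_tet])
    qed (simp add: J[OF B])
    then have "(\<Sum>C\<in>cells. cell_int C (\<lambda>x. classical_curl (u C) x \<bullet> \<phi> x - u C x \<bullet> classical_curl \<phi> x)) = 0"
      using mesh_green[of cells u, OF finite_cells cell_tet u \<phi>1] std3_volume_pos by simp
    moreover have "cell_int C (\<lambda>x. classical_curl (u C) x \<bullet> \<phi> x - u C x \<bullet> classical_curl \<phi> x) =
       cell_int C (\<lambda>x. classical_curl (u C) x \<bullet> \<phi> x) - cell_int C (\<lambda>x. u C x \<bullet> classical_curl \<phi> x)" if C: "C \<in> cells" for C
    proof -
      have "integrable lborel (\<lambda>x. indicator (convex hull C) x * (classical_curl (u C) x \<bullet> \<phi> x))"
        "integrable lborel (\<lambda>x. indicator (convex hull C) x * (u C x \<bullet> classical_curl \<phi> x))"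
        by (intro cell_integrable_lborel cell_tet[OF C] continuous_intros C1_continuous u[OF C] \<phi>1 C1_curl_continuous)+
      then show ?thesis by (simp add: cell_int_def right_diff_distrib)
    qed
    ultimately show ?thesis by (simp add: sum_subtractf)
  qed
  have gA: "AE x in lebesgue. \<forall>C\<in>cells. x \<in> convex hull C \<longrightarrow> x \<in> \<Omega> \<longrightarrow> glue cells u x = u C x"
    using glue_AE[OF tri, of u] by eventually_elim simp
  have i1: "L2_inner \<Omega> (glue cells u) (classical_curl \<phi>) = (\<Sum>C\<in>cells. cell_int C (\<lambda>x. u C x \<bullet> classical_curl \<phi> x))"
    if "Ck_field 1 \<phi>" for \<phi>
    by (rule inner[OF s1 C1_curl_continuous[OF that] _ _ gA]) (auto intro: C1_continuous u out0)
  show wc: "has_weak_curl \<Omega> (glue cells u) ?w"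
    unfolding has_weak_curl_def
  proof (intro conjI s1 s2 allI impI)
    fix \<phi> assume "test_field \<Omega> \<phi>"
    then have \<phi>1: "Ck_field 1 \<phi>" using smooth_field_C1 by (auto simp: test_field_def)
    have "AE x in lebesgue. \<forall>C\<in>cells. x \<in> convex hull C \<longrightarrow> x \<in> \<Omega> \<longrightarrow> ?w x = classical_curl (u C) x"
      using glue_AE[OF tri, of "\<lambda>C. classical_curl (u C)"] by eventually_elim simp
    from inner[OF s2 C1_continuous[OF \<phi>1] _ _ this]
    have "L2_inner \<Omega> ?w \<phi> = (\<Sum>C\<in>cells. cell_int C (\<lambda>x. classical_curl (u C) x \<bullet> \<phi> x))"
      using C1_curl_continuous u out0 by blast
    then show "L2_inner \<Omega> ?w \<phi> = L2_inner \<Omega> (glue cells u) (classical_curl \<phi>)"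
      using green[OF \<phi>1] i1[OF \<phi>1] by simp
  qed
  \<comment> \<open>\<open>weak_curl\<close> need not pick the glued curl;
    \<open>weak_curl_on_cell\<close> identifies whatever it picks, element by element.\<close>
  have wk: "has_weak_curl \<Omega> (glue cells u) (weak_curl \<Omega> (glue cells u))"
    unfolding weak_curl_def using wc by (rule someI[of "has_weak_curl \<Omega> (glue cells u)"])
  have "AE x in lebesgue. x \<in> convex hull C \<longrightarrow> x \<in> \<Omega> \<longrightarrow> weak_curl \<Omega> (glue cells u) x = classical_curl (u C) x"
    if C: "C \<in> cells" for C
    by (rule weak_curl_on_cell[OF wk open_domain cell_tet[OF C] u[OF C]]) (use gA C in \<open>auto elim!: eventually_mono\<close>)
  then show wA: "AE x in lebesgue. \<forall>C\<in>cells. x \<in> convex hull C \<longrightarrow> x \<in> \<Omega> \<longrightarrow> weak_curl \<Omega> (glue cells u) x = classical_curl (u C) x"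
    by (intro AE_finite_allI finite_cells) auto
  have "tangential_trace \<Omega> (glue cells u) \<phi> = 0" if "smooth_field \<phi>" for \<phi>
  proof -
    have \<phi>1: "Ck_field 1 \<phi>" by (rule smooth_field_C1[OF that])
    have "square_integrable \<Omega> (weak_curl \<Omega> (glue cells u))" using wk by (simp add: has_weak_curl_def)
    from inner[OF this C1_continuous[OF \<phi>1] _ _ wA]
    have "L2_inner \<Omega> (weak_curl \<Omega> (glue cells u)) \<phi> = (\<Sum>C\<in>cells. cell_int C (\<lambda>x. classical_curl (u C) x \<bullet> \<phi> x))"
      using C1_curl_continuous u out0 by blast
    then show ?thesis using green[OF \<phi>1] i1[OF \<phi>1] by (simp add: tangential_trace_def)
  qed
  then show "glue cells u \<in> Hcurl0 \<Omega>"
    using wc by (auto simp: Hcurl0_def Hcurl_def)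
qed

end

section \<open>The cut operator preserves tangential continuity\<close>

text \<open>Mixing a point with the barycentre makes all weights positive, and the mixture can be
  made to converge to the point.\<close>

lemma zero_on_face_closure:
  fixes f :: "'a::euclidean_space \<Rightarrow> 'b::real_normed_vector"
  assumes f: "continuous_on UNIV f" and B: "finite B" "B \<noteq> {}"
    and pos: "\<And>u. sum u B = 1 \<Longrightarrow> (\<And>b. b \<in> B \<Longrightarrow> u b > 0) \<Longrightarrow> f (\<Sum>b\<in>B. u b *\<^sub>R b) = 0"
    and x: "x \<in> convex hull B"
  shows "f x = 0"
proof -
  obtain w where w: "\<And>b. b \<in> B \<Longrightarrow> w b \<ge> 0" "sum w B = 1" "(\<Sum>b\<in>B. w b *\<^sub>R b) = x"
    using x unfolding convex_hull_finite[OF B(1)] by blast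
  define g where "g = (\<Sum>b\<in>B. (1 / card B) *\<^sub>R b)"
  define \<epsilon> where "\<epsilon> n = inverse (real (Suc n))" for n
  have eps: "\<epsilon> n > 0" "\<epsilon> n \<le> 1" for n by (auto simp: \<epsilon>_def inverse_le_1_iff)
  have z: "f ((1 - \<epsilon> n) *\<^sub>R x + \<epsilon> n *\<^sub>R g) = 0" for n
  proof -
    define u where "u b = (1 - \<epsilon> n) * w b + \<epsilon> n * (1 / card B)" for b
    have "sum u B = (1 - \<epsilon> n) * sum w B + \<epsilon> n * (\<Sum>b\<in>B. 1 / card B)"
      by (simp only: u_def[abs_def] sum.distrib sum_distrib_left)
    then have "sum u B = 1" using w(2) B by simp
    moreover have "u b > 0" if "b \<in> B" for b
      unfolding u_def using w(1)[OF that] eps[of n] B by (intro add_nonneg_pos mult_nonneg_nonneg mult_pos_pos) (auto simp: card_gt_0_iff)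
    ultimately have "f (\<Sum>b\<in>B. u b *\<^sub>R b) = 0" by (rule pos)
    moreover have "(\<Sum>b\<in>B. u b *\<^sub>R b) = (1 - \<epsilon> n) *\<^sub>R x + \<epsilon> n *\<^sub>R g"
      by (simp add: u_def w(3)[symmetric] g_def scaleR_add_left sum.distrib scaleR_sum_right)
    ultimately show ?thesis by simp
  qed
  have "\<epsilon> \<longlonglongrightarrow> 0" unfolding \<epsilon>_def by (rule LIMSEQ_inverse_real_of_nat)
  then have "(\<lambda>n. (1 - \<epsilon> n) *\<^sub>R x + \<epsilon> n *\<^sub>R g) \<longlonglongrightarrow> (1 - 0) *\<^sub>R x + 0 *\<^sub>R g"
    by (intro tendsto_intros)
  then have "(\<lambda>n. (1 - \<epsilon> n) *\<^sub>R x + \<epsilon> n *\<^sub>R g) \<longlonglongrightarrow> x" by simp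
  moreover have "isCont f x" using f by (simp add: continuous_on_eq_continuous_at)
  ultimately have "(\<lambda>n. f ((1 - \<epsilon> n) *\<^sub>R x + \<epsilon> n *\<^sub>R g)) \<longlonglongrightarrow> f x"
    using isCont_tendsto_compose by blast
  then show ?thesis by (simp add: z LIMSEQ_const_iff)
qed

lemma cross_zero_parallel:
  fixes x y :: "real^3"
  assumes "cross3 x y = 0" "y \<noteq> 0"
  shows "x = ((x \<bullet> y) / (y \<bullet> y)) *\<^sub>R y"
proof -
  have "cross3 y (cross3 x y) = (y \<bullet> y) *\<^sub>R x - (x \<bullet> y) *\<^sub>R y"
    by (simp add: cross3_simps vec_eq_iff forall_3 sum_3)
  then have "(y \<bullet> y) *\<^sub>R x = (x \<bullet> y) *\<^sub>R y" using assms by simp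
  then have "inverse (y \<bullet> y) *\<^sub>R ((y \<bullet> y) *\<^sub>R x) = inverse (y \<bullet> y) *\<^sub>R ((x \<bullet> y) *\<^sub>R y)" by simp
  then show ?thesis using assms(2) by (simp add: divide_inverse mult.commute)
qed

lemma cross_cross_expand:
  fixes e f w :: "real^3"
  shows "cross3 (cross3 e f) w = (e \<bullet> w) *\<^sub>R f - (f \<bullet> w) *\<^sub>R e"
  by (simp add: cross3_simps vec_eq_iff forall_3 sum_3)

lemma cross_cross_expand_right:
  fixes e f w :: "real^3"
  shows "cross3 w (cross3 e f) = (w \<bullet> f) *\<^sub>R e - (w \<bullet> e) *\<^sub>R f"
  by (simp add: cross3_simps vec_eq_iff forall_3 sum_3)

text \<open>
  All gradients in the jump are multiples of the face normal. The factors, in particular the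
  orientations, go into \<open>\<kappa>\<close>, so it is never needed that exactly two elements meet at a face.
\<close>

lemma jump_zero_iff:
  assumes fin: "finite \<C>" and tet: "\<And>C. C \<in> \<C> \<Longrightarrow> tet C" and B: "B \<in> mesh_faces \<C>"
  shows "\<exists>\<kappa> :: (real^3) set \<times> (real^3) \<Rightarrow> real. \<forall>u x. jump \<C> u B x = 0 \<longleftrightarrow>
    (\<forall>b\<in>B. \<forall>b'\<in>B. (\<Sum>p\<in>{(C, a). C \<in> \<C> \<and> a \<in> C \<and> C - {a} = B}. \<kappa> p * (u (fst p) x \<bullet> (b - b'))) = 0)"
proof -
  obtain b0 b1 b2 where b: "B = {b0, b1, b2}" "b0 \<noteq> b1" "b0 \<noteq> b2" "b1 \<noteq> b2"
    using mesh_face_card[OF B tet] by (auto simp: card_3_iff)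
  obtain D d where D: "D \<in> \<C>" "d \<in> D" "B = D - {d}" using B by (auto simp: mesh_faces_def)
  have bD: "b0 \<in> D" "b1 \<in> D" "b2 \<in> D" using b(1) D(3) by blast+
  define e where "e = b1 - b0"
  define f where "f = b2 - b0"
  define n where "n = cross3 e f"
  note gD = grad_edge[OF tet[OF D(1)]]
  \<comment> \<open>The gradients at \<open>b1\<close> and \<open>b2\<close> are dual to the edges
    \<open>e\<close> and \<open>f\<close>. This gives the linear independence of the edges, and
    below it separates the two coefficients of the jump.\<close>
  have g1: "grad D b1 \<bullet> e = 1" "grad D b1 \<bullet> f = 0" "grad D b2 \<bullet> f = 1" "grad D b2 \<bullet> e = 0"
    using gD bD b(2-4) by (auto simp: e_def f_def)
  have f0: "f \<noteq> 0" using g1 by auto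
  have n0: "n \<noteq> 0"
  proof
    assume "n = 0"
    then have "e = ((e \<bullet> f) / (f \<bullet> f)) *\<^sub>R f" using cross_zero_parallel[of e f] f0 by (simp add: n_def)
    then have "grad D b1 \<bullet> e = ((e \<bullet> f) / (f \<bullet> f)) * (grad D b1 \<bullet> f)" by (metis inner_scaleR_right)
    then show False using g1 by simp
  qed
  define Q where "Q = {(C, a). C \<in> \<C> \<and> a \<in> C \<and> C - {a} = B}"
  define \<kappa> where "\<kappa> p = measure lborel (convex hull (fst p)) * ((grad (fst p) (snd p) \<bullet> n) / (n \<bullet> n))" for p
  have par: "grad C a = ((grad C a \<bullet> n) / (n \<bullet> n)) *\<^sub>R n" if "(C, a) \<in> Q" for C a
  proof (rule cross_zero_parallel[OF _ n0])
    have C: "C \<in> \<C>" "a \<in> C" "C - {a} = B" using that by (auto simp: Q_def)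
    have "b0 \<in> C" "b1 \<in> C" "b2 \<in> C" "a \<noteq> b0" "a \<noteq> b1" "a \<noteq> b2" using C(3) b(1) by blast+
    then have "grad C a \<bullet> e = 0" "grad C a \<bullet> f = 0"
      using grad_edge[OF tet[OF C(1)] C(2)] by (simp_all add: e_def f_def)
    then show "cross3 (grad C a) n = 0" by (simp add: n_def cross_cross_expand_right)
  qed
  define S where "S u x t = (\<Sum>p\<in>Q. \<kappa> p * (u (fst p) x \<bullet> t))" for u :: "(real^3) set \<Rightarrow> real^3 \<Rightarrow> real^3" and x t
  have S_diff: "S u x (t - t') = S u x t - S u x t'" for u x t t'
    by (simp add: S_def inner_diff_right right_diff_distrib sum_subtractf)
  have J: "jump \<C> u B x = S u x e *\<^sub>R f - S u x f *\<^sub>R e" for u x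
  proof -
    have "jump \<C> u B x = (\<Sum>p\<in>Q. measure lborel (convex hull (fst p)) *\<^sub>R cross3 (grad (fst p) (snd p)) (u (fst p) x))"
      unfolding jump_def Q_def[symmetric] by (simp add: case_prod_beta)
    also have "\<dots> = (\<Sum>p\<in>Q. (\<kappa> p * (u (fst p) x \<bullet> e)) *\<^sub>R f - (\<kappa> p * (u (fst p) x \<bullet> f)) *\<^sub>R e)"
    proof (intro sum.cong refl)
      fix p assume "p \<in> Q"
      define r where "r = (grad (fst p) (snd p) \<bullet> n) / (n \<bullet> n)"
      have kp: "\<kappa> p = measure lborel (convex hull (fst p)) * r" by (simp add: \<kappa>_def r_def)
      have "grad (fst p) (snd p) = r *\<^sub>R n"
        unfolding r_def using \<open>p \<in> Q\<close> by (intro par) simp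
      then have "cross3 (grad (fst p) (snd p)) (u (fst p) x) = r *\<^sub>R cross3 n (u (fst p) x)"
        by (simp add: cross_mult_left)
      then show "measure lborel (convex hull (fst p)) *\<^sub>R cross3 (grad (fst p) (snd p)) (u (fst p) x) =
        (\<kappa> p * (u (fst p) x \<bullet> e)) *\<^sub>R f - (\<kappa> p * (u (fst p) x \<bullet> f)) *\<^sub>R e"
        using kp by (simp add: n_def cross_cross_expand inner_commute scaleR_diff_right mult.assoc)
    qed
    also have "\<dots> = S u x e *\<^sub>R f - S u x f *\<^sub>R e"
      by (simp add: S_def sum_subtractf scaleR_sum_left)
    finally show ?thesis .
  qed
  have "jump \<C> u B x = 0 \<longleftrightarrow> (\<forall>b\<in>B. \<forall>b'\<in>B. S u x (b - b') = 0)" for u x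
  proof
    assume "jump \<C> u B x = 0"
    then have 0: "S u x e *\<^sub>R f - S u x f *\<^sub>R e = 0" using J by simp
    then have "grad D b2 \<bullet> (S u x e *\<^sub>R f - S u x f *\<^sub>R e) = 0" "grad D b1 \<bullet> (S u x e *\<^sub>R f - S u x f *\<^sub>R e) = 0" by simp_all
    then have "S u x e = 0" "S u x f = 0" using g1 by (simp_all add: inner_diff_right)
    then have "S u x b1 = S u x b0" "S u x b2 = S u x b0" by (simp_all add: e_def f_def S_diff)
    then show "\<forall>b\<in>B. \<forall>b'\<in>B. S u x (b - b') = 0" by (auto simp: b(1) S_diff)
  next
    assume "\<forall>b\<in>B. \<forall>b'\<in>B. S u x (b - b') = 0"
    then have "S u x e = 0" "S u x f = 0" by (auto simp: b(1) e_def f_def)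
    then show "jump \<C> u B x = 0" by (simp add: J)
  qed
  then show ?thesis unfolding S_def Q_def by blast
qed

text \<open>On the face the coordinate of the opposite vertex \<open>a\<close> is zero, and
  differences of face vertices see only the gradients of face vertices. Mass, moment and projected
  point are therefore those of the face. The right-hand sides involve the element only through its
  \<open>v\<close>, which is what lets neighbouring cuts fit together.\<close>

lemma cut_trace:
  assumes C: "tet C" and a: "a \<in> C" and B: "C - {a} = B" and cut: "is_cut m C A v u"
    and w: "sum w B = 1" "(\<Sum>b\<in>B. w b *\<^sub>R b) = x" and b: "b \<in> B" "b' \<in> B"
  shows "B \<inter> A = {} \<Longrightarrow> u x \<bullet> (b - b') = 0"
    and "(\<Sum>c\<in>B \<inter> A. w c) = s \<Longrightarrow> s \<noteq> 0 \<Longrightarrow> z = inverse s *\<^sub>R (\<Sum>c\<in>B \<inter> A. w c *\<^sub>R c) \<Longrightarrow>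
      u x \<bullet> (b - b') = s ^ Suc m * (\<Sum>c\<in>B \<inter> A. ((if c = b then 1 else 0) - (if c = b' then 1 else 0)) * (v z \<bullet> (c - z)))"
proof -
  have fin: "finite C" by (rule tet_finite[OF C])
  have BC: "B \<subseteq> C" "a \<notin> B" "C \<inter> A \<subseteq> insert a (B \<inter> A)" using B by auto
  have bC: "b \<in> C" "b' \<in> C" "a \<noteq> b" "a \<noteq> b'" using b BC by auto
  have bar: "bary C c x = (if c \<in> B then w c else 0)" if "c \<in> C" for c
    by (rule bary_subset[OF C BC(1) w that])
  have gr: "grad C c \<bullet> (b - b') = (if c = b then 1 else 0) - (if c = b' then 1 else 0)" if "c \<in> C" for c
    by (rule grad_edge[OF C that bC(1,2)])
  have restrict: "(\<Sum>c\<in>C \<inter> A. h c) = (\<Sum>c\<in>B \<inter> A. h c)" if "h a = 0" for h :: "real^3 \<Rightarrow> 'z::comm_monoid_add"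
    by (rule sum.mono_neutral_right) (use fin B that in auto)
  show "u x \<bullet> (b - b') = 0" if "B \<inter> A = {}"
  proof -
    have "\<forall>c\<in>C \<inter> A. grad C c \<bullet> (b - b') = 0"
      using that BC(3) gr[OF a] bC(3,4) a by auto
    then show ?thesis using cut unfolding is_cut_def by blast
  qed
  show "u x \<bullet> (b - b') = s ^ Suc m * (\<Sum>c\<in>B \<inter> A. ((if c = b then 1 else 0) - (if c = b' then 1 else 0)) * (v z \<bullet> (c - z)))"
    if s: "(\<Sum>c\<in>B \<inter> A. w c) = s" "s \<noteq> 0" and z: "z = inverse s *\<^sub>R (\<Sum>c\<in>B \<inter> A. w c *\<^sub>R c)"
  proof -
    have "cut_mass C A x = (\<Sum>c\<in>C \<inter> A. if c \<in> B then w c else 0)"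
      unfolding cut_mass_def by (intro sum.cong refl bar) auto
    also have "\<dots> = s" unfolding s(1)[symmetric] using BC(2) by (subst restrict) (auto intro: sum.cong)
    finally have m: "cut_mass C A x = s" .
    have "cut_moment C A x = (\<Sum>c\<in>C \<inter> A. (if c \<in> B then w c else 0) *\<^sub>R c)"
      unfolding cut_moment_def by (intro sum.cong refl) (simp add: bar)
    also have "\<dots> = (\<Sum>c\<in>B \<inter> A. w c *\<^sub>R c)" using BC(2) by (subst restrict) (auto intro: sum.cong)
    finally have z': "inverse (cut_mass C A x) *\<^sub>R cut_moment C A x = z" using m z by simp
    have "u x \<bullet> (b - b') = s ^ Suc m * (v z \<bullet> (\<Sum>c\<in>C \<inter> A. (grad C c \<bullet> (b - b')) *\<^sub>R (c - z)))"
      using cut s(2) unfolding is_cut_def z'[symmetric] m[symmetric] by blast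
    also have "(\<Sum>c\<in>C \<inter> A. (grad C c \<bullet> (b - b')) *\<^sub>R (c - z)) = (\<Sum>c\<in>C \<inter> A. ((if c = b then 1 else 0) - (if c = b' then 1 else 0)) *\<^sub>R (c - z))"
      by (intro sum.cong refl) (simp only: gr Int_iff)
    also have "\<dots> = (\<Sum>c\<in>B \<inter> A. ((if c = b then 1 else 0) - (if c = b' then 1 else 0)) *\<^sub>R (c - z))"
      using bC(3,4) by (intro restrict) auto
    finally show ?thesis by (simp only: inner_sum_right inner_scaleR_right)
  qed
qed

text \<open>By \<open>cut_trace\<close> the tangential jump of the cut at \<open>x\<close> is a
  power of \<open>s\<close> times a combination of tangential jumps of \<open>v\<close> at one point
  \<open>z\<close>, the projection of \<open>x\<close> to the face spanned by
  \<open>B \<inter> A\<close>. The coefficients are common to all elements at the face, so they pass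
  through the sum over these elements.\<close>

lemma cut_jump_zero:
  assumes fin: "finite \<C>" and tet: "\<And>C. C \<in> \<C> \<Longrightarrow> tet C" and B: "B \<in> mesh_faces \<C>"
    and cut: "\<And>C. C \<in> \<C> \<Longrightarrow> is_cut m C A (v C) (u C)"
    and cont: "\<And>C. C \<in> \<C> \<Longrightarrow> continuous_on UNIV (u C)"
    and J: "\<And>x. x \<in> convex hull B \<Longrightarrow> jump \<C> v B x = 0"
    and x: "x \<in> convex hull B"
  shows "jump \<C> u B x = 0"
proof -
  define Q where "Q = {(C, a). C \<in> \<C> \<and> a \<in> C \<and> C - {a} = B}"
  have cB: "card B = 3" by (rule mesh_face_card[OF B tet])
  then have fB: "finite B" "B \<noteq> {}" by (auto intro: card_ge_0_finite)
  obtain \<kappa> :: "(real^3) set \<times> (real^3) \<Rightarrow> real" where \<kappa>: "\<And>u x. jump \<C> u B x = 0 \<longleftrightarrow> (\<forall>b\<in>B. \<forall>b'\<in>B. (\<Sum>p\<in>Q. \<kappa> p * (u (fst p) x \<bullet> (b - b'))) = 0)"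
    using jump_zero_iff[OF fin tet B] unfolding Q_def by blast
  show ?thesis
  proof (rule zero_on_face_closure[OF jump_continuous[OF fin tet cont] fB _ x])
    fix w :: "real^3 \<Rightarrow> real" assume w: "sum w B = 1" and pos: "\<And>b. b \<in> B \<Longrightarrow> w b > 0"
    define x where "x = (\<Sum>b\<in>B. w b *\<^sub>R b)"
    have "(\<Sum>p\<in>Q. \<kappa> p * (u (fst p) x \<bullet> (b - b'))) = 0" if b: "b \<in> B" "b' \<in> B" for b b'
    proof (cases "B \<inter> A = {}")
      case True
      have "u (fst p) x \<bullet> (b - b') = 0" if "p \<in> Q" for p
      proof -
        have p: "fst p \<in> \<C>" "snd p \<in> fst p" "fst p - {snd p} = B" using that by (auto simp: Q_def)
        show ?thesis by (rule cut_trace(1)[OF tet[OF p(1)] p(2,3) cut[OF p(1)] w x_def[symmetric] b True])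
      qed
      then show ?thesis by simp
    next
      case False
      define s where "s = (\<Sum>c\<in>B \<inter> A. w c)"
      have s0: "s > 0" unfolding s_def using fB False pos by (intro sum_pos) auto
      define z where "z = inverse s *\<^sub>R (\<Sum>c\<in>B \<inter> A. w c *\<^sub>R c)"
      have zs: "z = (\<Sum>c\<in>B \<inter> A. (w c / s) *\<^sub>R c)"
        by (simp add: z_def scaleR_sum_right divide_inverse mult.commute)
      have ws: "(\<Sum>c\<in>B \<inter> A. w c / s) = 1" using s0 by (simp add: sum_divide_distrib[symmetric] s_def[symmetric])
      have "z \<in> convex hull (B \<inter> A)"
      proof -
        have "finite (B \<inter> A)" using fB by simp
        then show ?thesis unfolding convex_hull_finite[OF \<open>finite (B \<inter> A)\<close>] using zs ws s0 pos
          by (auto intro!: exI[of _ "\<lambda>c. w c / s"] divide_nonneg_pos less_imp_le)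
      qed
      then have zB: "z \<in> convex hull B" using hull_mono[of "B \<inter> A" B] by blast
      define S where "S t = (\<Sum>p\<in>Q. \<kappa> p * (v (fst p) z \<bullet> t))" for t
      have S0: "S (b - b') = 0" if "b \<in> B" "b' \<in> B" for b b'
        using J[OF zB] \<kappa>[of v z] that by (auto simp: S_def)
      have Sd: "S (t - t') = S t - S t'" for t t'
        by (simp add: S_def inner_diff_right right_diff_distrib sum_subtractf)
      \<comment> \<open>\<open>z\<close> is a convex combination of vertices of \<open>B\<close>, so
        \<open>c - z\<close> is tangential to the face and is covered by the vanishing on
        edges.\<close>
      have Sz: "S (c - z) = 0" if c: "c \<in> B" for c
      proof -
        have lin: "linear S"
          unfolding S_def by (rule linearI) (simp_all add: inner_add_right distrib_left sum.distrib sum_distrib_left mult_ac)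
        have "S z = S (\<Sum>c\<in>B \<inter> A. (w c / s) *\<^sub>R c)" by (rule arg_cong[OF zs])
        also have "\<dots> = (\<Sum>c\<in>B \<inter> A. (w c / s) * S c)"
          by (simp add: linear_sum[OF lin] linear_scale[OF lin])
        also have "\<dots> = (\<Sum>c'\<in>B \<inter> A. (w c' / s) * S c)"
          using S0[OF _ c] by (intro sum.cong refl) (auto simp: Sd)
        also have "\<dots> = S c" unfolding sum_distrib_right[symmetric] ws by simp
        finally show ?thesis by (simp add: Sd)
      qed
      have "(\<Sum>p\<in>Q. \<kappa> p * (u (fst p) x \<bullet> (b - b'))) = (\<Sum>p\<in>Q. \<kappa> p * (s ^ Suc m * (\<Sum>c\<in>B \<inter> A. ((if c = b then 1 else 0) - (if c = b' then 1 else 0)) * (v (fst p) z \<bullet> (c - z)))))"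
      proof (intro sum.cong refl)
        fix p assume "p \<in> Q"
        then have p: "fst p \<in> \<C>" "snd p \<in> fst p" "fst p - {snd p} = B" by (auto simp: Q_def)
        show "\<kappa> p * (u (fst p) x \<bullet> (b - b')) = \<kappa> p * (s ^ Suc m * (\<Sum>c\<in>B \<inter> A. ((if c = b then 1 else 0) - (if c = b' then 1 else 0)) * (v (fst p) z \<bullet> (c - z))))"
          using cut_trace(2)[OF tet[OF p(1)] p(2,3) cut[OF p(1)] w x_def[symmetric] b s_def[symmetric] _ z_def] s0 by simp
      qed
      also have "\<dots> = s ^ Suc m * (\<Sum>c\<in>B \<inter> A. ((if c = b then 1 else 0) - (if c = b' then 1 else 0)) * S (c - z))"
        unfolding S_def sum_distrib_left by (subst sum.swap) (simp add: mult_ac)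
      also have "\<dots> = 0" using Sz by simp
      finally show ?thesis .
    qed
    then show "jump \<C> u B (\<Sum>b\<in>B. w b *\<^sub>R b) = 0"
      unfolding x_def[symmetric] \<kappa> by blast
  qed
qed

lemma cut_empty:
  assumes "is_cut m C A v u" "C \<inter> A = {}"
  shows "u = (\<lambda>x. 0)"
proof
  fix x
  have "\<forall>x t. (\<forall>c\<in>C \<inter> A. grad C c \<bullet> t = 0) \<longrightarrow> u x \<bullet> t = 0"
    using assms(1) unfolding is_cut_def by blast
  then have "u x \<bullet> u x = 0" by (simp add: assms(2))
  then show "u x = 0" by simp
qed

text \<open>The mass is then 1 and the moment is \<open>x\<close>: the projection is the
  identity.\<close>

lemma cut_full:
  assumes C: "tet C" and cut: "is_cut m C A v u" and sub: "C \<subseteq> A"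
  shows "u = v"
proof
  fix x
  have CA: "C \<inter> A = C" using sub by auto
  have m: "cut_mass C A x = 1" by (simp add: cut_mass_def CA bary_sum[OF C])
  have z: "cut_moment C A x = x" by (simp add: cut_moment_def CA bary_comb[OF C])
  have "u x \<bullet> t = v x \<bullet> t" for t
  proof -
    have "\<forall>x t. cut_mass C A x \<noteq> 0 \<longrightarrow>
       u x \<bullet> t = cut_mass C A x ^ Suc m * (v (inverse (cut_mass C A x) *\<^sub>R cut_moment C A x) \<bullet>
         (\<Sum>c\<in>C \<inter> A. (grad C c \<bullet> t) *\<^sub>R (c - inverse (cut_mass C A x) *\<^sub>R cut_moment C A x)))"
      using cut unfolding is_cut_def by blast
    from this[rule_format, of x t] have "u x \<bullet> t = v x \<bullet> (\<Sum>c\<in>C. (grad C c \<bullet> t) *\<^sub>R (c - x))"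
      by (simp add: m z CA)
    also have "(\<Sum>c\<in>C. (grad C c \<bullet> t) *\<^sub>R (c - x)) = t"
      using grad_comb[OF C, of t] grad_sum[OF C, of t]
      by (simp add: scaleR_diff_right sum_subtractf scaleR_sum_left[symmetric])
    finally show ?thesis .
  qed
  from this[of "u x - v x"] have "(u x - v x) \<bullet> (u x - v x) = 0" by (simp add: inner_diff_left)
  then show "u x = v x" by simp
qed

section \<open>Norm equivalence for polynomials on a tetrahedron\<close>

lemma open_bary_pos:
  assumes C: "tet C"
  shows "open {x. \<forall>c\<in>C. bary C c x > 0}"
proof -
  have "{x. \<forall>c\<in>C. bary C c x > 0} = (\<Inter>c\<in>C. {x. bary C c x > 0})" by auto
  moreover have "open {x. bary C c x > 0}" if "c \<in> C" for c
    by (intro open_Collect_less continuous_intros polys_continuous[OF bary_polys[OF C that]])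
  ultimately show ?thesis using tet_finite[OF C] by (auto intro!: open_INT)
qed

lemma interior_tet_hull:
  assumes C: "tet C"
  shows "interior (convex hull C) = {x. \<forall>c\<in>C. bary C c x > 0}"
proof
  show "interior (convex hull C) \<subseteq> {x. \<forall>c\<in>C. bary C c x > 0}"
    using interior_not_face[OF C] by blast
  show "{x. \<forall>c\<in>C. bary C c x > 0} \<subseteq> interior (convex hull C)"
    by (rule interior_maximal[OF _ open_bary_pos[OF C]]) (auto simp: tet_hull[OF C] less_imp_le)
qed

lemma interior_tet_hull_nonempty:
  assumes C: "tet C"
  shows "interior (convex hull C) \<noteq> {}"
proof -
  have one: "(\<Sum>c\<in>C. 1 / 4) = (1 :: real)" using C by (simp add: tet_def)
  define g where "g = (\<Sum>c\<in>C. (1/4) *\<^sub>R c)"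
  have b: "bary C c g = 1 / 4" if "c \<in> C" for c
    using bary_unique[OF C one g_def[symmetric] that] .
  have "\<forall>c\<in>C. bary C c g > 0"
  proof
    fix c assume "c \<in> C"
    from b[OF this] show "bary C c g > 0" by linarith
  qed
  then have "g \<in> interior (convex hull C)" unfolding interior_tet_hull[OF C] by simp
  then show ?thesis by blast
qed

lemma tet_volume_pos:
  assumes C: "tet C"
  shows "measure lborel (convex hull C) > 0"
proof (rule ccontr)
  assume "\<not> measure lborel (convex hull C) > 0"
  then have 0: "measure lborel (convex hull C) = 0" using measure_nonneg[of lborel "convex hull C"] by linarith
  have "emeasure lborel (convex hull C) < \<infinity>"
    using tet_hull_compact[OF C] emeasure_bounded_finite compact_imp_bounded by blast
  then have "emeasure lborel (convex hull C) = 0"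
    using 0 by (simp add: emeasure_eq_ennreal_measure)
  then have "convex hull C \<in> null_sets lborel"
    using borel_compact[OF tet_hull_compact[OF C]] by (simp add: null_sets_def)
  then have "negligible (convex hull C)"
    by (simp add: negligible_iff_null_sets null_sets_completionI)
  then have "negligible (interior (convex hull C))" using interior_subset negligible_subset by blast
  then show False using open_not_negligible[OF open_interior interior_tet_hull_nonempty[OF C]] by blast
qed

lemma cell_int_mono:
  assumes C: "tet C" and f: "continuous_on UNIV f" "continuous_on UNIV g"
    and le: "\<And>x. x \<in> interior (convex hull C) \<Longrightarrow> f x \<le> g x"
  shows "cell_int C f \<le> cell_int C g"
  unfolding cell_int_lebesgue[OF C f(1)] cell_int_lebesgue[OF C f(2)]
proof (rule integral_mono_AE[OF cell_integrable[OF C f(1)] cell_integrable[OF C f(2)]])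
  show "AE x in lebesgue. indicator (convex hull C) x * f x \<le> indicator (convex hull C) x * g x"
    using AE_interior_hull[OF C] by eventually_elim (auto simp: indicator_def le)
qed

lemma cell_int_cong:
  "(\<And>x. x \<in> convex hull C \<Longrightarrow> f x = g x) \<Longrightarrow> cell_int C f = cell_int C g"
  unfolding cell_int_def by (intro Bochner_Integration.integral_cong refl) (auto simp: indicator_def)

lemma cell_int_const:
  assumes C: "tet C"
  shows "cell_int C (\<lambda>x. r) = r * measure lborel (convex hull C)"
  using borel_compact[OF tet_hull_compact[OF C]] by (simp add: cell_int_def mult.commute)

lemma cell_int_sum:
  assumes C: "tet C" and f: "\<And>i. i \<in> I \<Longrightarrow> continuous_on UNIV (f i)"
  shows "cell_int C (\<lambda>x. \<Sum>i\<in>I. r i * f i x) = (\<Sum>i\<in>I. r i * cell_int C (f i))"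
proof -
  have "cell_int C (\<lambda>x. \<Sum>i\<in>I. r i * f i x) = (\<integral>x. (\<Sum>i\<in>I. r i * (indicator (convex hull C) x * f i x)) \<partial>lborel)"
    unfolding cell_int_def by (intro Bochner_Integration.integral_cong refl) (simp add: sum_distrib_left mult_ac)
  also have "\<dots> = (\<Sum>i\<in>I. r i * cell_int C (f i))"
    unfolding cell_int_def
    by (subst Bochner_Integration.integral_sum) (auto intro!: integrable_mult_right cell_integrable_lborel C f)
  finally show ?thesis .
qed

lemma cell_int_nonneg: "(\<And>x. f x \<ge> 0) \<Longrightarrow> cell_int C f \<ge> 0"
  unfolding cell_int_def by (rule Bochner_Integration.integral_nonneg) simp

lemma cell_int_square_zero:
  assumes C: "tet C" and f: "continuous_on UNIV f" and z: "cell_int C (\<lambda>x. f x * f x) = 0"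
    and x: "x \<in> convex hull C"
  shows "f x = 0"
proof -
  have c2: "continuous_on UNIV (\<lambda>x. f x * f x)" by (intro continuous_intros f)
  have int0: "f y = 0" if y: "y \<in> interior (convex hull C)" for y
  proof (rule ccontr)
    assume "f y \<noteq> 0"
    define U where "U = interior (convex hull C) \<inter> {y. f y \<noteq> 0}"
    have "open U" unfolding U_def by (intro open_Int open_interior open_Collect_neq f continuous_intros)
    moreover have "y \<in> U" using y \<open>f y \<noteq> 0\<close> by (simp add: U_def)
    ultimately have nn: "\<not> negligible U" using open_not_negligible by blast
    have "AE x in lebesgue. indicator (convex hull C) x * (f x * f x) = 0"
      using integral_nonneg_eq_0_iff_AE[OF cell_integrable[OF C c2]] z cell_int_lebesgue[OF C c2] by simp
    then have "AE x in lebesgue. x \<notin> U"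
      by eventually_elim (use interior_subset in \<open>auto simp: U_def indicator_def split: if_splits\<close>)
    then have "U \<in> null_sets lebesgue"
      using AE_iff_null_sets[of U lebesgue] \<open>open U\<close> by auto
    then show False using nn by (simp add: negligible_iff_null_sets)
  qed
  have fC: "finite C" "C \<noteq> {}" using C tet_finite[OF C] by (auto simp: tet_def)
  show ?thesis
  proof (rule zero_on_face_closure[OF f fC _ x])
    fix u :: "real^3 \<Rightarrow> real" assume u: "sum u C = 1" "\<And>c. c \<in> C \<Longrightarrow> u c > 0"
    have "bary C c (\<Sum>c\<in>C. u c *\<^sub>R c) = u c" if "c \<in> C" for c
      by (rule bary_unique[OF C u(1) refl that])
    then show "f (\<Sum>c\<in>C. u c *\<^sub>R c) = 0" by (intro int0) (simp add: interior_tet_hull[OF C] u(2))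
  qed
qed

text \<open>The inner product sees values on the hull only, hence the expansions are asserted there.
  A further function is either already in the span, when its residual has norm zero and so vanishes
  on the hull, or it contributes its normalised residual.\<close>

lemma gram_schmidt_polys:
  assumes C: "tet C" and "finite I" and "\<And>i. i \<in> I \<Longrightarrow> \<phi> i \<in> polys n"
  shows "\<exists>E. finite E \<and> E \<subseteq> polys n \<and>
    (\<forall>e\<in>E. \<forall>e'\<in>E. cell_int C (\<lambda>x. e x * e' x) = (if e = e' then 1 else 0)) \<and>
    (\<forall>i\<in>I. \<forall>x\<in>convex hull C. \<phi> i x = (\<Sum>e\<in>E. cell_int C (\<lambda>x. \<phi> i x * e x) * e x))"
  using assms(2,3)
proof (induction I rule: finite_induct)
  case empty
  then show ?case by (intro exI[of _ "{}"]) auto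
next
  case (insert j I)
  define ip where "ip f g = cell_int C (\<lambda>x. f x * g x)" for f g :: "real^3 \<Rightarrow> real"
  have "\<exists>E. finite E \<and> E \<subseteq> polys n \<and> (\<forall>e\<in>E. \<forall>e'\<in>E. ip e e' = (if e = e' then 1 else 0)) \<and>
      (\<forall>i\<in>I. \<forall>x\<in>convex hull C. \<phi> i x = (\<Sum>e\<in>E. ip (\<phi> i) e * e x))"
    unfolding ip_def by (rule insert.IH) (rule insert.prems, simp)
  then obtain E where E0: "finite E" "E \<subseteq> polys n" "\<forall>e\<in>E. \<forall>e'\<in>E. ip e e' = (if e = e' then 1 else 0)"
    "\<forall>i\<in>I. \<forall>x\<in>convex hull C. \<phi> i x = (\<Sum>e\<in>E. ip (\<phi> i) e * e x)"
    by (elim exE conjE)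
  have E3: "ip e e' = (if e = e' then 1 else 0)" if "e \<in> E" "e' \<in> E" for e e'
    using E0(3) that by blast
  have E4: "\<phi> i x = (\<Sum>e\<in>E. ip (\<phi> i) e * e x)" if "i \<in> I" "x \<in> convex hull C" for i x
    using E0(4) that by blast
  note E = E0(1,2) E3 E4
  have ip_sum: "ip (\<lambda>x. \<Sum>k\<in>K. c k * f k x) g = (\<Sum>k\<in>K. c k * ip (f k) g)"
    if "\<And>k. k \<in> K \<Longrightarrow> f k \<in> polys n" "g \<in> polys n" for K :: "(real^3 \<Rightarrow> real) set" and c f g
  proof -
    have "cell_int C (\<lambda>x. \<Sum>k\<in>K. c k * (f k x * g x)) = (\<Sum>k\<in>K. c k * cell_int C (\<lambda>x. f k x * g x))"
      by (rule cell_int_sum[OF C]) (intro continuous_on_mult polys_continuous[where m = n] that)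
    then show ?thesis by (simp add: ip_def sum_distrib_right mult.assoc)
  qed
  have ip_diff: "ip (\<lambda>x. f x - h x) g = ip f g - ip h g" and ip_scale: "ip (\<lambda>x. c * f x) g = c * ip f g"
    if "f \<in> polys n" "h \<in> polys n" "g \<in> polys n" for f h g c
  proof -
    have i: "integrable lborel (\<lambda>x. indicator (convex hull C) x * (f x * g x))" if "f \<in> polys n" for f
      using \<open>g \<in> polys n\<close> that by (intro cell_integrable_lborel[OF C] continuous_intros polys_continuous[where m = n])
    show "ip (\<lambda>x. f x - h x) g = ip f g - ip h g"
      using i[OF that(1)] i[OF that(2)] by (simp add: ip_def cell_int_def left_diff_distrib right_diff_distrib)
    show "ip (\<lambda>x. c * f x) g = c * ip f g"
      using i[OF that(1)] by (simp add: ip_def cell_int_def mult_ac)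
  qed
  have ip_comm: "ip f g = ip g f" for f g by (simp add: ip_def mult.commute)
  have ip_cong: "ip f g = ip f' g" if "\<And>x. x \<in> convex hull C \<Longrightarrow> f x = f' x" for f f' g
    unfolding ip_def using that by (intro cell_int_cong) simp
  have pj: "\<phi> j \<in> polys n" using insert by simp
  define pr where "pr = (\<lambda>x. \<Sum>e\<in>E. ip (\<phi> j) e * e x)"
  have prp: "pr \<in> polys n" unfolding pr_def using E by (intro polys_sum polys_cmult) auto
  define r where "r = (\<lambda>x. \<phi> j x - pr x)"
  have rp: "r \<in> polys n" unfolding r_def by (intro polys_diff pj prp)
  have re: "ip r e = 0" if e: "e \<in> E" for e
  proof -
    have ep: "e \<in> polys n" using e E by blast
    have "ip pr e = (\<Sum>e'\<in>E. ip (\<phi> j) e' * ip e' e)"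
      unfolding pr_def using E(2) ep by (intro ip_sum) auto
    also have "\<dots> = (\<Sum>e'\<in>E. if e' = e then ip (\<phi> j) e else 0)"
      using E(3) e by (intro sum.cong refl) auto
    also have "\<dots> = ip (\<phi> j) e" using E(1) e by simp
    finally show ?thesis unfolding r_def using ip_diff[OF pj prp ep] by simp
  qed
  show ?case
  proof (cases "ip r r = 0")
    case True
    have r0: "r x = 0" if "x \<in> convex hull C" for x
      by (rule cell_int_square_zero[OF C polys_continuous[OF rp] True[unfolded ip_def] that])
    show ?thesis unfolding ip_def[symmetric]
    proof (intro exI[of _ E] conjI ballI E(1,2))
      show "ip e e' = (if e = e' then 1 else 0)" if "e \<in> E" "e' \<in> E" for e e'
        using that by (rule E(3))
      fix i x assume i: "i \<in> insert j I" and x: "x \<in> convex hull C"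
      show "\<phi> i x = (\<Sum>e\<in>E. ip (\<phi> i) e * e x)"
      proof (cases "i = j")
        case True
        then show ?thesis using r0[OF x] by (simp add: r_def pr_def)
      next
        case False
        then show ?thesis using i x by (intro E(4)) auto
      qed
    qed
  next
    case False
    have "ip r r \<ge> 0" unfolding ip_def by (rule cell_int_nonneg) simp
    then have pos: "ip r r > 0" using False by simp
    define s where "s = sqrt (ip r r)"
    have s: "s > 0" "s * s = ip r r" using pos by (auto simp: s_def)
    define e0 where "e0 = (\<lambda>x. inverse s * r x)"
    have e0p: "e0 \<in> polys n" unfolding e0_def by (rule polys_cmult[OF rp])
    have e0e: "ip e0 e = 0" if "e \<in> E" for e
      using re[OF that] ip_scale[OF rp rp, of e "inverse s"] that E unfolding e0_def by auto
    have re0: "ip r e0 = s"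
    proof -
      have "ip r e0 = ip e0 r" by (rule ip_comm)
      also have "\<dots> = inverse s * ip r r"
        using ip_scale[OF rp rp rp, of "inverse s"] by (simp add: e0_def)
      also have "\<dots> = s" unfolding s(2)[symmetric] using s(1) by simp
      finally show ?thesis .
    qed
    have e00: "ip e0 e0 = 1"
    proof -
      have "ip e0 e0 = inverse s * ip r e0"
        using ip_scale[OF rp rp e0p, of "inverse s"] by (simp add: e0_def)
      then show ?thesis using re0 s by simp
    qed
    have e0n: "e0 \<notin> E" using e0e e00 by auto
    have pj0: "ip (\<phi> j) e0 = s"
    proof -
      have "ip pr e0 = (\<Sum>e\<in>E. ip (\<phi> j) e * ip e e0)"
        unfolding pr_def using E(2) e0p by (intro ip_sum) auto
      also have "\<dots> = 0" by (intro sum.neutral ballI) (simp add: ip_comm[of _ e0] e0e)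
      finally show ?thesis using ip_diff[OF pj prp e0p] re0 by (simp add: r_def)
    qed
    show ?thesis unfolding ip_def[symmetric]
    proof (intro exI[of _ "insert e0 E"] conjI ballI)
      show "finite (insert e0 E)" "insert e0 E \<subseteq> polys n" using E(1,2) e0p by auto
      show "ip e e' = (if e = e' then 1 else 0)" if "e \<in> insert e0 E" "e' \<in> insert e0 E" for e e'
        using that E(3) e0e e00 e0n ip_comm[of e e0] by auto
      fix i x assume i: "i \<in> insert j I" and x: "x \<in> convex hull C"
      show "\<phi> i x = (\<Sum>e\<in>insert e0 E. ip (\<phi> i) e * e x)"
      proof (cases "i = j")
        case True
        have "\<phi> j x = pr x + s * e0 x" using s(1) by (simp add: r_def e0_def mult.assoc[symmetric])
        then show ?thesis using E(1) e0n by (simp add: True pr_def pj0)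
      next
        case False
        then have iI: "i \<in> I" using i by simp
        have "ip (\<phi> i) e0 = ip (\<lambda>x. \<Sum>e\<in>E. ip (\<phi> i) e * e x) e0"
          by (rule ip_cong) (rule E(4)[OF iI])
        also have "\<dots> = (\<Sum>e\<in>E. ip (\<phi> i) e * ip e e0)"
          using E(2) e0p by (intro ip_sum) auto
        also have "\<dots> = 0" by (intro sum.neutral ballI) (simp add: ip_comm[of _ e0] e0e)
        finally show ?thesis using E(1) e0n E(4)[OF iI x] by simp
      qed
    qed
  qed
qed

text \<open>Parseval's identity for the system obtained from the monomials. It reduces estimates for
  polynomials to the Cauchy-Schwarz inequality for coefficients.\<close>

lemma reference_expansion:
  assumes C: "tet C"
  shows "\<exists>E. finite E \<and> E \<subseteq> polys n \<and>
    (\<forall>f\<in>polys n. \<exists>\<gamma>. (\<forall>x\<in>convex hull C. f x = (\<Sum>e\<in>E. \<gamma> e * e x)) \<and> (\<Sum>e\<in>E. (\<gamma> e)\<^sup>2) = cell_int C (\<lambda>x. f x * f x))"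
proof -
  define \<phi> :: "nat \<times> nat \<times> nat \<Rightarrow> real^3 \<Rightarrow> real" where "\<phi> i x = x $ 1 ^ fst i * x $ 2 ^ fst (snd i) * x $ 3 ^ snd (snd i)" for i x
  have \<phi>p: "\<phi> i \<in> polys n" if "i \<in> tri n" for i
    unfolding \<phi>_def[abs_def] using that by (intro polys_monomial) (simp add: tri_mem)
  obtain E where E: "finite E" "E \<subseteq> polys n"
    "\<forall>e\<in>E. \<forall>e'\<in>E. cell_int C (\<lambda>x. e x * e' x) = (if e = e' then 1 else 0)"
    "\<forall>i\<in>tri n. \<forall>x\<in>convex hull C. \<phi> i x = (\<Sum>e\<in>E. cell_int C (\<lambda>x. \<phi> i x * e x) * e x)"
    using gram_schmidt_polys[of C "tri n" \<phi> n, OF C finite_tri \<phi>p] by blast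
  have "\<exists>\<gamma>. (\<forall>x\<in>convex hull C. f x = (\<Sum>e\<in>E. \<gamma> e * e x)) \<and> (\<Sum>e\<in>E. (\<gamma> e)\<^sup>2) = cell_int C (\<lambda>x. f x * f x)"
    if f: "f \<in> polys n" for f
  proof -
    obtain c where c: "f = (\<lambda>x. \<Sum>i\<in>tri n. c i * \<phi> i x)"
      using polys_expand[OF f] unfolding \<phi>_def by blast
    define \<gamma> where "\<gamma> e = (\<Sum>i\<in>tri n. c i * cell_int C (\<lambda>x. \<phi> i x * e x))" for e
    have ex: "f x = (\<Sum>e\<in>E. \<gamma> e * e x)" if "x \<in> convex hull C" for x
    proof -
      have "f x = (\<Sum>i\<in>tri n. c i * (\<Sum>e\<in>E. cell_int C (\<lambda>x. \<phi> i x * e x) * e x))"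
        unfolding c using E(4) that by (intro sum.cong refl) auto
      also have "\<dots> = (\<Sum>e\<in>E. \<gamma> e * e x)"
        unfolding \<gamma>_def sum_distrib_left sum_distrib_right by (subst sum.swap) (simp add: mult_ac)
      finally show ?thesis .
    qed
    have "cell_int C (\<lambda>x. f x * f x) = cell_int C (\<lambda>x. \<Sum>p\<in>E \<times> E. (\<gamma> (fst p) * \<gamma> (snd p)) * (fst p x * snd p x))"
    proof (rule cell_int_cong)
      fix x assume "x \<in> convex hull C"
      then have "f x * f x = (\<Sum>e\<in>E. \<gamma> e * e x) * (\<Sum>e\<in>E. \<gamma> e * e x)" using ex by simp
      also have "\<dots> = (\<Sum>p\<in>E \<times> E. (\<gamma> (fst p) * \<gamma> (snd p)) * (fst p x * snd p x))"
        unfolding sum_product sum.cartesian_product by (intro sum.cong refl) (auto simp: mult_ac)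
      finally show "f x * f x = (\<Sum>p\<in>E \<times> E. (\<gamma> (fst p) * \<gamma> (snd p)) * (fst p x * snd p x))" .
    qed
    also have "\<dots> = (\<Sum>p\<in>E \<times> E. (\<gamma> (fst p) * \<gamma> (snd p)) * cell_int C (\<lambda>x. fst p x * snd p x))"
      using E(2) polys_continuous[of _ n UNIV] by (intro cell_int_sum[OF C]) (auto intro!: continuous_intros)
    also have "\<dots> = (\<Sum>e\<in>E. \<Sum>e'\<in>E. if e = e' then \<gamma> e * \<gamma> e' else 0)"
      unfolding sum.cartesian_product using E(3) by (intro sum.cong refl) auto
    also have "\<dots> = (\<Sum>e\<in>E. (\<gamma> e)\<^sup>2)" using E(1) by (simp add: power2_eq_square)
    finally show ?thesis using ex by auto
  qed
  then show ?thesis using E(1,2) by blast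
qed

text \<open>Derivatives are taken along edges, because affine maps between tetrahedra carry edges to
  edges; the bound then contains no length and changes only by a ratio of volumes. They are taken at
  interior points, where the values on the hull determine them.\<close>

definition poly_bound :: "nat \<Rightarrow> (real^3) set \<Rightarrow> real \<Rightarrow> bool" where
  "poly_bound n C K \<longleftrightarrow> (\<forall>f\<in>polys n.
     (\<forall>x\<in>convex hull C. (f x)\<^sup>2 \<le> K * cell_int C (\<lambda>x. f x * f x)) \<and>
     (\<forall>a\<in>C. \<forall>b\<in>C. \<forall>x\<in>interior (convex hull C). \<forall>f'. (f has_derivative f') (at x) \<longrightarrow>
        (f' (a - b))\<^sup>2 \<le> K * cell_int C (\<lambda>x. f x * f x)))"

lemma poly_bound_value:
  assumes "poly_bound n C K" "f \<in> polys n" "x \<in> convex hull C"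
  shows "(f x)\<^sup>2 \<le> K * cell_int C (\<lambda>x. f x * f x)"
  using assms unfolding poly_bound_def by blast

lemma poly_bound_derivative:
  assumes "poly_bound n C K" "f \<in> polys n" "a \<in> C" "b \<in> C" "x \<in> interior (convex hull C)" "(f has_derivative f') (at x)"
  shows "(f' (a - b))\<^sup>2 \<le> K * cell_int C (\<lambda>x. f x * f x)"
  using assms unfolding poly_bound_def by blast

lemma reference_poly_bound:
  assumes C: "tet C"
  shows "\<exists>K>0. poly_bound n C K"
proof -
  obtain E where E: "finite E" "E \<subseteq> polys n"
    "\<forall>f\<in>polys n. \<exists>\<gamma>. (\<forall>x\<in>convex hull C. f x = (\<Sum>e\<in>E. \<gamma> e * e x)) \<and> (\<Sum>e\<in>E. (\<gamma> e)\<^sup>2) = cell_int C (\<lambda>x. f x * f x)"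
    using reference_expansion[OF C, of n] by (elim exE conjE)
  have "\<forall>e\<in>E. \<exists>D :: 3 \<Rightarrow> real^3 \<Rightarrow> real. (\<forall>i. D i \<in> polys n) \<and> (\<forall>x. (e has_derivative (\<lambda>h. D 1 x * h $ 1 + D 2 x * h $ 2 + D 3 x * h $ 3)) (at x))"
  proof
    fix e assume "e \<in> E"
    then have "e \<in> polys n" using E(2) by blast
    then show "\<exists>D :: 3 \<Rightarrow> real^3 \<Rightarrow> real. (\<forall>i. D i \<in> polys n) \<and> (\<forall>x. (e has_derivative (\<lambda>h. D 1 x * h $ 1 + D 2 x * h $ 2 + D 3 x * h $ 3)) (at x))"
      by (rule polys_has_derivative) blast
  qed
  from bchoice[OF this] obtain D :: "(real^3 \<Rightarrow> real) \<Rightarrow> 3 \<Rightarrow> real^3 \<Rightarrow> real" where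
    D0: "\<forall>e\<in>E. (\<forall>i. D e i \<in> polys n) \<and> (\<forall>x. (e has_derivative (\<lambda>h. D e 1 x * h $ 1 + D e 2 x * h $ 2 + D e 3 x * h $ 3)) (at x))" ..
  define d where "d e x h = D e 1 x * h $ 1 + D e 2 x * h $ 2 + D e 3 x * h $ 3" for e and x h :: "real^3"
  have Dp: "D e i \<in> polys n" and Dd: "(e has_derivative d e x) (at x)" if "e \<in> E" for e i x
    using D0 that unfolding d_def by blast+
  \<comment> \<open>The squares of all values and edge derivatives of the orthonormal system;
    \<open>q\<close> is continuous, so its bound on the compact hull serves as the second factor in
    Cauchy-Schwarz.\<close>
  define q where "q x = (\<Sum>e\<in>E. (e x)\<^sup>2) + (\<Sum>a\<in>C. \<Sum>b\<in>C. \<Sum>e\<in>E. (d e x (a - b))\<^sup>2)" for x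
  have ce: "continuous_on UNIV e" if "e \<in> E" for e using that E(2) polys_continuous by blast
  have cD: "continuous_on UNIV (D e i)" if "e \<in> E" for e i using Dp[OF that] polys_continuous by blast
  have "continuous_on UNIV q"
    unfolding q_def d_def by (intro continuous_intros ce cD)
  then have "bounded (q ` (convex hull C))"
    by (intro compact_imp_bounded compact_continuous_image tet_hull_compact C) (rule continuous_on_subset, auto)
  then obtain K0 where K0: "\<And>x. x \<in> convex hull C \<Longrightarrow> norm (q x) \<le> K0"
    unfolding bounded_iff by blast
  define K where "K = \<bar>K0\<bar> + 1"
  have K: "K > 0" "\<And>x. x \<in> convex hull C \<Longrightarrow> q x \<le> K" using K0 by (fastforce simp: K_def)+
  have q1: "(\<Sum>e\<in>E. (e x)\<^sup>2) \<le> q x" for x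
    unfolding q_def by (simp add: sum_nonneg)
  have q2: "(\<Sum>e\<in>E. (d e x (a - b))\<^sup>2) \<le> q x" if "a \<in> C" "b \<in> C" for x a b
  proof -
    have "(\<Sum>e\<in>E. (d e x (a - b))\<^sup>2) \<le> (\<Sum>b\<in>C. \<Sum>e\<in>E. (d e x (a - b))\<^sup>2)"
      using that tet_finite[OF C] by (intro member_le_sum[of b C "\<lambda>b. \<Sum>e\<in>E. (d e x (a - b))\<^sup>2"]) (auto intro: sum_nonneg)
    also have "\<dots> \<le> (\<Sum>a\<in>C. \<Sum>b\<in>C. \<Sum>e\<in>E. (d e x (a - b))\<^sup>2)"
      using that tet_finite[OF C] by (intro member_le_sum[of a C "\<lambda>a. \<Sum>b\<in>C. \<Sum>e\<in>E. (d e x (a - b))\<^sup>2"]) (auto intro!: sum_nonneg)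
    also have "\<dots> \<le> q x" unfolding q_def by (simp add: sum_nonneg)
    finally show ?thesis .
  qed
  have cs: "(\<Sum>e\<in>E. \<gamma> e * y e)\<^sup>2 \<le> K * I" if "(\<Sum>e\<in>E. (\<gamma> e)\<^sup>2) = I" "(\<Sum>e\<in>E. (y e)\<^sup>2) \<le> K" for \<gamma> y :: "(real^3 \<Rightarrow> real) \<Rightarrow> real" and I
  proof -
    have "(\<Sum>e\<in>E. \<gamma> e * y e)\<^sup>2 \<le> (\<Sum>e\<in>E. (\<gamma> e)\<^sup>2) * (\<Sum>e\<in>E. (y e)\<^sup>2)" by (rule Cauchy_Schwarz_ineq_sum)
    also have "\<dots> \<le> (\<Sum>e\<in>E. (\<gamma> e)\<^sup>2) * K" using that(2) by (intro mult_left_mono sum_nonneg) auto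
    finally show ?thesis using that(1) by (simp add: mult.commute)
  qed
  have "poly_bound n C K"
    unfolding poly_bound_def
  proof (intro ballI conjI allI impI)
    fix f x assume f: "f \<in> polys n" and x: "x \<in> convex hull C"
    obtain \<gamma> where g: "\<forall>x\<in>convex hull C. f x = (\<Sum>e\<in>E. \<gamma> e * e x)" "(\<Sum>e\<in>E. (\<gamma> e)\<^sup>2) = cell_int C (\<lambda>x. f x * f x)"
      using E(3) f by blast
    show "(f x)\<^sup>2 \<le> K * cell_int C (\<lambda>x. f x * f x)"
      unfolding g(1)[rule_format, OF x] by (rule cs[OF g(2)]) (rule order_trans[OF q1 K(2)[OF x]])
  next
    fix f a b x f' assume f: "f \<in> polys n" and a: "a \<in> C" and b: "b \<in> C" and x: "x \<in> interior (convex hull C)"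
      and f': "(f has_derivative f') (at x)"
    obtain \<gamma> where g: "\<forall>x\<in>convex hull C. f x = (\<Sum>e\<in>E. \<gamma> e * e x)" "(\<Sum>e\<in>E. (\<gamma> e)\<^sup>2) = cell_int C (\<lambda>x. f x * f x)"
      using E(3) f by blast
    have "((\<lambda>x. \<Sum>e\<in>E. \<gamma> e * e x) has_derivative (\<lambda>h. \<Sum>e\<in>E. \<gamma> e * d e x h)) (at x)"
      by (intro has_derivative_sum has_derivative_mult_right Dd)
    then have "(f has_derivative (\<lambda>h. \<Sum>e\<in>E. \<gamma> e * d e x h)) (at x)"
    proof (rule has_derivative_transform_within_open[OF _ open_interior x])
      fix y assume "y \<in> interior (convex hull C)"
      then have "y \<in> convex hull C" by (rule subsetD[OF interior_subset])
      then show "(\<Sum>e\<in>E. \<gamma> e * e y) = f y" by (rule g(1)[rule_format, symmetric])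
    qed
    then have "f' = (\<lambda>h. \<Sum>e\<in>E. \<gamma> e * d e x h)" using f' by (rule has_derivative_unique[rotated])
    then have "f' (a - b) = (\<Sum>e\<in>E. \<gamma> e * d e x (a - b))" by simp
    moreover have "(\<Sum>e\<in>E. (d e x (a - b))\<^sup>2) \<le> K"
      using order_trans[OF q2[OF a b] K(2)] x interior_subset by blast
    ultimately show "(f' (a - b))\<^sup>2 \<le> K * cell_int C (\<lambda>x. f x * f x)"
      using cs[OF g(2)] by simp
  qed
  then show ?thesis using K(1) by blast
qed

section \<open>Affine transport between tetrahedra\<close>

definition vertex_map :: "(real^3) set \<Rightarrow> (real^3 \<Rightarrow> real^3) \<Rightarrow> real^3 \<Rightarrow> real^3" where
  "vertex_map C \<beta> w = (\<Sum>c\<in>C. bary C c w *\<^sub>R \<beta> c)"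

lemma vertex_map_inverse:
  assumes C: "tet C" and D: "tet D" and \<beta>: "bij_betw \<beta> C D"
  shows "\<exists>w. vertex_map C \<beta> w = x \<and> (\<forall>c\<in>C. bary C c w = bary D (\<beta> c) x)"
proof -
  define w where "w = (\<Sum>c\<in>C. bary D (\<beta> c) x *\<^sub>R c)"
  have "(\<Sum>c\<in>C. bary D (\<beta> c) x) = 1"
    using sum.reindex_bij_betw[OF \<beta>, of "\<lambda>d. bary D d x"] bary_sum[OF D] by simp
  then have b: "bary C c w = bary D (\<beta> c) x" if "c \<in> C" for c
    by (rule bary_unique[OF C _ w_def[symmetric] that])
  then have "vertex_map C \<beta> w = (\<Sum>c\<in>C. bary D (\<beta> c) x *\<^sub>R \<beta> c)"
    unfolding vertex_map_def by (intro sum.cong refl) simp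
  also have "\<dots> = x"
    using sum.reindex_bij_betw[OF \<beta>, of "\<lambda>d. bary D d x *\<^sub>R d"] bary_comb[OF D] by simp
  finally show ?thesis using b by blast
qed

text \<open>\<open>tet_fubini\<close> expresses both integrals by the same integral \<open>R\<close>
  over the parameter domain, so no determinant of the affine map is computed.\<close>

lemma vertex_map_integral:
  assumes C: "tet C" and D: "tet D" and \<beta>: "bij_betw \<beta> C D" and h: "continuous_on UNIV h"
  shows "cell_int D h * measure lborel (convex hull C) = measure lborel (convex hull D) * cell_int C (\<lambda>w. h (vertex_map C \<beta> w))"
proof -
  obtain a b c d where abcd: "C = {a, b, c, d}" "a \<noteq> b" "a \<noteq> c" "a \<noteq> d" "b \<noteq> c" "b \<noteq> d" "c \<noteq> d"
  proof -
    have "card C = Suc 3" using C by (simp add: tet_def)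
    then obtain a C' where C': "C = insert a C'" "a \<notin> C'" "card C' = 3"
      using card_eq_SucD by metis
    then obtain b c d where "C' = {b, c, d}" "b \<noteq> c" "b \<noteq> d" "c \<noteq> d" by (auto simp: card_3_iff)
    then show ?thesis using C' by (intro that[of a b c d]) auto
  qed
  have ne: "b \<noteq> a" "c \<noteq> a" "d \<noteq> a" "c \<noteq> b" "d \<noteq> b" "d \<noteq> c" using abcd by auto
  have Deq: "D = {\<beta> a, \<beta> b, \<beta> c, \<beta> d}" using \<beta> abcd(1) by (auto simp: bij_betw_def)
  have eq: "vertex_map C \<beta> (tet_param a b c d q) = tet_param (\<beta> a) (\<beta> b) (\<beta> c) (\<beta> d) q" for q
  proof -
    obtain s y z where q: "q = (s, y, z)" by (metis surj_pair)
    define u where "u = (\<lambda>x. if x = a then s else if x = c then y else if x = d then z else 1 - (s + y + z))"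
    have u: "sum u C = 1" "(\<Sum>x\<in>C. u x *\<^sub>R x) = tet_param a b c d q"
      using abcd ne by (simp_all add: u_def q tet_param_def algebra_simps)
    have "vertex_map C \<beta> (tet_param a b c d q) = (\<Sum>x\<in>C. u x *\<^sub>R \<beta> x)"
      unfolding vertex_map_def by (intro sum.cong refl) (simp add: bary_unique[OF C u])
    also have "\<dots> = tet_param (\<beta> a) (\<beta> b) (\<beta> c) (\<beta> d) q"
      using abcd ne by (simp add: u_def q tet_param_def algebra_simps)
    finally show ?thesis .
  qed
  have "continuous_on UNIV (vertex_map C \<beta>)"
    unfolding vertex_map_def[abs_def]
    by (intro continuous_intros polys_continuous[OF bary_polys[OF C]])
  then have hc: "continuous_on UNIV (\<lambda>w. h (vertex_map C \<beta> w))"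
    by (rule continuous_on_compose2[OF h]) auto
  define R where "R = (\<integral>p. indicator std2 p * (\<integral>s. h (tet_param (\<beta> a) (\<beta> b) (\<beta> c) (\<beta> d) (s, p)) * indicator {0..1 - fst p - snd p} s \<partial>lborel) \<partial>lborel)"
  have e1: "std3_volume * cell_int D h = measure lborel (convex hull D) * R"
    unfolding cell_int_def R_def Deq by (rule tet_fubini[OF D[unfolded Deq] h])
  have e2: "std3_volume * cell_int C (\<lambda>w. h (vertex_map C \<beta> w)) = measure lborel (convex hull C) * R"
    using tet_fubini[OF C[unfolded abcd(1)] hc] unfolding eq cell_int_def R_def by (simp add: abcd(1))
  have "std3_volume * (cell_int D h * measure lborel (convex hull C)) = (std3_volume * cell_int D h) * measure lborel (convex hull C)"
    by (simp only: mult.assoc)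
  also have "\<dots> = measure lborel (convex hull D) * (std3_volume * cell_int C (\<lambda>w. h (vertex_map C \<beta> w)))"
    unfolding e1 e2 by (simp only: mult_ac)
  also have "\<dots> = std3_volume * (measure lborel (convex hull D) * cell_int C (\<lambda>w. h (vertex_map C \<beta> w)))"
    by (simp only: mult_ac)
  finally show ?thesis using std3_volume_pos by simp
qed

text \<open>The vertex map carries values and edge derivatives over unchanged, and only the integral
  scales with the volume; so the constant of one reference tetrahedron serves all.\<close>

lemma uniform_poly_bound: "\<exists>K>0. \<forall>D. tet D \<longrightarrow> poly_bound n D (K / measure lborel (convex hull D))"
\<comment> \<open>Any tetrahedron may be the reference. If there were none the claim would be void,
  so none has to be exhibited.\<close>
proof (cases "\<exists>C. tet C")
  case False
  then show ?thesis by (intro exI[of _ 1]) auto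
next
  case True
  then obtain C where C: "tet C" by blast
  obtain K where K: "K > 0" "poly_bound n C K" using reference_poly_bound[OF C] by blast
  define V where "V = measure lborel (convex hull C)"
  have V: "V > 0" unfolding V_def by (rule tet_volume_pos[OF C])
  have "poly_bound n D (K * V / measure lborel (convex hull D))" if D: "tet D" for D
  proof -
    define W where "W = measure lborel (convex hull D)"
    have W: "W > 0" unfolding W_def by (rule tet_volume_pos[OF D])
    have "card C = card D" using C D by (simp add: tet_def)
    then obtain \<beta> where \<beta>: "bij_betw \<beta> C D"
      using finite_same_card_bij[OF tet_finite[OF C] tet_finite[OF D]] by blast
    define X where "X = vertex_map C \<beta>"
    have Xp: "(\<lambda>w. X w $ i) \<in> polys 1" for i
      unfolding X_def vertex_map_def sum_component vector_scaleR_component real_scaleR_def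
      using bary_polys[OF C] by (intro polys_sum tet_finite C polys_cmultr) simp
    have int: "K * cell_int C (\<lambda>w. f (X w) * f (X w)) = K * V / W * cell_int D (\<lambda>x. f x * f x)" if "f \<in> polys n" for f
    proof -
      have "cell_int D (\<lambda>x. f x * f x) * V = W * cell_int C (\<lambda>w. f (X w) * f (X w))"
        unfolding V_def W_def X_def using that
        by (intro vertex_map_integral[OF C D \<beta>] continuous_intros polys_continuous[where m = n])
      then show ?thesis using W by (simp add: field_simps)
    qed
    show ?thesis
      unfolding W_def[symmetric] poly_bound_def
    proof (intro ballI conjI allI impI)
      fix f x assume f: "f \<in> polys n" and x: "x \<in> convex hull D"
      obtain w where w: "X w = x" "\<forall>c\<in>C. bary C c w = bary D (\<beta> c) x"
        using vertex_map_inverse[OF C D \<beta>, of x] unfolding X_def by blast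
      have "\<beta> c \<in> D" if "c \<in> C" for c using \<beta> that by (auto simp: bij_betw_def)
      then have wC: "w \<in> convex hull C" using x w(2) by (auto simp: tet_hull[OF C] tet_hull[OF D])
      have "(\<lambda>w. f (X w)) \<in> polys n" by (rule polys_compose_affine[OF f Xp])
      then have "(f (X w))\<^sup>2 \<le> K * cell_int C (\<lambda>w. f (X w) * f (X w))"
        by (rule poly_bound_value[OF K(2) _ wC])
      then show "(f x)\<^sup>2 \<le> K * V / W * cell_int D (\<lambda>x. f x * f x)" by (simp only: w(1) int[OF f])
    next
      fix f a b x f' assume f: "f \<in> polys n" and a: "a \<in> D" and b: "b \<in> D" and x: "x \<in> interior (convex hull D)"
        and f': "(f has_derivative f') (at x)"
      obtain w where w: "X w = x" "\<forall>c\<in>C. bary C c w = bary D (\<beta> c) x"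
        using vertex_map_inverse[OF C D \<beta>, of x] unfolding X_def by blast
      have "\<beta> c \<in> D" if "c \<in> C" for c using \<beta> that by (auto simp: bij_betw_def)
      then have wC: "w \<in> interior (convex hull C)" using x w(2) by (auto simp: interior_tet_hull[OF C] interior_tet_hull[OF D])
      obtain a' b' where ab: "a' \<in> C" "b' \<in> C" "\<beta> a' = a" "\<beta> b' = b"
        using a b \<beta> by (auto simp: bij_betw_def)
      have bd: "((\<lambda>w. bary C c w) has_derivative (\<lambda>h. grad C c \<bullet> h)) (at w)" if "c \<in> C" for c
      proof -
        have eq: "(\<lambda>w. bary C c w) = (\<lambda>w. grad C c \<bullet> w + bary C c 0)" by (intro ext bary_affine[OF C that])
        have "((\<lambda>w. grad C c \<bullet> w + bary C c 0) has_derivative (\<lambda>h. grad C c \<bullet> h)) (at w)"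
          by (auto intro!: derivative_eq_intros)
        then show ?thesis by (simp only: eq[symmetric])
      qed
      define L where "L h = (\<Sum>c\<in>C. (grad C c \<bullet> h) *\<^sub>R \<beta> c)" for h
      have Xd: "(X has_derivative L) (at w)"
        unfolding X_def vertex_map_def[abs_def] L_def[abs_def]
        by (intro has_derivative_sum has_derivative_scaleR_left bd)
      have "((\<lambda>w. f (X w)) has_derivative (\<lambda>h. f' (L h))) (at w)"
        by (rule has_derivative_compose[OF Xd]) (simp add: w(1) f')
      moreover have "(\<lambda>w. f (X w)) \<in> polys n" by (rule polys_compose_affine[OF f Xp])
      ultimately have "(f' (L (a' - b')))\<^sup>2 \<le> K * cell_int C (\<lambda>w. f (X w) * f (X w))"
        using poly_bound_derivative[OF K(2) _ ab(1,2) wC] by blast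
      moreover have "L (a' - b') = a - b"
      proof -
        have "L (a' - b') = (\<Sum>c\<in>C. (if c = a' then \<beta> c else 0) - (if c = b' then \<beta> c else 0))"
          unfolding L_def using grad_edge[OF C _ ab(1,2)] by (intro sum.cong refl) auto
        then show ?thesis using ab tet_finite[OF C] by (simp add: sum_subtractf)
      qed
      ultimately show "(f' (a - b))\<^sup>2 \<le> K * V / W * cell_int D (\<lambda>x. f x * f x)" by (simp only: int[OF f])
    qed
  qed
  then show ?thesis using K(1) V by (intro exI[of _ "K * V"]) auto
qed

section \<open>Stability of the cut operator\<close>

lemma local_nedelec_component:
  assumes "v \<in> local_nedelec m"
  shows "(\<lambda>x. v x $ i) \<in> polys (Suc m)"
proof -
  obtain p q where pq: "p \<in> poly_fields m" "q \<in> poly_fields m" "v = (\<lambda>x. p x + cross3 x (q x))"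
    using assms by (auto simp: local_nedelec_def)
  have P: "(\<lambda>x. p x $ j) \<in> polys (Suc m)" for j
    using pq(1) polys_mono[of m "Suc m"] by (auto simp: poly_fields_def)
  have Q: "(\<lambda>x. x $ j * q x $ l) \<in> polys (Suc m)" for j l
    using polys_mult[OF polys_coord[of j 0], of "\<lambda>x. q x $ l" m] pq(2) by (simp add: poly_fields_def)
  consider "i = 1" | "i = 2" | "i = 3" using exhaust_3 by blast
  then show ?thesis
    unfolding pq(3) by cases (simp_all add: cross3_def, (intro polys_add polys_diff P Q)+)
qed

lemma poly_field_derivative:
  fixes v :: "real^3 \<Rightarrow> real^3"
  assumes v: "\<And>i. (\<lambda>x. v x $ i) \<in> polys n"
  shows "\<exists>D :: 3 \<Rightarrow> 3 \<Rightarrow> real^3 \<Rightarrow> real. (\<forall>i j. D i j \<in> polys n) \<and>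
    (\<forall>x. (v has_derivative (\<lambda>h. \<chi> i. D i 1 x * h $ 1 + D i 2 x * h $ 2 + D i 3 x * h $ 3)) (at x))"
proof -
  have "\<forall>i. \<exists>D :: 3 \<Rightarrow> real^3 \<Rightarrow> real. (\<forall>j. D j \<in> polys n) \<and> (\<forall>x. ((\<lambda>x. v x $ i) has_derivative (\<lambda>h. D 1 x * h $ 1 + D 2 x * h $ 2 + D 3 x * h $ 3)) (at x))"
    by (rule allI, rule polys_has_derivative[OF v]) blast
  from choice[OF this] obtain D :: "3 \<Rightarrow> 3 \<Rightarrow> real^3 \<Rightarrow> real" where
    D: "\<forall>i. (\<forall>j. D i j \<in> polys n) \<and> (\<forall>x. ((\<lambda>x. v x $ i) has_derivative (\<lambda>h. D i 1 x * h $ 1 + D i 2 x * h $ 2 + D i 3 x * h $ 3)) (at x))" ..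
  have "(v has_derivative (\<lambda>h. \<chi> i. D i 1 x * h $ 1 + D i 2 x * h $ 2 + D i 3 x * h $ 3)) (at x)" for x
    unfolding has_derivative_componentwise_within[where f = v]
  proof
    fix e :: "real^3" assume "e \<in> Basis"
    then obtain i where e: "e = axis i 1" by (auto simp: Basis_vec_def)
    have "((\<lambda>x. v x $ i) has_derivative (\<lambda>h. D i 1 x * h $ 1 + D i 2 x * h $ 2 + D i 3 x * h $ 3)) (at x)"
      using D by blast
    then show "((\<lambda>x. v x \<bullet> e) has_derivative (\<lambda>h. (\<chi> i. D i 1 x * h $ 1 + D i 2 x * h $ 2 + D i 3 x * h $ 3) \<bullet> e)) (at x)"
      by (simp add: e inner_axis)
  qed
  then show ?thesis using D by (intro exI[of _ D]) blast
qed

lemma poly_field_C1: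
  fixes v :: "real^3 \<Rightarrow> real^3"
  assumes v: "\<And>i. (\<lambda>x. v x $ i) \<in> polys n"
  shows "Ck_field 1 v"
proof -
  obtain D :: "3 \<Rightarrow> 3 \<Rightarrow> real^3 \<Rightarrow> real" where D: "\<forall>i j. D i j \<in> polys n"
    "\<forall>x. (v has_derivative (\<lambda>h. \<chi> i. D i 1 x * h $ 1 + D i 2 x * h $ 2 + D i 3 x * h $ 3)) (at x)"
    using poly_field_derivative[OF v] by (elim exE conjE)
  have dv: "(v has_derivative (\<lambda>h. \<chi> i. D i 1 x * h $ 1 + D i 2 x * h $ 2 + D i 3 x * h $ 3)) (at x)" for x
    using D(2) by (rule spec)
  have "partial_deriv j v x = (\<chi> i. D i j x)" for j x
  proof -
    consider "j = 1" | "j = 2" | "j = 3" using exhaust_3 by blast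
    then show ?thesis
      unfolding partial_deriv_def frechet_derivative_at[OF dv, symmetric]
      by cases (simp_all add: axis_def)
  qed
  then have p: "partial_deriv j v = (\<lambda>x. \<chi> i. D i j x)" for j by (rule ext)
  have "continuous_on UNIV (\<lambda>x. \<chi> i. D i j x)" for j
    using D(1) by (intro continuous_on_vec_lambda polys_continuous[where m = n]) blast
  then show ?thesis
    unfolding Ck_field_1 p using dv by (auto simp: differentiable_def)
qed

lemma norm_square_vec3: "(norm (x :: real^3))\<^sup>2 = (x $ 1)\<^sup>2 + (x $ 2)\<^sup>2 + (x $ 3)\<^sup>2"
  unfolding power2_norm_eq_inner inner_vec_def sum_3 by (simp add: power2_eq_square)

lemma cell_int_norm_square:
  fixes v :: "real^3 \<Rightarrow> real^3"
  assumes C: "tet C" and v: "continuous_on UNIV v"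
  shows "cell_int C (\<lambda>x. (norm (v x))\<^sup>2) = cell_int C (\<lambda>x. v x $ 1 * v x $ 1) + cell_int C (\<lambda>x. v x $ 2 * v x $ 2) + cell_int C (\<lambda>x. v x $ 3 * v x $ 3)"
proof -
  have i: "integrable lborel (\<lambda>x. indicator (convex hull C) x * (v x $ j * v x $ j))" for j
    by (intro cell_integrable_lborel C continuous_intros v)
  show ?thesis
    unfolding cell_int_def norm_square_vec3 unfolding power2_eq_square distrib_left
    using i[of 1] i[of 2] i[of 3] by simp
qed

lemma value_bound:
  fixes v :: "real^3 \<Rightarrow> real^3"
  assumes C: "tet C" and pb: "poly_bound n C \<kappa>" and v: "\<And>i. (\<lambda>x. v x $ i) \<in> polys n" and x: "x \<in> convex hull C"
  shows "(norm (v x))\<^sup>2 \<le> \<kappa> * cell_int C (\<lambda>x. (norm (v x))\<^sup>2)"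
proof -
  have "(v x $ i)\<^sup>2 \<le> \<kappa> * cell_int C (\<lambda>x. v x $ i * v x $ i)" for i
    by (rule poly_bound_value[OF pb v x])
  from this[of 1] this[of 2] this[of 3] show ?thesis
    unfolding cell_int_norm_square[OF C C1_continuous[OF poly_field_C1[OF v]]]
    unfolding norm_square_vec3 distrib_left by linarith
qed

text \<open>A partial derivative combines four edge derivatives with coefficients at most
  \<open>G\<close>, so its square is at most \<open>16 * G\<^sup>2 * \<kappa> * I i\<close>.
  Squaring a difference costs a factor 2, and each \<open>I i\<close> occurs in two components of
  the curl: \<open>64 = 16 * 2 * 2\<close>.\<close>

lemma curl_bound:
  assumes C: "tet C" and pb: "poly_bound n C \<kappa>" and k: "\<kappa> \<ge> 0" and u: "\<And>i. (\<lambda>x. u x $ i) \<in> polys n"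
    and G: "\<And>c. c \<in> C \<Longrightarrow> norm (grad C c) \<le> G" and x: "x \<in> interior (convex hull C)"
  shows "(norm (classical_curl u x))\<^sup>2 \<le> 64 * G\<^sup>2 * \<kappa> * cell_int C (\<lambda>x. (norm (u x))\<^sup>2)"
proof -
  have C1: "Ck_field 1 u" by (rule poly_field_C1[OF u])
  define I where "I i = cell_int C (\<lambda>x. u x $ i * u x $ i)" for i
  have I0: "I i \<ge> 0" for i unfolding I_def by (rule cell_int_nonneg) simp
  have "C \<noteq> {}" using C by (auto simp: tet_def)
  then obtain b where b: "b \<in> C" by blast
  have G0: "G \<ge> 0" using G[OF b] norm_ge_zero order_trans by blast
  define d where "d = (\<lambda>e. \<Sum>j\<in>UNIV. e $ j *\<^sub>R partial_deriv j u x)"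
  have du: "(u has_derivative d) (at x)" unfolding d_def by (rule C1_has_derivative[OF C1])
  have lin: "linear d" by (rule has_derivative_linear[OF du])
  have "(partial_deriv j u x $ i)\<^sup>2 \<le> 16 * G\<^sup>2 * \<kappa> * I i" for i j
  proof -
    have dc: "((\<lambda>x. u x $ i) has_derivative (\<lambda>h. d h $ i)) (at x)"
      by (rule bounded_linear.has_derivative[OF bounded_linear_vec_nth du])
    define e :: "real^3" where "e = axis j 1"
    have "e = (\<Sum>c\<in>C. (grad C c \<bullet> e) *\<^sub>R (c - b))"
      using grad_comb[OF C, of e] grad_sum[OF C, of e]
      by (simp add: scaleR_diff_right sum_subtractf scaleR_sum_left[symmetric])
    then have "d e = d (\<Sum>c\<in>C. (grad C c \<bullet> e) *\<^sub>R (c - b))" by (rule arg_cong)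
    moreover have "d e = partial_deriv j u x"
      unfolding d_def e_def by (simp add: axis_def if_distrib[of "\<lambda>r. r *\<^sub>R _"] cong: if_cong)
    ultimately have "partial_deriv j u x = (\<Sum>c\<in>C. (grad C c \<bullet> e) *\<^sub>R d (c - b))"
      by (simp add: linear_sum[OF lin] linear_scale[OF lin])
    then have pe: "partial_deriv j u x $ i = (\<Sum>c\<in>C. (grad C c \<bullet> e) * d (c - b) $ i)"
      by (simp add: sum_component)
    have "\<bar>(grad C c \<bullet> e) * d (c - b) $ i\<bar> \<le> G * sqrt (\<kappa> * I i)" if c: "c \<in> C" for c
    proof -
      have "\<bar>grad C c \<bullet> e\<bar> \<le> norm (grad C c) * norm e" by (rule Cauchy_Schwarz_ineq2)
      then have "\<bar>grad C c \<bullet> e\<bar> \<le> G" using G[OF c] by (simp add: e_def)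
      moreover have "(d (c - b) $ i)\<^sup>2 \<le> \<kappa> * I i"
        using poly_bound_derivative[OF pb u c b x dc] by (simp add: I_def)
      then have "\<bar>d (c - b) $ i\<bar> \<le> sqrt (\<kappa> * I i)" by (metis real_sqrt_abs real_sqrt_le_iff)
      ultimately show ?thesis unfolding abs_mult using G0 by (intro mult_mono) auto
    qed
    then have "(\<Sum>c\<in>C. \<bar>(grad C c \<bullet> e) * d (c - b) $ i\<bar>) \<le> card C * (G * sqrt (\<kappa> * I i))"
      by (rule sum_bounded_above)
    also have "\<dots> = 4 * (G * sqrt (\<kappa> * I i))" using C by (simp add: tet_def)
    finally have "\<bar>partial_deriv j u x $ i\<bar> \<le> 4 * (G * sqrt (\<kappa> * I i))"
      unfolding pe by (rule order_trans[OF sum_abs])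
    then have "\<bar>partial_deriv j u x $ i\<bar>\<^sup>2 \<le> (4 * (G * sqrt (\<kappa> * I i)))\<^sup>2" by (intro power_mono) auto
    also have "\<dots> = 16 * G\<^sup>2 * \<kappa> * I i" using k I0[of i] by (simp add: power_mult_distrib)
    finally show ?thesis by simp
  qed
  then have p: "(partial_deriv j u x $ i)\<^sup>2 \<le> 16 * (G\<^sup>2 * \<kappa>) * I i" for i j by (simp add: mult.assoc)
  have sq: "(s - t)\<^sup>2 \<le> 2 * s\<^sup>2 + 2 * t\<^sup>2" for s t :: real
    using zero_le_power2[of "s + t"] by (simp add: power2_diff power2_sum)
  have "(norm (classical_curl u x))\<^sup>2 =
     (partial_deriv 2 u x $ 3 - partial_deriv 3 u x $ 2)\<^sup>2 + (partial_deriv 3 u x $ 1 - partial_deriv 1 u x $ 3)\<^sup>2 + (partial_deriv 1 u x $ 2 - partial_deriv 2 u x $ 1)\<^sup>2"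
    by (simp add: norm_square_vec3 classical_curl_def)
  also have "\<dots> \<le> 2 * (16 * (G\<^sup>2 * \<kappa>) * I 3) + 2 * (16 * (G\<^sup>2 * \<kappa>) * I 2) + (2 * (16 * (G\<^sup>2 * \<kappa>) * I 1) + 2 * (16 * (G\<^sup>2 * \<kappa>) * I 3)) + (2 * (16 * (G\<^sup>2 * \<kappa>) * I 2) + 2 * (16 * (G\<^sup>2 * \<kappa>) * I 1))"
    using sq[of "partial_deriv 2 u x $ 3" "partial_deriv 3 u x $ 2"] sq[of "partial_deriv 3 u x $ 1" "partial_deriv 1 u x $ 3"]
      sq[of "partial_deriv 1 u x $ 2" "partial_deriv 2 u x $ 1"]
      p[where i = 3 and j = 2] p[where i = 2 and j = 3] p[where i = 1 and j = 3] p[where i = 3 and j = 1] p[where i = 2 and j = 1] p[where i = 1 and j = 2]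
    by linarith
  also have "\<dots> = 64 * (G\<^sup>2 * \<kappa>) * (I 1 + I 2 + I 3)" by (simp add: algebra_simps)
  finally show ?thesis
    unfolding cell_int_norm_square[OF C C1_continuous[OF C1]] I_def by (simp only: mult_ac)
qed

text \<open>The formula for the cut is used with \<open>t = u x\<close>. The projected point stays
  in the hull, the mass is at most 1, and at most four vertices contribute, each with a gradient
  bounded by \<open>G\<close> and a vector \<open>c - z\<close> no longer than \<open>h\<close>; one
  factor \<open>norm (u x)\<close> cancels. At interior points the mass is positive as soon as some
  vertex is in \<open>A\<close>.\<close>

lemma cut_bound:
  assumes C: "tet C" and cut: "is_cut m C A v u"
    and G: "\<And>c. c \<in> C \<Longrightarrow> norm (grad C c) \<le> G" and h: "\<And>a b. a \<in> C \<Longrightarrow> b \<in> C \<Longrightarrow> norm (a - b) \<le> h"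
    and M: "\<And>z. z \<in> convex hull C \<Longrightarrow> norm (v z) \<le> M" and x: "x \<in> interior (convex hull C)"
  shows "norm (u x) \<le> 4 * G * h * M"
proof -
  have "C \<noteq> {}" using C by (auto simp: tet_def)
  then obtain b where b: "b \<in> C" by blast
  have G0: "G \<ge> 0" using G[OF b] norm_ge_zero order_trans by blast
  have h0: "h \<ge> 0" using h[OF b b] by simp
  have xC: "x \<in> convex hull C" using x interior_subset by blast
  have M0: "M \<ge> 0" using M[OF xC] norm_ge_zero order_trans by blast
  show ?thesis
  proof (cases "C \<inter> A = {}")
    case True
    then show ?thesis using cut_empty[OF cut] G0 h0 M0 by simp
  next
    case False
    have fin: "finite C" by (rule tet_finite[OF C])
    have pos: "bary C c x > 0" if "c \<in> C" for c using interior_not_face[OF C that x] .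
    define s where "s = cut_mass C A x"
    have s: "0 < s" "s \<le> 1"
    proof -
      show "0 < s" unfolding s_def cut_mass_def using fin False pos by (intro sum_pos) auto
      have "s \<le> (\<Sum>c\<in>C. bary C c x)" unfolding s_def cut_mass_def
        using fin pos by (intro sum_mono2) (auto intro: less_imp_le)
      then show "s \<le> 1" using bary_sum[OF C] by simp
    qed
    define z where "z = inverse s *\<^sub>R cut_moment C A x"
    have "z = (\<Sum>c\<in>C \<inter> A. (bary C c x / s) *\<^sub>R c)"
      by (simp add: z_def cut_moment_def scaleR_sum_right divide_inverse mult.commute)
    moreover have "(\<Sum>c\<in>C \<inter> A. bary C c x / s) = 1"
      using s by (simp add: sum_divide_distrib[symmetric] s_def cut_mass_def)
    moreover have "finite (C \<inter> A)" using fin by simp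
    moreover have "0 \<le> bary C c x / s" if "c \<in> C \<inter> A" for c
      using pos[of c] that s(1) by (intro divide_nonneg_pos less_imp_le) auto
    ultimately have "z \<in> convex hull (C \<inter> A)"
      unfolding convex_hull_finite[OF \<open>finite (C \<inter> A)\<close>] by (intro CollectI exI[of _ "\<lambda>c. bary C c x / s"]) auto
    then have zC: "z \<in> convex hull C" using hull_mono[of "C \<inter> A" C] by blast
    have cz: "norm (c - z) \<le> h" if c: "c \<in> C" for c
    proof -
      have "C \<subseteq> cball c h" using h[OF c] by (auto simp: dist_norm)
      then have "convex hull C \<subseteq> cball c h" by (rule hull_minimal) simp
      then show ?thesis using zC by (auto simp: dist_norm)
    qed
    have "\<forall>x t. cut_mass C A x \<noteq> 0 \<longrightarrow>
       u x \<bullet> t = cut_mass C A x ^ Suc m * (v (inverse (cut_mass C A x) *\<^sub>R cut_moment C A x) \<bullet>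
         (\<Sum>c\<in>C \<inter> A. (grad C c \<bullet> t) *\<^sub>R (c - inverse (cut_mass C A x) *\<^sub>R cut_moment C A x)))"
      using cut unfolding is_cut_def by blast
    from this[rule_format, of x "u x"] s(1)
    have "u x \<bullet> u x = s ^ Suc m * (v z \<bullet> (\<Sum>c\<in>C \<inter> A. (grad C c \<bullet> u x) *\<^sub>R (c - z)))"
      unfolding z_def s_def by simp
    also have "\<dots> \<le> 1 * (norm (v z) * norm (\<Sum>c\<in>C \<inter> A. (grad C c \<bullet> u x) *\<^sub>R (c - z)))"
    proof -
      have "s ^ Suc m * (v z \<bullet> y) \<le> s ^ Suc m * (norm (v z) * norm y)" for y
        using s(1) norm_cauchy_schwarz by (intro mult_left_mono) auto
      also have "s ^ Suc m * (norm (v z) * norm y) \<le> 1 * (norm (v z) * norm y)" for y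
        using s power_le_one[of s "Suc m"] by (intro mult_right_mono) auto
      finally show ?thesis .
    qed
    also have "norm (\<Sum>c\<in>C \<inter> A. (grad C c \<bullet> u x) *\<^sub>R (c - z)) \<le> (\<Sum>c\<in>C \<inter> A. G * norm (u x) * h)"
    proof (rule sum_norm_le)
      fix c assume c: "c \<in> C \<inter> A"
      have "\<bar>grad C c \<bullet> u x\<bar> \<le> norm (grad C c) * norm (u x)" by (rule Cauchy_Schwarz_ineq2)
      also have "\<dots> \<le> G * norm (u x)" using G c by (intro mult_right_mono) auto
      finally show "norm ((grad C c \<bullet> u x) *\<^sub>R (c - z)) \<le> G * norm (u x) * h"
        using cz[of c] c G0 by (simp add: mult_mono)
    qed
    also have "(\<Sum>c\<in>C \<inter> A. G * norm (u x) * h) \<le> 4 * (G * norm (u x) * h)"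
    proof -
      have "card (C \<inter> A) \<le> 4" using card_mono[OF fin, of "C \<inter> A"] C by (simp add: tet_def)
      then show ?thesis using G0 h0 by (simp add: mult_right_mono)
    qed
    finally have "u x \<bullet> u x \<le> norm (v z) * (4 * (G * norm (u x) * h))"
      by (simp add: mult_left_mono)
    also have "\<dots> \<le> M * (4 * (G * norm (u x) * h))"
      using M[OF zC] G0 h0 by (intro mult_right_mono) auto
    finally have "norm (u x) * norm (u x) \<le> (4 * G * h * M) * norm (u x)"
      by (simp add: power2_norm_eq_inner[symmetric] power2_eq_square mult_ac)
    then show ?thesis
      using G0 h0 M0 by (cases "norm (u x) = 0") (auto simp: mult_le_cancel_right)
  qed
qed

text \<open>\<open>curl_bound\<close> for the cut is combined with \<open>cut_bound\<close> and
  \<open>value_bound\<close> for \<open>v\<close>, and \<open>1024 = 64 * 16\<close>. Each use of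
  \<open>poly_bound\<close> brings one reciprocal volume, which integrating a constant over the
  element removes. As \<open>G * h\<close> measures only the shape, the curl costs
  \<open>G\<^sup>2\<close>, of order \<open>h^-2\<close>.\<close>

lemma cut_stability:
  "\<exists>K>0. \<forall>C A v u G h. tet C \<longrightarrow> v \<in> local_nedelec m \<longrightarrow> is_cut m C A v u \<longrightarrow>
     (\<forall>c\<in>C. norm (grad C c) \<le> G) \<longrightarrow> (\<forall>a\<in>C. \<forall>b\<in>C. norm (a - b) \<le> h) \<longrightarrow>
     cell_int C (\<lambda>x. (norm (classical_curl u x))\<^sup>2) \<le> K * G\<^sup>2 * (G * h)\<^sup>2 * cell_int C (\<lambda>x. (norm (v x))\<^sup>2)"
proof -
  obtain K where K: "K > 0" "\<And>D. tet D \<Longrightarrow> poly_bound (Suc m) D (K / measure lborel (convex hull D))"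
    using uniform_poly_bound[of "Suc m"] by blast
  have "cell_int C (\<lambda>x. (norm (classical_curl u x))\<^sup>2) \<le> (1024 * K * K) * G\<^sup>2 * (G * h)\<^sup>2 * cell_int C (\<lambda>x. (norm (v x))\<^sup>2)"
    if C: "tet C" and v: "v \<in> local_nedelec m" and cut: "is_cut m C A v u"
      and G: "\<forall>c\<in>C. norm (grad C c) \<le> G" and h: "\<forall>a\<in>C. \<forall>b\<in>C. norm (a - b) \<le> h" for C A v u G h
  proof -
    define V where "V = measure lborel (convex hull C)"
    have V: "V > 0" unfolding V_def by (rule tet_volume_pos[OF C])
    define \<kappa> where "\<kappa> = K / V"
    have k: "\<kappa> > 0" using K V by (simp add: \<kappa>_def)
    have pb: "poly_bound (Suc m) C \<kappa>" using K(2)[OF C] by (simp add: \<kappa>_def V_def)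
    have u: "u \<in> local_nedelec m" using cut by (simp add: is_cut_def)
    note vp = local_nedelec_component[OF v] and up = local_nedelec_component[OF u]
    have uc: "continuous_on UNIV u" by (rule C1_continuous[OF poly_field_C1[OF up]])
    define Iv where "Iv = cell_int C (\<lambda>x. (norm (v x))\<^sup>2)"
    define Iu where "Iu = cell_int C (\<lambda>x. (norm (u x))\<^sup>2)"
    have Iv0: "Iv \<ge> 0" unfolding Iv_def by (rule cell_int_nonneg) simp
    define M where "M = sqrt (\<kappa> * Iv)"
    have M: "norm (v z) \<le> M" if "z \<in> convex hull C" for z
      using value_bound[OF C pb vp that] unfolding M_def Iv_def by (rule real_le_rsqrt)
    have "(norm (u x))\<^sup>2 \<le> 16 * (G * h)\<^sup>2 * (\<kappa> * Iv)" if x: "x \<in> interior (convex hull C)" for x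
    proof -
      have "norm (u x) \<le> 4 * G * h * M"
        by (rule cut_bound[OF C cut _ _ M x]) (use G h in auto)
      then have "(norm (u x))\<^sup>2 \<le> (4 * G * h * M)\<^sup>2" by (intro power_mono) auto
      also have "\<dots> = 16 * (G * h)\<^sup>2 * (\<kappa> * Iv)" using k Iv0 by (simp add: M_def power_mult_distrib)
      finally show ?thesis .
    qed
    then have "Iu \<le> cell_int C (\<lambda>x. 16 * (G * h)\<^sup>2 * (\<kappa> * Iv))"
      unfolding Iu_def by (intro cell_int_mono C continuous_intros uc)
    also have "\<dots> = 16 * (G * h)\<^sup>2 * K * Iv" using V by (simp add: cell_int_const[OF C] \<kappa>_def V_def)
    finally have 1: "Iu \<le> 16 * (G * h)\<^sup>2 * K * Iv" .
    have "cell_int C (\<lambda>x. (norm (classical_curl u x))\<^sup>2) \<le> cell_int C (\<lambda>x. 64 * G\<^sup>2 * \<kappa> * Iu)"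
      unfolding Iu_def using k G
      by (intro cell_int_mono C continuous_intros C1_curl_continuous poly_field_C1[OF up] curl_bound[OF C pb _ up]) auto
    also have "\<dots> = 64 * G\<^sup>2 * K * Iu" using V by (simp add: cell_int_const[OF C] \<kappa>_def V_def)
    also have "\<dots> \<le> 64 * G\<^sup>2 * K * (16 * (G * h)\<^sup>2 * K * Iv)"
      using 1 K(1) by (intro mult_left_mono) auto
    finally show ?thesis unfolding Iv_def by (simp add: mult_ac)
  qed
  moreover have "1024 * K * K > 0" using K(1) by simp
  ultimately show ?thesis by blast
qed

section \<open>Geometry of the layers\<close>

text \<open>Across an inscribed ball of radius \<open>r\<close> the coordinate grows by
  \<open>2 * r * g\<close> in gradient direction while staying between 0 and 1, so the gradient is
  at most the reciprocal inball diameter; shape regularity and quasi-uniformity relate this to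
  \<open>H\<close>. The absolute values are there because \<open>\<sigma>\<close> and
  \<open>\<tau>\<close> come without a sign.\<close>

lemma grad_bound:
  assumes C: "tet C" and c: "c \<in> C" and sr: "diameter (convex hull C) \<le> \<sigma> * inball_diameter (convex hull C)"
    and qu: "H \<le> \<tau> * diameter (convex hull C)" and H: "0 < H" "diameter (convex hull C) \<le> H"
  shows "norm (grad C c) \<le> \<bar>\<tau> * \<sigma>\<bar> / H"
proof -
  let ?T = "convex hull C"
  define g where "g = norm (grad C c)"
  have g: "g > 0" using grad_nonzero[OF C c] by (simp add: g_def)
  have ball: "2 * r \<le> 1 / g" if r: "0 \<le> r" "cball x r \<subseteq> ?T" for r x
  proof -
    define y where "y = (r / g) *\<^sub>R grad C c"
    have "norm y = r" using r g by (simp add: y_def g_def)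
    then have "x + y \<in> ?T" "x - y \<in> ?T" using r by (auto simp: subset_iff dist_norm)
    have le1: "bary C c z \<le> 1" if "z \<in> ?T" for z
    proof -
      have "bary C c z \<le> (\<Sum>a\<in>C. bary C a z)"
        using that c tet_finite[OF C] by (intro member_le_sum) (auto simp: tet_hull[OF C])
      then show ?thesis using bary_sum[OF C] by simp
    qed
    have "bary C c (x + y) - bary C c (x - y) = grad C c \<bullet> ((x + y) - (x - y))" by (rule bary_diff[OF C c])
    also have "\<dots> = 2 * (grad C c \<bullet> y)" unfolding inner_diff_right inner_add_right by simp
    also have "\<dots> = 2 * r * g" using g by (simp add: y_def g_def power2_norm_eq_inner[symmetric] power2_eq_square)
    finally have "2 * r * g \<le> 1"
      using le1[OF \<open>x + y \<in> ?T\<close>] \<open>x - y \<in> ?T\<close> c by (auto simp: tet_hull[OF C])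
    then show ?thesis using g by (simp add: field_simps)
  qed
  have Cne: "C \<noteq> {}" using C by (auto simp: tet_def)
  then obtain b where b: "b \<in> ?T" using hull_inc by fastforce
  define S where "S = {2 * r | r. 0 \<le> r \<and> (\<exists>x. cball x r \<subseteq> ?T)}"
  have S0: "0 \<in> S" unfolding S_def using b by (intro CollectI exI[of _ 0]) auto
  have Sle: "s \<le> 1 / g" if "s \<in> S" for s using that ball by (auto simp: S_def)
  have in1: "inball_diameter ?T \<le> 1 / g"
    unfolding inball_diameter_def S_def[symmetric] using S0 Sle by (intro cSup_least) auto
  have in0: "0 \<le> inball_diameter ?T"
    unfolding inball_diameter_def S_def[symmetric] using S0 Sle by (intro cSup_upper) (auto simp: bdd_above_def)
  have "diameter ?T \<ge> 0" by (rule diameter_ge_0) (intro compact_imp_bounded tet_hull_compact C)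
  have "diameter ?T > 0"
  proof (rule ccontr)
    assume "\<not> diameter ?T > 0"
    then have "diameter ?T = 0" using \<open>diameter ?T \<ge> 0\<close> by simp
    then show False using qu H by simp
  qed
  have "diameter ?T \<le> \<bar>\<sigma>\<bar> * inball_diameter ?T"
    using sr in0 by (meson abs_ge_self mult_right_mono order_trans)
  also have "\<dots> \<le> \<bar>\<sigma>\<bar> * (1 / g)" using in1 by (intro mult_left_mono) auto
  finally have d: "diameter ?T \<le> \<bar>\<sigma>\<bar> * (1 / g)" .
  have "H \<le> \<bar>\<tau>\<bar> * diameter ?T"
    using qu \<open>diameter ?T \<ge> 0\<close> by (meson abs_ge_self mult_right_mono order_trans)
  also have "\<dots> \<le> \<bar>\<tau>\<bar> * (\<bar>\<sigma>\<bar> * (1 / g))" using d by (intro mult_left_mono) auto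
  finally have "H * g \<le> \<bar>\<tau> * \<sigma>\<bar>" using g by (simp add: abs_mult field_simps)
  then show ?thesis using H(1) by (simp add: g_def field_simps)
qed

text \<open>The segment from \<open>x\<close> to \<open>y\<close> meets the frontier of
  \<open>A\<close> in a point \<open>p\<close>, which lies in \<open>B\<close> because the closure
  does; the remaining piece from \<open>p\<close> to \<open>y\<close> must therefore meet the
  frontier of \<open>B\<close>.\<close>

lemma frontier_dist:
  fixes A B :: "'a::euclidean_space set"
  assumes cc: "closure A \<subseteq> B" and x: "x \<in> A" and y: "y \<notin> B"
  shows "setdist (frontier A) (frontier B) \<le> dist x y"
proof -
  have "A \<subseteq> B" using cc closure_subset by blast
  have "closed_segment x y \<inter> frontier A \<noteq> {}"
    by (rule connected_Int_frontier) (use x y \<open>A \<subseteq> B\<close> in auto)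
  then obtain p where p: "p \<in> closed_segment x y" "p \<in> frontier A" by blast
  then have "p \<in> B" using cc by (auto simp: frontier_def)
  have "closed_segment p y \<inter> frontier B \<noteq> {}"
    by (rule connected_Int_frontier) (use \<open>p \<in> B\<close> y in auto)
  then obtain q where q: "q \<in> closed_segment p y" "q \<in> frontier B" by blast
  have "setdist (frontier A) (frontier B) \<le> dist p q" using p q by (intro setdist_le_dist)
  also have "\<dots> \<le> dist p y" using dist_in_closed_segment[OF q(1)] by (simp add: dist_commute)
  also have "\<dots> \<le> dist x y" using dist_in_closed_segment[OF p(1)] by (simp add: dist_commute)
  finally show ?thesis .
qed

text \<open>This keeps the layers around the inner subdomain inside the outer one.\<close>

lemma infdist_less_imp_in:
  fixes A B :: "'a::euclidean_space set"
  assumes cc: "closure A \<subseteq> B" and A: "A \<noteq> {}" and y: "infdist y A < setdist (frontier A) (frontier B)"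
  shows "y \<in> B"
proof (rule ccontr)
  assume yB: "y \<notin> B"
  have "setdist (frontier A) (frontier B) \<le> dist y x" if "x \<in> A" for x
    using frontier_dist[OF cc that yB] by (simp add: dist_commute)
  then have "setdist (frontier A) (frontier B) \<le> infdist y A"
    unfolding infdist_notempty[OF A] using A by (intro cINF_greatest) auto
  then show False using y by simp
qed

text \<open>The optimal choice is \<open>t = E / P\<close>. For \<open>P = 0\<close> and
  \<open>E > 0\<close> the choice \<open>t = (Q + 1) / E\<close> leads to
  \<open>2 * E \<le> E\<close>, a contradiction. The lemma takes the place of a Cauchy-Schwarz
  inequality for sums of integrals.\<close>

lemma square_le_of_young:
  fixes E P Q :: real
  assumes E: "E \<ge> 0" and P: "P \<ge> 0" and Q: "Q \<ge> 0" and y: "\<And>t. t > 0 \<Longrightarrow> 2 * E \<le> t * P + Q / t"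
  shows "E\<^sup>2 \<le> P * Q"
proof (cases "E = 0")
  case True
  then show ?thesis using P Q by simp
next
  case False
  then have E0: "E > 0" using E by simp
  show ?thesis
  proof (cases "P = 0")
    case True
    have "2 * E \<le> Q / ((Q + 1) / E)" using y[of "(Q + 1) / E"] True E0 Q by simp
    also have "\<dots> = E * (Q / (Q + 1))" by simp
    also have "\<dots> \<le> E * 1" using E0 Q by (intro mult_left_mono) auto
    finally show ?thesis using E0 by simp
  next
    case False
    then have P0: "P > 0" using P by simp
    have "2 * E \<le> (E / P) * P + Q / (E / P)" using E0 P0 by (intro y) simp
    then have "E \<le> Q * P / E" using P0 by simp
    then show ?thesis using E0 by (simp add: pos_le_divide_eq power2_eq_square mult.commute)
  qed
qed

lemma inner_young:
  fixes a b :: "'a::real_inner" and t :: real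
  assumes "t > 0"
  shows "- 2 * (a \<bullet> b) \<le> t * (norm a)\<^sup>2 + (norm b)\<^sup>2 / t"
proof -
  have "0 \<le> (t *\<^sub>R a + b) \<bullet> (t *\<^sub>R a + b)" by simp
  also have "\<dots> = t * t * (a \<bullet> a) + 2 * t * (a \<bullet> b) + b \<bullet> b"
    by (simp add: inner_add_left inner_add_right inner_commute[of b a] algebra_simps)
  finally have "0 \<le> (t * t * (a \<bullet> a) + 2 * t * (a \<bullet> b) + b \<bullet> b) / t" using assms by simp
  also have "\<dots> = t * (a \<bullet> a) + 2 * (a \<bullet> b) + (b \<bullet> b) / t" using assms by (simp add: add_divide_distrib)
  finally show ?thesis by (simp add: power2_norm_eq_inner)
qed

section \<open>Layers of elements and the Caccioppoli inequality\<close>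

context tet_mesh
begin

text \<open>\<open>Suc j\<close> and not \<open>j\<close>: layer 0 already reaches one mesh width
  beyond \<open>D\<close>, so that every element meeting \<open>D\<close> has all its vertices in
  it.\<close>

definition layer :: "(real^3) set \<Rightarrow> nat \<Rightarrow> (real^3) set" where
  "layer D j = {a. infdist a D \<le> real (Suc j) * mesh_width \<T>}"

definition core :: "(real^3) set \<Rightarrow> nat \<Rightarrow> (real^3) set set" where
  "core D j = {C \<in> cells. C \<subseteq> layer D j}"

lemma cell_diameter:
  assumes C: "C \<in> cells" and x: "x \<in> convex hull C" and y: "y \<in> convex hull C"
  shows "dist x y \<le> mesh_width \<T>"
proof -
  have "dist x y \<le> diameter (convex hull C)"
    by (rule diameter_bounded_bound[OF compact_imp_bounded[OF tet_hull_compact[OF cell_tet[OF C]]] x y])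
  also have "\<dots> \<le> mesh_width \<T>"
    unfolding mesh_width_def using C tri by (intro Max_ge) (auto simp: triangulation_def mesh_tets_def)
  finally show ?thesis .
qed

lemma core_mono: "core D j \<subseteq> core D (Suc j)"
proof
  fix C assume C: "C \<in> core D j"
  then have "C \<in> cells" by (simp add: core_def)
  then obtain a where "a \<in> C" using cell_tet[of C] by (force simp: tet_def)
  then have "a \<in> convex hull C" by (rule hull_inc)
  then have "mesh_width \<T> \<ge> 0" using cell_diameter[OF \<open>C \<in> cells\<close>, of a a] by simp
  then have "real (Suc j) * mesh_width \<T> \<le> real (Suc (Suc j)) * mesh_width \<T>" by (intro mult_right_mono) auto
  then have "layer D j \<subseteq> layer D (Suc j)" unfolding layer_def by (intro Collect_mono impI) (rule order_trans)
  then show "C \<in> core D (Suc j)" using C by (auto simp: core_def)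
qed

lemma touching_in_core:
  assumes C: "C \<in> cells" and A: "C \<inter> layer D j \<noteq> {}"
  shows "C \<in> core D (Suc j)"
proof -
  obtain a where a: "a \<in> C" "infdist a D \<le> real (Suc j) * mesh_width \<T>" using A by (auto simp: layer_def)
  have "infdist b D \<le> real (Suc (Suc j)) * mesh_width \<T>" if b: "b \<in> C" for b
    using infdist_triangle[of b D a] a(2) cell_diameter[OF C, of b a] a(1) b
    by (simp add: hull_inc distrib_right)
  then show ?thesis using C by (auto simp: core_def layer_def)
qed

text \<open>One mesh width more than for the vertices: \<open>D\<close> need not be convex, so the
  distance at points of an element is not controlled by its maximum over the vertices.\<close>

lemma core_infdist:
  assumes C: "C \<in> core D j" and x: "x \<in> convex hull C"
  shows "infdist x D \<le> real (j + 2) * mesh_width \<T>"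
proof -
  have C': "C \<in> cells" "C \<subseteq> layer D j" using C by (auto simp: core_def)
  then obtain a where a: "a \<in> C" using cell_tet[of C] by (force simp: tet_def)
  then have "infdist a D \<le> real (Suc j) * mesh_width \<T>" using C' by (auto simp: layer_def)
  then show ?thesis
    using infdist_triangle[of x D a] cell_diameter[OF C'(1) x hull_inc[OF a]] by (simp add: algebra_simps)
qed

lemma touching_in_core_0:
  assumes C: "C \<in> cells" and x: "x \<in> convex hull C" "x \<in> D"
  shows "C \<in> core D 0"
proof -
  have "infdist a D \<le> mesh_width \<T>" if "a \<in> C" for a
    using infdist_le[OF x(2), of a] cell_diameter[OF C hull_inc[OF that] x(1)] by simp
  then show ?thesis using C by (auto simp: core_def layer_def)
qed

text \<open>\<open>inside\<close> makes the cut zero on every element that leaves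
  \<open>\<Omega>\<close>, which settles the trace condition and all faces not contained in
  \<open>\<Omega>\<close>, since the elements at such a face leave \<open>\<Omega>\<close> as well.
  On the other faces \<open>\<xi>\<close> has zero jump at points of the relative interior, by
  continuity on the whole face, and \<open>cut_jump_zero\<close> passes this on to the cut.\<close>

lemma cut_test_field:
  assumes w: "has_weak_curl \<Omega> \<xi> w" and v: "\<And>C. C \<in> cells \<Longrightarrow> v C \<in> local_nedelec m"
    and eq: "\<And>C. C \<in> cells \<Longrightarrow> AE x in lebesgue. x \<in> convex hull C \<longrightarrow> x \<in> \<Omega> \<longrightarrow> \<xi> x = v C x"
    and cut: "\<And>C. C \<in> cells \<Longrightarrow> is_cut m C A (v C) (u C)"
    and inside: "\<And>C. C \<in> cells \<Longrightarrow> C \<inter> A \<noteq> {} \<Longrightarrow> convex hull C \<subseteq> \<Omega>"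
    and m: "m = k - 1"
  shows "glue cells u \<in> nedelec0 \<Omega> k \<T>"
    and "AE x in lebesgue. \<forall>C\<in>cells. x \<in> convex hull C \<longrightarrow> x \<in> \<Omega> \<longrightarrow> weak_curl \<Omega> (glue cells u) x = classical_curl (u C) x"
proof -
  have ul: "u C \<in> local_nedelec m" if "C \<in> cells" for C using cut[OF that] by (simp add: is_cut_def)
  have uC1: "Ck_field 1 (u C)" if "C \<in> cells" for C
    by (rule poly_field_C1[OF local_nedelec_component[OF ul[OF that]]])
  have vC1: "Ck_field 1 (v C)" if "C \<in> cells" for C
    by (rule poly_field_C1[OF local_nedelec_component[OF v[OF that]]])
  have out: "u C = (\<lambda>x. 0)" if "C \<in> cells" "\<not> convex hull C \<subseteq> \<Omega>" for C
    using cut_empty[OF cut[OF that(1)]] inside[OF that(1)] that(2) by blast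
  have J: "jump cells u B x = 0" if B: "B \<in> mesh_faces cells" and x: "x \<in> convex hull B" for B x
  proof (cases "convex hull B \<subseteq> \<Omega>")
    case True
    have cB: "card B = 3" by (rule mesh_face_card[OF B cell_tet])
    then have fB: "finite B" "B \<noteq> {}" by (auto intro: card_ge_0_finite)
    have "jump cells v B y = 0" if y: "y \<in> convex hull B" for y
    proof (rule zero_on_face_closure[OF jump_continuous[OF finite_cells cell_tet C1_continuous[OF vC1]] fB _ y])
      fix t :: "real^3 \<Rightarrow> real" assume t: "sum t B = 1" "\<And>b. b \<in> B \<Longrightarrow> t b > 0"
      have "(\<Sum>b\<in>B. t b *\<^sub>R b) \<in> convex hull B"
        unfolding convex_hull_finite[OF fB(1)] using t by (auto intro!: exI[of _ t] less_imp_le)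
      then show "jump cells v B (\<Sum>b\<in>B. t b *\<^sub>R b) = 0"
        using True by (intro jump_zero_inside[OF w vC1 eq B _ t(1) refl t(2)]) auto
    qed
    then show ?thesis
      by (intro cut_jump_zero[OF finite_cells cell_tet B cut C1_continuous[OF uC1] _ x]) auto
  next
    case False
    have "u C = (\<lambda>x. 0)" if "C \<in> cells" "C - {a} = B" for C a
    proof (rule out[OF that(1)])
      have "convex hull B \<subseteq> convex hull C" using that(2) by (intro hull_mono) auto
      then show "\<not> convex hull C \<subseteq> \<Omega>" using False by blast
    qed
    then show ?thesis unfolding jump_def by (intro sum.neutral) auto
  qed
  note glued = glued_field[of u, OF uC1 out J]
  show "AE x in lebesgue. \<forall>C\<in>cells. x \<in> convex hull C \<longrightarrow> x \<in> \<Omega> \<longrightarrow> weak_curl \<Omega> (glue cells u) x = classical_curl (u C) x"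
    using glued(3) .
  have "\<exists>p\<in>poly_fields (k - 1). \<exists>q\<in>poly_fields (k - 1). AE x in lebesgue_on T. glue cells u x = p x + cross3 x (q x)"
    if T: "T \<in> \<T>" for T
  proof -
    obtain C where C: "C \<in> cells" "T = convex hull C" using T cells_hull by blast
    obtain p q where pq: "p \<in> poly_fields m" "q \<in> poly_fields m" "u C = (\<lambda>x. p x + cross3 x (q x))"
      using ul[OF C(1)] unfolding local_nedelec_def by blast
    have "AE x in lebesgue. x \<in> T \<longrightarrow> glue cells u x = p x + cross3 x (q x)"
      using glue_AE[OF tri, of u] by eventually_elim (use C pq(3) in auto)
    then have "AE x in lebesgue_on T. glue cells u x = p x + cross3 x (q x)"
      using tet_hull_lebesgue[OF cell_tet[OF C(1)]] C(2) by (subst AE_restrict_space_iff) auto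
    then show ?thesis using pq(1,2) unfolding m by blast
  qed
  moreover have "glue cells u \<in> Hcurl \<Omega>" using glued(2) by (simp add: Hcurl0_def)
  ultimately show "glue cells u \<in> nedelec0 \<Omega> k \<T>"
    using glued(2) by (simp add: nedelec0_def nedelec_def)
qed

text \<open>\<open>\<kappa>\<close> is the cost of one cut and is kept abstract here; its size
  \<open>h^-2\<close> enters only in the theorem. \<open>N\<close> counts the layers that fit
  between \<open>D\<close> and \<open>D'\<close>, the two extra mesh widths being those of
  \<open>core_infdist\<close>.\<close>

lemma caccioppoli:
  assumes k: "k \<ge> 1" and \<xi>: "\<xi> \<in> nedelec \<Omega> k \<T>"
    and orth: "\<And>\<psi>. \<psi> \<in> nedelec0 \<Omega> k \<T> \<Longrightarrow> L2_inner \<Omega> (weak_curl \<Omega> \<xi>) (weak_curl \<Omega> \<psi>) = 0"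
    and D: "open D" "D \<noteq> {}" "closure D \<subseteq> D'" "open D'" "D' \<subseteq> \<Omega>"
    and N: "real (N + 2) * mesh_width \<T> < setdist (frontier D) (frontier D')"
    and \<kappa>: "\<kappa> \<ge> 0" and stable: "\<And>C A v u. C \<in> cells \<Longrightarrow> v \<in> local_nedelec (k - 1) \<Longrightarrow> is_cut (k - 1) C A v u \<Longrightarrow>
      cell_int C (\<lambda>x. (norm (classical_curl u x))\<^sup>2) \<le> \<kappa> * cell_int C (\<lambda>x. (norm (v x))\<^sup>2)"
  shows "(L2_norm D (weak_curl \<Omega> \<xi>))\<^sup>2 * (real N)\<^sup>2 \<le> 8 * \<kappa> * (L2_norm D' \<xi>)\<^sup>2"
proof -
  define m where "m = k - 1"
  define w where "w = weak_curl \<Omega> \<xi>"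
  have DO: "D \<subseteq> \<Omega>" using D closure_subset by blast
  obtain w0 where w0: "has_weak_curl \<Omega> \<xi> w0" using \<xi> by (auto simp: nedelec_def Hcurl_def)
  have wc: "has_weak_curl \<Omega> \<xi> w"
    unfolding w_def weak_curl_def using w0 by (rule someI[of "has_weak_curl \<Omega> \<xi>"])
  have "\<exists>v. v \<in> local_nedelec m \<and> (AE x in lebesgue. x \<in> convex hull C \<longrightarrow> \<xi> x = v x)" if C: "C \<in> cells" for C
  proof -
    have "convex hull C \<in> \<T>" using C by (simp add: mesh_tets_def)
    then obtain p q where pq: "p \<in> poly_fields m" "q \<in> poly_fields m"
      "AE x in lebesgue_on (convex hull C). \<xi> x = p x + cross3 x (q x)"
      using \<xi> unfolding nedelec_def m_def by blast
    have "AE x in lebesgue. x \<in> convex hull C \<longrightarrow> \<xi> x = p x + cross3 x (q x)"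
      using pq(3) tet_hull_lebesgue[OF cell_tet[OF C]] by (subst (asm) AE_restrict_space_iff) auto
    then show ?thesis using pq(1,2) unfolding local_nedelec_def
      by (intro exI[of _ "\<lambda>x. p x + cross3 x (q x)"]) blast
  qed
  then have "\<forall>C\<in>cells. \<exists>v. v \<in> local_nedelec m \<and> (AE x in lebesgue. x \<in> convex hull C \<longrightarrow> \<xi> x = v x)" by blast
  from bchoice[OF this] obtain v where
    v0: "\<forall>C\<in>cells. v C \<in> local_nedelec m \<and> (AE x in lebesgue. x \<in> convex hull C \<longrightarrow> \<xi> x = v C x)" ..
  have v: "v C \<in> local_nedelec m" and \<xi>v: "AE x in lebesgue. x \<in> convex hull C \<longrightarrow> \<xi> x = v C x" if "C \<in> cells" for C
    using v0 that by blast+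
  have \<xi>v': "AE x in lebesgue. x \<in> convex hull C \<longrightarrow> x \<in> \<Omega> \<longrightarrow> \<xi> x = v C x" if "C \<in> cells" for C
    using \<xi>v[OF that] by eventually_elim simp
  have vC1: "Ck_field 1 (v C)" if "C \<in> cells" for C
    by (rule poly_field_C1[OF local_nedelec_component[OF v[OF that]]])
  have "AE x in lebesgue. x \<in> convex hull C \<longrightarrow> x \<in> \<Omega> \<longrightarrow> w x = classical_curl (v C) x" if C: "C \<in> cells" for C
    by (rule weak_curl_on_cell[OF wc open_domain cell_tet[OF C] vC1[OF C] \<xi>v'[OF C]])
  then have wA: "AE x in lebesgue. \<forall>C\<in>cells. x \<in> convex hull C \<longrightarrow> x \<in> \<Omega> \<longrightarrow> w x = classical_curl (v C) x"
    by (intro AE_finite_allI finite_cells) auto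
  have \<xi>A: "AE x in lebesgue. \<forall>C\<in>cells. x \<in> convex hull C \<longrightarrow> \<xi> x = v C x"
    using \<xi>v by (intro AE_finite_allI finite_cells) auto
  define e where "e C = cell_int C (\<lambda>x. (norm (classical_curl (v C) x))\<^sup>2)" for C
  define f where "f C = cell_int C (\<lambda>x. (norm (v C x))\<^sup>2)" for C
  have e0: "e C \<ge> 0" and f0: "f C \<ge> 0" for C
    unfolding e_def f_def by (rule cell_int_nonneg, simp)+
  define R where "R = core D"
  have Rc: "R j \<subseteq> cells" for j by (auto simp: R_def core_def)
  have Rfin: "finite (R j)" for j using Rc finite_cells finite_subset by blast
  have Rm: "R j \<subseteq> R (Suc j)" for j unfolding R_def by (rule core_mono)
  have hull_D': "convex hull C \<subseteq> D'" if "C \<in> R j" "j \<le> N" for C j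
  proof
    fix x assume x: "x \<in> convex hull C"
    have "mesh_width \<T> \<ge> 0" using cell_diameter[of C x x] that(1) Rc x by auto
    then have "real (j + 2) * mesh_width \<T> \<le> real (N + 2) * mesh_width \<T>" using that(2) by (intro mult_right_mono) auto
    moreover have "infdist x D \<le> real (j + 2) * mesh_width \<T>" using that(1) x unfolding R_def by (rule core_infdist)
    ultimately have "infdist x D \<le> real (N + 2) * mesh_width \<T>" by linarith
    then show "x \<in> D'" using N by (intro infdist_less_imp_in[OF D(3,2)]) simp
  qed
  define E where "E j = (\<Sum>C\<in>R j. e C)" for j
  define M where "M j = (\<Sum>C\<in>R j. f C)" for j
  have E_diff: "E (Suc j) - E j = (\<Sum>C\<in>R (Suc j) - R j. e C)" and M_diff: "M (Suc j) - M j = (\<Sum>C\<in>R (Suc j) - R j. f C)" for j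
    unfolding E_def M_def using Rm Rfin by (simp_all add: sum_diff)
  have step: "(E j)\<^sup>2 \<le> \<kappa> * (E (Suc j) - E j) * (M (Suc j) - M j)" if j: "j < N" for j
  proof -
    define A where "A = layer D j"
    have "\<forall>C\<in>cells. \<exists>u. is_cut m C A (v C) u" using cut_exists[OF cell_tet v] by blast
    from bchoice[OF this] obtain u where u0: "\<forall>C\<in>cells. is_cut m C A (v C) (u C)" ..
    then have cut: "is_cut m C A (v C) (u C)" if "C \<in> cells" for C using that by blast
    have touch: "C \<in> R (Suc j)" if "C \<in> cells" "C \<inter> A \<noteq> {}" for C
      unfolding R_def using that touching_in_core by (simp add: A_def)
    have inside: "convex hull C \<subseteq> \<Omega>" if "C \<in> cells" "C \<inter> A \<noteq> {}" for C
      using hull_D'[OF touch[OF that]] j D(5) by auto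
    have test1: "glue cells u \<in> nedelec0 \<Omega> k \<T>"
      by (rule cut_test_field(1)[OF wc v \<xi>v' cut inside m_def])
    have test2: "AE x in lebesgue. \<forall>C\<in>cells. x \<in> convex hull C \<longrightarrow> x \<in> \<Omega> \<longrightarrow> weak_curl \<Omega> (glue cells u) x = classical_curl (u C) x"
      by (rule cut_test_field(2)[OF wc v \<xi>v' cut inside m_def])
    have uC1: "Ck_field 1 (u C)" if "C \<in> cells" for C
      using cut[OF that] local_nedelec_component poly_field_C1 unfolding is_cut_def by blast
    have u0: "u C = (\<lambda>x. 0)" if "C \<in> cells" "C \<notin> R (Suc j)" for C
      using cut_empty[OF cut[OF that(1)]] touch[OF that(1)] that(2) by blast
    have c0: "classical_curl (u C) x = 0" if "C \<in> cells" "C \<notin> R (Suc j)" for C x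
      using field_zero_outside[of "{}" "u C" x] u0[OF that] by simp
    have uv: "u C = v C" if "C \<in> R j" for C
    proof (rule cut_full[OF _ cut])
      show "tet C" "C \<in> cells" using that Rc cell_tet by blast+
      show "C \<subseteq> A" using that by (simp add: R_def core_def A_def)
    qed
    define ip where "ip C = cell_int C (\<lambda>x. classical_curl (v C) x \<bullet> classical_curl (u C) x)" for C
    have "L2_inner \<Omega> w (weak_curl \<Omega> (glue cells u)) = (\<Sum>C\<in>cells. ip C)"
      unfolding L2_inner_lebesgue[OF domain_measurable] ip_def
    proof (rule integral_cells)
      have g: "glue cells u \<in> Hcurl \<Omega>" using test1 by (simp add: nedelec0_def nedelec_def)
      then obtain w1 where "has_weak_curl \<Omega> (glue cells u) w1" by (auto simp: Hcurl_def)
      then have "has_weak_curl \<Omega> (glue cells u) (weak_curl \<Omega> (glue cells u))"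
        unfolding weak_curl_def by (rule someI[of "has_weak_curl \<Omega> (glue cells u)"])
      then have si: "square_integrable \<Omega> (weak_curl \<Omega> (glue cells u))" "square_integrable \<Omega> w"
        using wc by (auto simp: has_weak_curl_def)
      have "(\<lambda>x. (indicator \<Omega> x *\<^sub>R w x) \<bullet> (indicator \<Omega> x *\<^sub>R weak_curl \<Omega> (glue cells u) x)) \<in> borel_measurable lebesgue"
        by (intro borel_measurable_inner square_integrable_lebesgue si domain_measurable)
      moreover have "(\<lambda>x. (indicator \<Omega> x *\<^sub>R w x) \<bullet> (indicator \<Omega> x *\<^sub>R weak_curl \<Omega> (glue cells u) x)) =
         (\<lambda>x. indicator \<Omega> x * (w x \<bullet> weak_curl \<Omega> (glue cells u) x))"
        by (auto simp: indicator_def)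
      ultimately show "(\<lambda>x. indicator \<Omega> x * (w x \<bullet> weak_curl \<Omega> (glue cells u) x)) \<in> borel_measurable lebesgue" by simp
      show "AE x in lebesgue. \<forall>C\<in>cells. x \<in> convex hull C \<longrightarrow> x \<in> \<Omega> \<longrightarrow>
          w x \<bullet> weak_curl \<Omega> (glue cells u) x = classical_curl (v C) x \<bullet> classical_curl (u C) x"
        using wA test2 by eventually_elim simp
    next
      fix C x assume C: "C \<in> cells" "x \<in> convex hull C" "x \<notin> \<Omega>"
      then have "C \<notin> R (Suc j)" using hull_D'[of C "Suc j"] j D(5) by auto
      then show "classical_curl (v C) x \<bullet> classical_curl (u C) x = 0" using c0[OF C(1)] by simp
    next
      fix C assume "C \<in> cells"
      then show "continuous_on UNIV (\<lambda>x. classical_curl (v C) x \<bullet> classical_curl (u C) x)"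
        by (intro continuous_intros C1_curl_continuous vC1 uC1)
    qed
    then have "(\<Sum>C\<in>cells. ip C) = 0" using orth[OF test1] by (simp add: w_def)
    also have "(\<Sum>C\<in>cells. ip C) = (\<Sum>C\<in>R (Suc j). ip C)"
    proof (rule sum.mono_neutral_right[OF finite_cells Rc])
      show "\<forall>C\<in>cells - R (Suc j). ip C = 0" by (auto simp: ip_def c0 cell_int_def)
    qed
    also have "\<dots> = (\<Sum>C\<in>R (Suc j) - R j. ip C) + (\<Sum>C\<in>R j. ip C)"
      by (rule sum.subset_diff[OF Rm Rfin])
    also have "(\<Sum>C\<in>R j. ip C) = E j"
      unfolding E_def by (intro sum.cong refl) (simp add: ip_def e_def uv power2_norm_eq_inner)
    \<comment> \<open>On \<open>R j\<close> the cut is \<open>\<xi>\<close> itself and off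
      \<open>R (Suc j)\<close> it is zero, so orthogonality leaves only the ring between the two
      cores.\<close>
    finally have Ej: "E j = - (\<Sum>C\<in>R (Suc j) - R j. ip C)" by simp
    define P where "P = (\<Sum>C\<in>R (Suc j) - R j. e C)"
    define Q where "Q = (\<Sum>C\<in>R (Suc j) - R j. cell_int C (\<lambda>x. (norm (classical_curl (u C) x))\<^sup>2))"
    have "(E j)\<^sup>2 \<le> P * Q"
    proof (rule square_le_of_young)
      show "E j \<ge> 0" unfolding E_def by (intro sum_nonneg e0)
      show "P \<ge> 0" unfolding P_def by (intro sum_nonneg e0)
      show "Q \<ge> 0" unfolding Q_def by (intro sum_nonneg cell_int_nonneg) simp
      fix t :: real assume t: "t > 0"
      have "- 2 * ip C \<le> t * e C + cell_int C (\<lambda>x. (norm (classical_curl (u C) x))\<^sup>2) / t" if "C \<in> R (Suc j) - R j" for C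
      proof -
        have C: "C \<in> cells" using that Rc by blast
        note tC = cell_tet[OF C]
        let ?a = "classical_curl (v C)" and ?b = "classical_curl (u C)"
        have ca: "continuous_on UNIV ?a" and cb: "continuous_on UNIV ?b"
          by (intro C1_curl_continuous vC1 uC1 C)+
        have ia: "integrable lborel (\<lambda>x. indicator (convex hull C) x * (norm (?a x))\<^sup>2)"
          and ib: "integrable lborel (\<lambda>x. indicator (convex hull C) x * (norm (?b x))\<^sup>2)"
          and iab: "integrable lborel (\<lambda>x. indicator (convex hull C) x * (?a x \<bullet> ?b x))"
          by (intro cell_integrable_lborel[OF tC] continuous_intros ca cb)+
        have "cell_int C (\<lambda>x. - 2 * (?a x \<bullet> ?b x)) \<le> cell_int C (\<lambda>x. t * (norm (?a x))\<^sup>2 + (norm (?b x))\<^sup>2 / t)"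
        proof (rule cell_int_mono[OF tC])
          show "continuous_on UNIV (\<lambda>x. - 2 * (?a x \<bullet> ?b x))" "continuous_on UNIV (\<lambda>x. t * (norm (?a x))\<^sup>2 + (norm (?b x))\<^sup>2 / t)"
            using t by (intro continuous_intros ca cb; simp)+
          fix x
          show "- 2 * (?a x \<bullet> ?b x) \<le> t * (norm (?a x))\<^sup>2 + (norm (?b x))\<^sup>2 / t" by (rule inner_young[OF t])
        qed
        also have "cell_int C (\<lambda>x. t * (norm (?a x))\<^sup>2 + (norm (?b x))\<^sup>2 / t) = t * e C + cell_int C (\<lambda>x. (norm (?b x))\<^sup>2) / t"
          using ia ib by (simp add: cell_int_def e_def distrib_left mult.left_commute[of _ t])
        also have "cell_int C (\<lambda>x. - 2 * (?a x \<bullet> ?b x)) = - 2 * ip C"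
          using iab by (simp add: cell_int_def ip_def mult.left_commute[of _ 2])
        finally show ?thesis .
      qed
      then have "(\<Sum>C\<in>R (Suc j) - R j. - 2 * ip C) \<le> (\<Sum>C\<in>R (Suc j) - R j. t * e C + cell_int C (\<lambda>x. (norm (classical_curl (u C) x))\<^sup>2) / t)"
        by (rule sum_mono)
      then show "2 * E j \<le> t * P + Q / t"
        by (simp add: Ej P_def Q_def sum.distrib sum_distrib_left sum_divide_distrib sum_negf)
    qed
    \<comment> \<open>Stability is local to each element, so the curl of the cut on the ring is paid
      for by the mass of \<open>\<xi>\<close> on the same ring.\<close>
    also have "P * Q \<le> P * (\<kappa> * (M (Suc j) - M j))"
    proof (rule mult_left_mono)
      show "P \<ge> 0" unfolding P_def by (intro sum_nonneg e0)
      show "Q \<le> \<kappa> * (M (Suc j) - M j)"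
        unfolding Q_def M_diff sum_distrib_left f_def
        using stable[folded m_def, OF _ v cut] Rc by (intro sum_mono) blast
    qed
    finally show ?thesis by (simp add: P_def E_diff mult_ac)
  qed
  \<comment> \<open>For \<open>A = UNIV\<close> the cut is the field itself, and stability becomes
    an inverse inequality.\<close>
  have last: "E N \<le> \<kappa> * M N"
    unfolding E_def M_def sum_distrib_left
  proof (rule sum_mono)
    fix C assume "C \<in> R N"
    then have C: "C \<in> cells" using Rc by blast
    obtain u where u: "is_cut m C UNIV (v C) u" using cut_exists[OF cell_tet[OF C] v[OF C]] by blast
    have "u = v C" using cut_full[OF cell_tet[OF C] u] by simp
    then show "e C \<le> \<kappa> * f C"
      unfolding e_def f_def using stable[folded m_def, OF C v[OF C] u] by simp
  qed
  have main: "E 0 * (real N)\<^sup>2 \<le> 8 * \<kappa> * M N"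
  proof (rule discrete_riccati[OF _ _ _ _ \<kappa> step last])
    show "E j \<le> E (Suc j)" "M j \<le> M (Suc j)" for j
      unfolding E_def M_def using Rm Rfin e0 f0 by (auto intro!: sum_mono2)
    show "E 0 \<ge> 0" "M 0 \<ge> 0" unfolding E_def M_def by (intro sum_nonneg e0 f0)+
  qed
  have si: "square_integrable \<Omega> \<xi>" "square_integrable \<Omega> w" using wc by (auto simp: has_weak_curl_def)
  have norm_sq: "(L2_norm U g)\<^sup>2 = (\<integral>x. indicator U x * (norm (g x))\<^sup>2 \<partial>lebesgue)"
    and norm_int: "integrable lebesgue (\<lambda>x. indicator U x * (norm (g x))\<^sup>2)"
    if g: "square_integrable \<Omega> g" and U: "open U" "U \<subseteq> \<Omega>" for g U
  proof -
    have Um: "U \<in> sets lebesgue" using U(1) by (simp add: sets_completionI_sets)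
    have "(\<integral>x. indicator U x *\<^sub>R (norm (g x))\<^sup>2 \<partial>lebesgue) \<ge> 0"
      by (rule Bochner_Integration.integral_nonneg) simp
    then show "(L2_norm U g)\<^sup>2 = (\<integral>x. indicator U x * (norm (g x))\<^sup>2 \<partial>lebesgue)"
      unfolding L2_norm_def using Um by (subst integral_restrict_space) auto
    have "integrable lebesgue (\<lambda>x. indicator U x *\<^sub>R (indicator \<Omega> x * (norm (g x))\<^sup>2))"
      by (rule integrable_mult_indicator[OF Um square_integrable_lebesgue(2)[OF g domain_measurable]])
    moreover have "(\<lambda>x. indicator U x *\<^sub>R (indicator \<Omega> x * (norm (g x))\<^sup>2)) = (\<lambda>x. indicator U x * (norm (g x))\<^sup>2)"
      using U(2) by (auto simp: indicator_def fun_eq_iff)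
    ultimately show "integrable lebesgue (\<lambda>x. indicator U x * (norm (g x))\<^sup>2)" by simp
  qed
  have intc: "integrable lebesgue (\<lambda>x. indicator (convex hull C) x * (norm (classical_curl (v C) x))\<^sup>2)"
    and intv: "integrable lebesgue (\<lambda>x. indicator (convex hull C) x * (norm (v C x))\<^sup>2)" if "C \<in> cells" for C
    by (intro cell_integrable cell_tet continuous_intros C1_curl_continuous C1_continuous vC1 that)+
  \<comment> \<open>The elements meeting \<open>D\<close> all belong to \<open>R 0\<close>, so they
    cover \<open>D\<close>.\<close>
  have lower: "(L2_norm D w)\<^sup>2 \<le> E 0"
  proof -
    have "(L2_norm D w)\<^sup>2 \<le> (\<integral>x. (\<Sum>C\<in>R 0. indicator (convex hull C) x * (norm (classical_curl (v C) x))\<^sup>2) \<partial>lebesgue)"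
      unfolding norm_sq[OF si(2) D(1) DO]
    proof (rule integral_mono_AE)
      show "integrable lebesgue (\<lambda>x. indicator D x * (norm (w x))\<^sup>2)" by (rule norm_int[OF si(2) D(1) DO])
      show "integrable lebesgue (\<lambda>x. \<Sum>C\<in>R 0. indicator (convex hull C) x * (norm (classical_curl (v C) x))\<^sup>2)"
        using Rc by (intro Bochner_Integration.integrable_sum intc) auto
      show "AE x in lebesgue. indicator D x * (norm (w x))\<^sup>2 \<le> (\<Sum>C\<in>R 0. indicator (convex hull C) x * (norm (classical_curl (v C) x))\<^sup>2)"
        using wA
      proof eventually_elim
        case (elim x)
        show ?case
        proof (cases "x \<in> D")
          case True
          then obtain C where C: "C \<in> cells" "x \<in> convex hull C" using cells_cover DO by blast
          then have CR: "C \<in> R 0" using touching_in_core_0 True by (simp add: R_def)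
          have "indicator D x * (norm (w x))\<^sup>2 = indicator (convex hull C) x * (norm (classical_curl (v C) x))\<^sup>2"
            using elim C True DO by auto
          also have "\<dots> \<le> (\<Sum>C\<in>R 0. indicator (convex hull C) x * (norm (classical_curl (v C) x))\<^sup>2)"
            using CR Rfin by (intro member_le_sum[of C "R 0" "\<lambda>C. indicator (convex hull C) x * (norm (classical_curl (v C) x))\<^sup>2"]) auto
          finally show ?thesis .
        qed (simp add: sum_nonneg)
      qed
    qed
    also have "\<dots> = E 0"
      unfolding E_def e_def using Rc
      by (subst Bochner_Integration.integral_sum) (auto intro!: intc sum.cong cell_int_lebesgue[symmetric] cell_tet continuous_intros C1_curl_continuous vC1)
    finally show ?thesis .
  qed
  have D'm: "open D'" "D' \<subseteq> \<Omega>" by fact+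
  \<comment> \<open>The elements of \<open>R N\<close> lie in \<open>D'\<close> and overlap only in
    null sets, so the sum counts almost every point at most once.\<close>
  have upper: "M N \<le> (L2_norm D' \<xi>)\<^sup>2"
  proof -
    have "M N = (\<integral>x. (\<Sum>C\<in>R N. indicator (convex hull C) x * (norm (v C x))\<^sup>2) \<partial>lebesgue)"
      unfolding M_def f_def using Rc
      by (subst Bochner_Integration.integral_sum) (auto intro!: intv sum.cong cell_int_lebesgue cell_tet continuous_intros C1_continuous vC1)
    also have "\<dots> \<le> (L2_norm D' \<xi>)\<^sup>2"
      unfolding norm_sq[OF si(1) D'm]
    proof (rule integral_mono_AE)
      show "integrable lebesgue (\<lambda>x. indicator D' x * (norm (\<xi> x))\<^sup>2)" by (rule norm_int[OF si(1) D'm])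
      show "integrable lebesgue (\<lambda>x. \<Sum>C\<in>R N. indicator (convex hull C) x * (norm (v C x))\<^sup>2)"
        using Rc by (intro Bochner_Integration.integrable_sum intv) auto
      show "AE x in lebesgue. (\<Sum>C\<in>R N. indicator (convex hull C) x * (norm (v C x))\<^sup>2) \<le> indicator D' x * (norm (\<xi> x))\<^sup>2"
        using \<xi>A mesh_AE_disjoint[OF tri]
      proof eventually_elim
        case (elim x)
        show ?case
        proof (cases "\<exists>C\<in>R N. x \<in> convex hull C")
          case True
          then obtain C where C: "C \<in> R N" "x \<in> convex hull C" by blast
          have Cc: "C \<in> cells" using C Rc by blast
          have "(\<Sum>B\<in>R N. indicator (convex hull B) x * (norm (v B x))\<^sup>2) = (\<Sum>B\<in>R N. if B = C then (norm (v C x))\<^sup>2 else 0)"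
          proof (intro sum.cong refl)
            fix B assume "B \<in> R N"
            then have "B \<in> cells" using Rc by blast
            then show "indicator (convex hull B) x * (norm (v B x))\<^sup>2 = (if B = C then (norm (v C x))\<^sup>2 else 0)"
              using elim(2) C(2) Cc by (auto simp: indicator_def)
          qed
          also have "\<dots> = (norm (\<xi> x))\<^sup>2" using elim(1) C Cc Rfin by simp
          also have "\<dots> = indicator D' x * (norm (\<xi> x))\<^sup>2" using hull_D'[OF C(1)] C(2) by auto
          finally show ?thesis by simp
        next
          case False
          then have "(\<Sum>C\<in>R N. indicator (convex hull C) x * (norm (v C x))\<^sup>2) = 0" by (intro sum.neutral) auto
          then show ?thesis by simp
        qed
      qed
    qed
    finally show ?thesis .
  qed
  have "(L2_norm D w)\<^sup>2 * (real N)\<^sup>2 \<le> E 0 * (real N)\<^sup>2" using lower by (intro mult_right_mono) auto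
  also have "\<dots> \<le> 8 * \<kappa> * M N" by (rule main)
  also have "\<dots> \<le> 8 * \<kappa> * (L2_norm D' \<xi>)\<^sup>2" using upper \<kappa> by (intro mult_left_mono) auto
  finally show ?thesis by (simp add: w_def)
qed

end

text \<open>The constant depends on \<open>k\<close> through \<open>K\<close> and on
  \<open>\<sigma>\<close> and \<open>\<tau>\<close> through \<open>g\<close>; one value serves all
  \<open>c \<ge> 6\<close>. The threshold 6 ensures that the number of available layers is
  comparable to \<open>d / h\<close>.\<close>

theorem lemma3p10:
  fixes \<Omega> :: "(real^3) set" and k :: nat and \<sigma> \<tau> :: real
  assumes "lipschitz_polyhedral_domain \<Omega>" and "k \<ge> 1"
  shows "\<exists>c0>0. \<forall>c\<ge>c0. \<exists>C>0. \<forall>\<M> :: (real^3) set set set.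
     (\<forall>\<T>\<in>\<M>. tetrahedral_mesh \<Omega> \<T>) \<and> shape_regular \<sigma> \<M> \<and> quasi_uniform \<tau> \<M> \<longrightarrow>
     (\<forall>\<T>\<in>\<M>. \<forall>\<Omega>' \<Omega>'' :: (real^3) set. \<forall>d :: real.
        open \<Omega>' \<and> \<Omega>' \<noteq> {} \<and> open \<Omega>'' \<and>
        compactly_contained \<Omega>' \<Omega>'' \<and> compactly_contained \<Omega>'' \<Omega> \<and>
        d = setdist (frontier \<Omega>') (frontier \<Omega>'') \<and> d > c * mesh_width \<T> \<longrightarrow>
        (\<forall>\<xi> \<in> nedelec \<Omega> k \<T>.
           (\<forall>\<psi> \<in> nedelec0 \<Omega> k \<T>. L2_inner \<Omega> (weak_curl \<Omega> \<xi>) (weak_curl \<Omega> \<psi>) = 0) \<longrightarrow>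
           L2_norm \<Omega>' (weak_curl \<Omega> \<xi>) \<le> C * inverse d * L2_norm \<Omega>'' \<xi>))"
proof -
  obtain K where K: "K > 0" and stab: "\<And>C A v u G h. tet C \<Longrightarrow> v \<in> local_nedelec (k - 1) \<Longrightarrow> is_cut (k - 1) C A v u \<Longrightarrow>
     (\<forall>c\<in>C. norm (grad C c) \<le> G) \<Longrightarrow> (\<forall>a\<in>C. \<forall>b\<in>C. norm (a - b) \<le> h) \<Longrightarrow>
     cell_int C (\<lambda>x. (norm (classical_curl u x))\<^sup>2) \<le> K * G\<^sup>2 * (G * h)\<^sup>2 * cell_int C (\<lambda>x. (norm (v x))\<^sup>2)"
    using cut_stability[of "k - 1"] by blast
  define g where "g = \<bar>\<tau> * \<sigma>\<bar>"
  \<comment> \<open>\<open>128 = 8 * 16\<close>, with 8 from the Riccati inequality and 16 from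
    squaring \<open>d \<le> 4 * (real N * H)\<close>; the added 1 keeps the constant positive even
    for \<open>g = 0\<close>.\<close>
  define C0 where "C0 = sqrt (128 * K * g ^ 4) + 1"
  have C0: "C0 > 0" using K by (simp add: C0_def add_nonneg_pos)
  have est: "L2_norm D (weak_curl \<Omega> \<xi>) \<le> C0 * inverse d * L2_norm D' \<xi>"
    if mesh: "tetrahedral_mesh \<Omega> \<T>" and sr: "\<And>T. T \<in> \<T> \<Longrightarrow> diameter T \<le> \<sigma> * inball_diameter T"
      and qu: "\<And>T. T \<in> \<T> \<Longrightarrow> mesh_width \<T> \<le> \<tau> * diameter T"
      and D: "open D" "D \<noteq> {}" "open D'" "compactly_contained D D'" "compactly_contained D' \<Omega>"
      and d: "d = setdist (frontier D) (frontier D')" "d > c * mesh_width \<T>" and c: "c \<ge> 6"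
      and \<xi>: "\<xi> \<in> nedelec \<Omega> k \<T>" and orth: "\<And>\<psi>. \<psi> \<in> nedelec0 \<Omega> k \<T> \<Longrightarrow> L2_inner \<Omega> (weak_curl \<Omega> \<xi>) (weak_curl \<Omega> \<psi>) = 0"
    for \<T> D D' d \<xi> c
  proof -
    have op: "open \<Omega>" using assms(1) by (simp add: lipschitz_polyhedral_domain_def)
    interpret tet_mesh \<Omega> \<T> by standard (fact op, fact mesh)
    have cc: "closure D \<subseteq> D'" "D' \<subseteq> \<Omega>"
      using D closure_subset by (auto simp: compactly_contained_def)
    obtain x where "x \<in> D" using D(2) by blast
    then have "x \<in> \<Omega>" using cc closure_subset by blast
    then obtain C where C: "C \<in> cells" using cells_cover by blast
    define H where "H = mesh_width \<T>"
    have H0: "H > 0"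
    proof -
      have "card C = 4" using cell_tet[OF C] by (simp add: tet_def)
      then obtain a b where ab: "a \<in> C" "b \<in> C" "a \<noteq> b"
        by (metis One_nat_def card_le_Suc0_iff_eq card.infinite numeral_le_one_iff semiring_norm(69) zero_neq_numeral)
      then have "0 < dist a b" by simp
      also have "\<dots> \<le> H" unfolding H_def by (rule cell_diameter[OF C]) (use ab in \<open>auto intro: hull_inc\<close>)
      finally show ?thesis .
    qed
    have d6: "d > 6 * H"
    proof -
      have "6 * H \<le> c * H" using c H0 by (intro mult_right_mono) auto
      then show ?thesis using d(2) by (simp add: H_def)
    qed
    have d0: "d > 0" using d6 H0 by linarith
    \<comment> \<open>Two mesh widths are those demanded by \<open>caccioppoli\<close>, and the
      third makes its inequality strict after rounding down. As \<open>d / H > 6\<close>,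
      \<open>N\<close> is at least 3, so that \<open>d / H < N + 4 \<le> 4 * N\<close>.\<close>
    define N where "N = nat \<lfloor>d / H\<rfloor> - 3"
    have r6: "6 < d / H" using d6 H0 by (simp add: pos_less_divide_eq)
    have fl: "real_of_int \<lfloor>d / H\<rfloor> \<le> d / H" "d / H < real_of_int \<lfloor>d / H\<rfloor> + 1" by linarith+
    have "\<lfloor>d / H\<rfloor> \<ge> 6" using r6 by (simp add: le_floor_iff)
    then have Nr: "real N = real_of_int \<lfloor>d / H\<rfloor> - 3" by (simp add: N_def of_nat_diff le_nat_iff)
    have N1: "real (N + 2) * H < d"
    proof -
      have "real (N + 2) = real N + 2" by simp
      then have "real (N + 2) < d / H" using Nr fl by linarith
      then show ?thesis using H0 by (simp add: pos_less_divide_eq)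
    qed
    have N2: "d \<le> 4 * (real N * H)"
    proof -
      have "d / H \<le> 4 * real N" using Nr fl r6 by linarith
      then show ?thesis using H0 by (simp add: pos_divide_le_eq mult.assoc)
    qed
    \<comment> \<open>This equals \<open>K * g ^ 4 / H\<^sup>2\<close>; the unreduced form is that
      of \<open>cut_stability\<close> with \<open>G = g / H\<close> and
      \<open>h = H\<close>.\<close>
    define \<kappa> where "\<kappa> = K * (g / H)\<^sup>2 * (g / H * H)\<^sup>2"
    have k0: "\<kappa> \<ge> 0" using K by (simp add: \<kappa>_def)
    have stable: "cell_int C (\<lambda>x. (norm (classical_curl u x))\<^sup>2) \<le> \<kappa> * cell_int C (\<lambda>x. (norm (v x))\<^sup>2)"
      if C: "C \<in> cells" and v: "v \<in> local_nedelec (k - 1)" and cut: "is_cut (k - 1) C A v u" for C A v u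
      unfolding \<kappa>_def
    proof (rule stab[OF cell_tet[OF C] v cut])
      have T: "convex hull C \<in> \<T>" using C by (simp add: mesh_tets_def)
      have "diameter (convex hull C) \<le> H"
        unfolding H_def mesh_width_def using T tri by (intro Max_ge) (auto simp: triangulation_def)
      then show "\<forall>c\<in>C. norm (grad C c) \<le> g / H"
        unfolding g_def using grad_bound[OF cell_tet[OF C] _ sr[OF T] qu[OF T, folded H_def] H0] by blast
      show "\<forall>a\<in>C. \<forall>b\<in>C. norm (a - b) \<le> H"
        using cell_diameter[OF C] unfolding H_def dist_norm by (auto intro: hull_inc)
    qed
    have "(L2_norm D (weak_curl \<Omega> \<xi>))\<^sup>2 * (real N)\<^sup>2 \<le> 8 * \<kappa> * (L2_norm D' \<xi>)\<^sup>2"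
      by (rule caccioppoli[OF assms(2) \<xi> orth D(1,2) cc(1) D(3) cc(2) N1[unfolded H_def d(1)] k0 stable])
    then have "(L2_norm D (weak_curl \<Omega> \<xi>))\<^sup>2 * (real N)\<^sup>2 * H\<^sup>2 \<le> 8 * \<kappa> * (L2_norm D' \<xi>)\<^sup>2 * H\<^sup>2"
      by (intro mult_right_mono) auto
    also have "8 * \<kappa> * (L2_norm D' \<xi>)\<^sup>2 * H\<^sup>2 = 8 * K * g ^ 4 * (L2_norm D' \<xi>)\<^sup>2"
      using H0 by (simp add: \<kappa>_def power_divide power_mult_distrib power4_eq_xxxx power2_eq_square)
    finally have A: "(L2_norm D (weak_curl \<Omega> \<xi>))\<^sup>2 * (real N * H)\<^sup>2 \<le> 8 * K * g ^ 4 * (L2_norm D' \<xi>)\<^sup>2"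
      by (simp add: power_mult_distrib mult.assoc)
    have "d\<^sup>2 \<le> (4 * (real N * H))\<^sup>2" using N2 d0 by (intro power_mono) auto
    then have "(L2_norm D (weak_curl \<Omega> \<xi>))\<^sup>2 * d\<^sup>2 \<le> (L2_norm D (weak_curl \<Omega> \<xi>))\<^sup>2 * (16 * (real N * H)\<^sup>2)"
      by (intro mult_left_mono) (auto simp: power_mult_distrib)
    also have "\<dots> = 16 * ((L2_norm D (weak_curl \<Omega> \<xi>))\<^sup>2 * (real N * H)\<^sup>2)" by simp
    also have "\<dots> \<le> 16 * (8 * K * g ^ 4 * (L2_norm D' \<xi>)\<^sup>2)" by (rule mult_left_mono[OF A]) simp
    finally have "(L2_norm D (weak_curl \<Omega> \<xi>) * d)\<^sup>2 \<le> 128 * K * g ^ 4 * (L2_norm D' \<xi>)\<^sup>2"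
      by (simp add: power_mult_distrib)
    then have "sqrt ((L2_norm D (weak_curl \<Omega> \<xi>) * d)\<^sup>2) \<le> sqrt (128 * K * g ^ 4 * (L2_norm D' \<xi>)\<^sup>2)"
      by (rule real_sqrt_le_mono)
    moreover have n0: "L2_norm U h \<ge> 0" for U h by (simp add: L2_norm_def)
    ultimately have "L2_norm D (weak_curl \<Omega> \<xi>) * d \<le> sqrt (128 * K * g ^ 4) * L2_norm D' \<xi>"
      using d0 n0[of D' \<xi>] n0[of D "weak_curl \<Omega> \<xi>"] by (simp add: real_sqrt_mult)
    also have "\<dots> \<le> C0 * L2_norm D' \<xi>" unfolding C0_def using n0 by (intro mult_right_mono) auto
    finally show ?thesis using d0 by (simp add: field_simps)
  qed
  show ?thesis
  proof (rule exI[of _ 6], intro conjI allI impI)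
    show "(6::real) > 0" by simp
    fix c :: real assume c: "6 \<le> c"
    show "\<exists>C>0. \<forall>\<M> :: (real^3) set set set.
     (\<forall>\<T>\<in>\<M>. tetrahedral_mesh \<Omega> \<T>) \<and> shape_regular \<sigma> \<M> \<and> quasi_uniform \<tau> \<M> \<longrightarrow>
     (\<forall>\<T>\<in>\<M>. \<forall>\<Omega>' \<Omega>'' :: (real^3) set. \<forall>d :: real.
        open \<Omega>' \<and> \<Omega>' \<noteq> {} \<and> open \<Omega>'' \<and>
        compactly_contained \<Omega>' \<Omega>'' \<and> compactly_contained \<Omega>'' \<Omega> \<and>
        d = setdist (frontier \<Omega>') (frontier \<Omega>'') \<and> d > c * mesh_width \<T> \<longrightarrow>
        (\<forall>\<xi> \<in> nedelec \<Omega> k \<T>.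
           (\<forall>\<psi> \<in> nedelec0 \<Omega> k \<T>. L2_inner \<Omega> (weak_curl \<Omega> \<xi>) (weak_curl \<Omega> \<psi>) = 0) \<longrightarrow>
           L2_norm \<Omega>' (weak_curl \<Omega> \<xi>) \<le> C * inverse d * L2_norm \<Omega>'' \<xi>))"
    proof (intro exI[of _ C0] conjI allI impI ballI C0)
      fix \<M> :: "(real^3) set set set" and \<T> D D' d \<xi>
      assume "(\<forall>\<T>\<in>\<M>. tetrahedral_mesh \<Omega> \<T>) \<and> shape_regular \<sigma> \<M> \<and> quasi_uniform \<tau> \<M>"
        "\<T> \<in> \<M>" and h: "open D \<and> D \<noteq> {} \<and> open D' \<and> compactly_contained D D' \<and> compactly_contained D' \<Omega> \<and>
        d = setdist (frontier D) (frontier D') \<and> c * mesh_width \<T> < d"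
        and \<xi>: "\<xi> \<in> nedelec \<Omega> k \<T>" "\<forall>\<psi>\<in>nedelec0 \<Omega> k \<T>. L2_inner \<Omega> (weak_curl \<Omega> \<xi>) (weak_curl \<Omega> \<psi>) = 0"
      then have mesh: "tetrahedral_mesh \<Omega> \<T>" and sr: "\<And>T. T \<in> \<T> \<Longrightarrow> diameter T \<le> \<sigma> * inball_diameter T"
        and qu: "\<And>T. T \<in> \<T> \<Longrightarrow> mesh_width \<T> \<le> \<tau> * diameter T"
        unfolding shape_regular_def quasi_uniform_def by blast+
      show "L2_norm D (weak_curl \<Omega> \<xi>) \<le> C0 * inverse d * L2_norm D' \<xi>"
        by (rule est[OF mesh sr qu _ _ _ _ _ _ _ c \<xi>(1)]) (use h \<xi>(2) in auto)
    qed
  qed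
qed

end
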